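(* Let $A$ be a graded algebra and $B$ a graded factor algebra of $A$. Assume that $B$ is $\mathcal{K}_2$ as a (left) $A$-module and also $\mathcal{K}_2$ as an algebra. Then $A$ is $\mathcal{K}_2$.
   Context: Conventions. $K$ is a field. A "graded algebra" is a connected $\mathbb{N}$-graded $K$-algebra of the form $A=T(V)/I$, where $V$ is a finite-dimensional $K$-vector space placed in degree 1, $T(V)$ is its tensor algebra, and $I$ is an ideal generated by a (minimal) finite set of homogeneous elements of degree at least 2 (not necessarily all of the same degree). The field $K$ is identified with the trivial $A$-module $A/A_+$. The bigraded Yoneda algebra is $E(A)=\bigoplus_{n,m} E^{n,m}(A)$ with $E^{n,m}(A)=\mathrm{Ext}_A^{n}(K,K)_{-m}$ ($n$ is the cohomological degree, $-m$ the internal degree; Ext is computed in the category of $\mathbb{Z}$-graded locally finite $A$-modules with graded Hom spaces), with the Yoneda (cup) product; $E^n(A)=\bigoplus_m E^{n,m}(A)$. The graded algebra $A$ is called $\mathcal{K}_2$ (as an algebra) if $E(A)$ is generated as an algebra by $E^1(A)$ and $E^2(A)$. $\mathcal{K}_2$-modules. Put $I'=I\otimes V+V\otimes I$. Let $W$ be a graded left $A$-module (here $W=B$, an $A$-module via the quotient map $A\to B$) and let $Q^*\to W\to 0$ be a minimal graded projective (free) resolution of $W$ over $A$. Choose homogeneous bases of the $Q^n$ and let the maps $Q^n\to Q^{n-1}$ be given, for $n\ge 1$, by (right multiplication of row vectors by) matrices $M_n$ with homogeneous entries in $T(V)$, i.e. lifted from $A$ to $T(V)$. Let $L_n$ be $M_n$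 modulo $T(V)_{\ge 2}$ (linear part). For $n\ge 2$ let $E_n$ be $M_nM_{n-1}$ (whose entries lie in $I$) modulo $I'$, and let $E_1=0$. $[L_n:E_n]$ is the matrix obtained by concatenating the rows of $L_n$ and $E_n$. $W$ is a $\mathcal{K}_2$ $A$-module if for all $1\le n\le \mathrm{pd}_A(W)$ (projective dimension, possibly infinite), the rows of $[L_n:E_n]$ are linearly independent over $K$. *)

theory Defs
  imports "HOL-Library.Poly_Mapping"
begin

section \<open>Graded algebras\<close>

text \<open>
  A finite-dimensional space \<open>V\<close> is given by a basis \<open>X\<close>. The tensor algebra \<open>T(V)\<close> is the free
  algebra on \<open>X\<close>: finitely supported functions on words over \<open>X\<close>, multiplied by convolution with
  respect to concatenation. The latter is the product of \<^theory>\<open>HOL-Library.Poly_Mapping\<close> once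
  lists are regarded as an additive monoid.
\<close>

instantiation list :: (type) monoid_add
begin
definition zero_list :: "'a list" where "zero_list = []"
definition plus_list :: "'a list \<Rightarrow> 'a list \<Rightarrow> 'a list" where "plus_list = (@)"
instance by standard (simp_all add: zero_list_def plus_list_def)
end

type_synonym ('x, 'k) tensor = "'x list \<Rightarrow>\<^sub>0 'k"

definition tensor_algebra :: "'x set \<Rightarrow> ('x, 'k::field) tensor set" where
  "tensor_algebra X = {p. Poly_Mapping.keys p \<subseteq> lists X}"

definition const_coeff :: "('x, 'k::field) tensor \<Rightarrow> 'k" where
  "const_coeff p = Poly_Mapping.lookup p []"

definition tensor_plus :: "'x set \<Rightarrow> ('x, 'k::field) tensor set" where
  "tensor_plus X = {p \<in> tensor_algebra X. const_coeff p = 0}"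

definition homogeneous :: "int \<Rightarrow> ('x, 'k::field) tensor \<Rightarrow> bool" where
  "homogeneous d p \<longleftrightarrow> (\<forall>w \<in> Poly_Mapping.keys p. int (length w) = d)"

definition two_sided_ideal :: "'x set \<Rightarrow> ('x, 'k::field) tensor set \<Rightarrow> bool" where
  "two_sided_ideal X I \<longleftrightarrow> I \<subseteq> tensor_algebra X \<and> 0 \<in> I \<and> (\<forall>p\<in>I. \<forall>q\<in>I. p + q \<in> I) \<and>
     (\<forall>p\<in>I. \<forall>a\<in>tensor_algebra X. \<forall>b\<in>tensor_algebra X. a * p * b \<in> I)"

definition generated_ideal :: "'x set \<Rightarrow> ('x, 'k::field) tensor set \<Rightarrow> ('x, 'k) tensor set" where
  "generated_ideal X G = \<Inter>{I. two_sided_ideal X I \<and> G \<subseteq> I}"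

text \<open>\<open>A = T(V)/I\<close> is represented by the pair \<open>X, I\<close>.\<close>

definition graded_algebra :: "'x set \<Rightarrow> ('x, 'k::field) tensor set \<Rightarrow> bool" where
  "graded_algebra X I \<longleftrightarrow> finite X \<and>
     (\<exists>G. finite G \<and> G \<subseteq> tensor_algebra X \<and> (\<forall>g\<in>G. \<exists>d\<ge>2. homogeneous d g) \<and>
          I = generated_ideal X G)"

text \<open>
  A connected graded factor algebra of \<open>T(V)/I\<close> is \<open>T(V)/J\<close> with \<open>J\<close> a proper homogeneous ideal
  containing \<open>I\<close>. The ideal \<open>J\<close> may contain elements of degree 1.
\<close>

definition graded_factor_algebra ::
    "'x set \<Rightarrow> ('x, 'k::field) tensor set \<Rightarrow> ('x, 'k) tensor set \<Rightarrow> bool" where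
  "graded_factor_algebra X I J \<longleftrightarrow> two_sided_ideal X J \<and> I \<subseteq> J \<and> J \<noteq> tensor_algebra X \<and>
     (\<forall>p\<in>J. \<exists>H. finite H \<and> H \<subseteq> J \<and> (\<forall>h\<in>H. \<exists>d. homogeneous d h) \<and> p = \<Sum>H)"


section \<open>Rows, matrices and graded modules\<close>

text \<open>
  Elements of a free module with basis \<open>S \<subseteq> \<nat>\<close> are finitely supported rows; a matrix is a family of
  rows and acts on rows from the right. Throughout, rows and matrices over \<open>A\<close> are represented by
  rows and matrices over \<open>T(V)\<close>, and equality over \<open>A\<close> is congruence modulo \<open>I\<close>.
\<close>

type_synonym ('x, 'k) row = "nat \<Rightarrow>\<^sub>0 ('x, 'k) tensor"
type_synonym ('x, 'k) matrix = "nat \<Rightarrow> ('x, 'k) row"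

definition rows :: "('x, 'k::field) tensor set \<Rightarrow> nat set \<Rightarrow> ('x, 'k) row set" where
  "rows C S = {u. Poly_Mapping.keys u \<subseteq> S \<and> (\<forall>i\<in>S. Poly_Mapping.lookup u i \<in> C)}"

definition row_scale :: "('x, 'k::field) tensor \<Rightarrow> ('x, 'k) row \<Rightarrow> ('x, 'k) row" where
  "row_scale a u = Poly_Mapping.map ((*) a) u"

definition row_mult :: "('x, 'k::field) row \<Rightarrow> ('x, 'k) matrix \<Rightarrow> ('x, 'k) row" (infixl "\<star>" 70) where
  "u \<star> M = (\<Sum>i\<in>Poly_Mapping.keys u. row_scale (Poly_Mapping.lookup u i) (M i))"

definition mat_mult :: "('x, 'k::field) matrix \<Rightarrow> ('x, 'k) matrix \<Rightarrow> ('x, 'k) matrix" where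
  "mat_mult M N = (\<lambda>i. M i \<star> N)"

definition homogeneous_row :: "(nat \<Rightarrow> int) \<Rightarrow> int \<Rightarrow> ('x, 'k::field) row \<Rightarrow> bool" where
  "homogeneous_row deg d u \<longleftrightarrow> (\<forall>j. homogeneous (d - deg j) (Poly_Mapping.lookup u j))"

text \<open>
  A graded left \<open>A\<close>-module is presented as the free graded \<open>T(V)\<close>-module on \<open>gens\<close> modulo a
  graded submodule \<open>rels\<close> that contains \<open>I\<close> times the free module. The condition on degrees
  makes the module locally finite and bounded below.
\<close>

record (overloaded) ('x, 'k) gmodule =
  gens :: "nat set"
  gdeg :: "nat \<Rightarrow> int"
  rels :: "('x, 'k) row set"

definition graded_module :: "'x set \<Rightarrow> ('x, 'k::field) tensor set \<Rightarrow> ('x, 'k) gmodule \<Rightarrow> bool" where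
  "graded_module X I W \<longleftrightarrow>
     (\<forall>m. finite {i \<in> gens W. gdeg W i \<le> m}) \<and>
     rows I (gens W) \<subseteq> rels W \<and> rels W \<subseteq> rows (tensor_algebra X) (gens W) \<and>
     (\<forall>u\<in>rels W. \<forall>v\<in>rels W. u + v \<in> rels W) \<and>
     (\<forall>a\<in>tensor_algebra X. \<forall>u\<in>rels W. row_scale a u \<in> rels W) \<and>
     (\<forall>u\<in>rels W. \<exists>H. finite H \<and> H \<subseteq> rels W \<and>
        (\<forall>h\<in>H. \<exists>d. homogeneous_row (gdeg W) d h) \<and> u = \<Sum>H)"

text \<open>The cyclic module \<open>T(V)/N\<close>, generated in degree 0.\<close>

definition cyclic_module :: "('x, 'k::field) tensor set \<Rightarrow> ('x, 'k) gmodule" where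
  "cyclic_module N = \<lparr>gens = {0}, gdeg = (\<lambda>_. 0), rels = rows N {0}\<rparr>"

definition trivial_module :: "'x set \<Rightarrow> ('x, 'k::field) gmodule" where
  "trivial_module X = cyclic_module (tensor_plus X)"


section \<open>Graded free resolutions\<close>

text \<open>
  \<open>Q\<^sup>n\<close> is the graded free module with basis \<open>bas Q n\<close> in degrees \<open>bdeg Q n\<close>. For \<open>n \<ge> 1\<close>,
  \<open>mat Q n\<close> is the matrix of \<open>Q\<^sup>n \<rightarrow> Q\<^sup>n\<^sup>-\<^sup>1\<close>, lifted to \<open>T(V)\<close>; \<open>mat Q 0\<close> is the matrix of the
  augmentation \<open>Q\<^sup>0 \<rightarrow> W\<close> with respect to the generators of \<open>W\<close>.
\<close>

record (overloaded) ('x, 'k) resolution =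
  bas :: "nat \<Rightarrow> nat set"
  bdeg :: "nat \<Rightarrow> nat \<Rightarrow> int"
  mat :: "nat \<Rightarrow> ('x, 'k) matrix"

text \<open>The rows that vanish in the target of the \<open>n\<close>-th map.\<close>

definition zero_rows ::
    "('x, 'k::field) tensor set \<Rightarrow> ('x, 'k) gmodule \<Rightarrow> ('x, 'k) resolution \<Rightarrow> nat \<Rightarrow> ('x, 'k) row set" where
  "zero_rows I W Q n = (case n of 0 \<Rightarrow> rels W | Suc k \<Rightarrow> rows I (bas Q k))"

definition graded_free_resolution ::
    "'x set \<Rightarrow> ('x, 'k::field) tensor set \<Rightarrow> ('x, 'k) gmodule \<Rightarrow> ('x, 'k) resolution \<Rightarrow> bool" where
  "graded_free_resolution X I W Q \<longleftrightarrow>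
     (\<forall>n m. finite {i \<in> bas Q n. bdeg Q n i \<le> m}) \<and>
     (\<forall>i\<in>bas Q 0. mat Q 0 i \<in> rows (tensor_algebra X) (gens W) \<and>
        homogeneous_row (gdeg W) (bdeg Q 0 i) (mat Q 0 i)) \<and>
     (\<forall>n. \<forall>i\<in>bas Q (Suc n). mat Q (Suc n) i \<in> rows (tensor_algebra X) (bas Q n) \<and>
        homogeneous_row (bdeg Q n) (bdeg Q (Suc n) i) (mat Q (Suc n) i)) \<and>
     (\<forall>w\<in>rows (tensor_algebra X) (gens W). \<exists>u\<in>rows (tensor_algebra X) (bas Q 0).
        w - u \<star> mat Q 0 \<in> rels W) \<and>
     (\<forall>n. {u \<in> rows (tensor_algebra X) (bas Q n). u \<star> mat Q n \<in> zero_rows I W Q n} =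
          {v \<star> mat Q (Suc n) + w | v w.
             v \<in> rows (tensor_algebra X) (bas Q (Suc n)) \<and> w \<in> rows I (bas Q n)})"

definition minimal_resolution ::
    "'x set \<Rightarrow> ('x, 'k::field) tensor set \<Rightarrow> ('x, 'k) gmodule \<Rightarrow> ('x, 'k) resolution \<Rightarrow> bool" where
  "minimal_resolution X I W Q \<longleftrightarrow> graded_free_resolution X I W Q \<and>
     (\<forall>n. \<forall>i\<in>bas Q (Suc n). mat Q (Suc n) i \<in> rows (tensor_plus X) (bas Q n))"


section \<open>The modules called K2\<close>

definition tensor_ge2 :: "'x set \<Rightarrow> ('x, 'k::field) tensor set" where
  "tensor_ge2 X = {p \<in> tensor_algebra X. \<forall>w\<in>Poly_Mapping.keys p. 2 \<le> length w}"

definition var :: "'x \<Rightarrow> ('x, 'k::field) tensor" where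
  "var x = Poly_Mapping.single [x] 1"

text \<open>\<open>I' = I \<otimes> V + V \<otimes> I\<close>, written out in the basis \<open>X\<close> of \<open>V\<close>.\<close>

definition ideal' :: "'x set \<Rightarrow> ('x, 'k::field) tensor set \<Rightarrow> ('x, 'k) tensor set" where
  "ideal' X I = {(\<Sum>x\<in>X. f x * var x) + (\<Sum>x\<in>X. var x * g x) | f g. f ` X \<subseteq> I \<and> g ` X \<subseteq> I}"

definition scalar_row :: "(nat \<Rightarrow>\<^sub>0 'k::field) \<Rightarrow> ('x, 'k) row" where
  "scalar_row c = Poly_Mapping.map (Poly_Mapping.single []) c"

text \<open>
  Linear independence over \<open>K\<close> of the rows of \<open>[L\<^sub>n : E\<^sub>n]\<close>: a linear combination of the rows of
  \<open>M\<^sub>n\<close> that vanishes modulo \<open>T(V)\<^sub>\<ge>\<^sub>2\<close>, and such that (for \<open>n \<ge> 2\<close>, as \<open>E\<^sub>1 = 0\<close>) the same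
  combination of the rows of \<open>M\<^sub>n M\<^sub>n\<^sub>-\<^sub>1\<close> vanishes modulo \<open>I'\<close>, is trivial.
\<close>

definition LE_rows_independent ::
    "'x set \<Rightarrow> ('x, 'k::field) tensor set \<Rightarrow> ('x, 'k) resolution \<Rightarrow> nat \<Rightarrow> bool" where
  "LE_rows_independent X I Q n \<longleftrightarrow>
     (\<forall>c :: nat \<Rightarrow>\<^sub>0 'k.
        Poly_Mapping.keys c \<subseteq> bas Q n \<and>
        scalar_row c \<star> mat Q n \<in> rows (tensor_ge2 X) (bas Q (n - 1)) \<and>
        (n \<ge> 2 \<longrightarrow>
          scalar_row c \<star> mat_mult (mat Q n) (mat Q (n - 1)) \<in> rows (ideal' X I) (bas Q (n - 2)))
        \<longrightarrow> c = 0)"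

text \<open>
  The condition does not depend on the choice of the minimal resolution, its bases and the lifts.
  For \<open>n\<close> beyond the projective dimension of \<open>W\<close> the set \<open>bas Q n\<close> is empty (by minimality), so
  that letting \<open>n\<close> range over all positive integers is no restriction.
\<close>

definition K2_module :: "'x set \<Rightarrow> ('x, 'k::field) tensor set \<Rightarrow> ('x, 'k) gmodule \<Rightarrow> bool" where
  "K2_module X I W \<longleftrightarrow> graded_module X I W \<and>
     (\<exists>Q. minimal_resolution X I W Q \<and> (\<forall>n\<ge>1. LE_rows_independent X I Q n))"


section \<open>The Yoneda algebra\<close>

text \<open>
  Let \<open>P\<close> be a graded free resolution of the trivial module. A homomorphism \<open>P\<^sup>n \<rightarrow> K\<close> of degree
  \<open>-m\<close> is given by its values on the basis; it vanishes on basis elements of degree other than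
  \<open>m\<close>.
\<close>

type_synonym 'k cochain = "nat \<Rightarrow>\<^sub>0 'k"

definition cochains :: "('x, 'k::field) resolution \<Rightarrow> nat \<Rightarrow> int \<Rightarrow> 'k cochain set" where
  "cochains P n m = {f. Poly_Mapping.keys f \<subseteq> {i \<in> bas P n. bdeg P n i = m}}"

definition apply_cochain :: "'k::field cochain \<Rightarrow> ('x, 'k) row \<Rightarrow> 'k" where
  "apply_cochain f u =
     (\<Sum>j\<in>Poly_Mapping.keys u. const_coeff (Poly_Mapping.lookup u j) * Poly_Mapping.lookup f j)"

definition cocycles :: "('x, 'k::field) resolution \<Rightarrow> nat \<Rightarrow> int \<Rightarrow> 'k cochain set" where
  "cocycles P n m =
     {f \<in> cochains P n m. \<forall>i\<in>bas P (Suc n). apply_cochain f (mat P (Suc n) i) = 0}"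

definition coboundaries :: "('x, 'k::field) resolution \<Rightarrow> nat \<Rightarrow> int \<Rightarrow> 'k cochain set" where
  "coboundaries P n m = (case n of 0 \<Rightarrow> {0} | Suc k \<Rightarrow>
     {f \<in> cochains P n m. \<exists>e\<in>cochains P k m.
        \<forall>i\<in>bas P n. Poly_Mapping.lookup f i = apply_cochain e (mat P n i)})"

text \<open>
  \<open>E\<^sup>n\<^sup>,\<^sup>m(A)\<close> is the space of cocycles modulo coboundaries. For the Yoneda product with a cocycle
  \<open>f\<close> of bidegree \<open>(p, m)\<close>, lift \<open>f\<close> to a chain map \<open>F\<^sub>k : P\<^sup>p\<^sup>+\<^sup>k \<rightarrow> P\<^sup>k\<close> of degree \<open>-m\<close>; the product of
  the classes of \<open>g\<close>, of cohomological degree \<open>q\<close>, and \<open>f\<close> is the class of \<open>g \<circ> F\<^sub>q\<close>.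
\<close>

definition chain_lift ::
    "'x set \<Rightarrow> ('x, 'k::field) tensor set \<Rightarrow> ('x, 'k) resolution \<Rightarrow>
     nat \<Rightarrow> int \<Rightarrow> 'k cochain \<Rightarrow> (nat \<Rightarrow> ('x, 'k) matrix) \<Rightarrow> bool" where
  "chain_lift X I P p m f F \<longleftrightarrow>
     (\<forall>k. \<forall>i\<in>bas P (p + k). F k i \<in> rows (tensor_algebra X) (bas P k) \<and>
        homogeneous_row (bdeg P k) (bdeg P (p + k) i - m) (F k i)) \<and>
     (\<forall>i\<in>bas P p. const_coeff (Poly_Mapping.lookup (F 0 i \<star> mat P 0) 0) = Poly_Mapping.lookup f i) \<and>
     (\<forall>k. \<forall>i\<in>bas P (p + Suc k).
        F (Suc k) i \<star> mat P (Suc k) - mat P (p + Suc k) i \<star> F k \<in> rows I (bas P k))"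

definition yoneda_product ::
    "'x set \<Rightarrow> ('x, 'k::field) tensor set \<Rightarrow> ('x, 'k) resolution \<Rightarrow>
     nat \<Rightarrow> 'k cochain \<Rightarrow> nat \<Rightarrow> int \<Rightarrow> 'k cochain \<Rightarrow> 'k cochain \<Rightarrow> bool" where
  "yoneda_product X I P q g p m f h \<longleftrightarrow>
     (\<exists>F. chain_lift X I P p m f F \<and> Poly_Mapping.keys h \<subseteq> bas P (p + q) \<and>
        (\<forall>i\<in>bas P (p + q). Poly_Mapping.lookup h i = apply_cochain g (F q i)))"

text \<open>
  \<open>yoneda_generated X I P n m f\<close>: the class in \<open>E\<^sup>n\<^sup>,\<^sup>m(A)\<close> of the cocycle \<open>f\<close> lies in the subalgebra
  generated by \<open>E\<^sup>1(A)\<close> and \<open>E\<^sup>2(A)\<close>. This subalgebra is bigraded, and it contains \<open>E\<^sup>0(A) = K\<close>, the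
  multiples of the unit. Sign conventions for the product are immaterial here.
\<close>

inductive yoneda_generated ::
    "'x set \<Rightarrow> ('x, 'k::field) tensor set \<Rightarrow> ('x, 'k) resolution \<Rightarrow> nat \<Rightarrow> int \<Rightarrow> 'k cochain \<Rightarrow> bool"
  for X I P where
  unit: "f \<in> cocycles P 0 m \<Longrightarrow> yoneda_generated X I P 0 m f"
| deg1: "f \<in> cocycles P 1 m \<Longrightarrow> yoneda_generated X I P 1 m f"
| deg2: "f \<in> cocycles P 2 m \<Longrightarrow> yoneda_generated X I P 2 m f"
| coboundary: "f \<in> coboundaries P n m \<Longrightarrow> yoneda_generated X I P n m f"
| add: "yoneda_generated X I P n m f \<Longrightarrow> yoneda_generated X I P n m g \<Longrightarrow>
        yoneda_generated X I P n m (f + g)"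
| scale: "yoneda_generated X I P n m f \<Longrightarrow>
        yoneda_generated X I P n m (Poly_Mapping.map ((*) c) f)"
| product: "yoneda_generated X I P q l g \<Longrightarrow> yoneda_generated X I P p m f \<Longrightarrow>
        yoneda_product X I P q g p m f h \<Longrightarrow> yoneda_generated X I P (p + q) (m + l) h"

text \<open>
  The Yoneda algebra does not depend on the resolution, up to isomorphism; a minimal one is used.
  The definition applies to any \<open>T(V)/I\<close> with \<open>I\<close> a proper homogeneous ideal, also when \<open>I\<close> contains
  elements of degree 1 (so that \<open>V\<close> is larger than the degree 1 part of the algebra).
\<close>

definition K2_algebra :: "'x set \<Rightarrow> ('x, 'k::field) tensor set \<Rightarrow> bool" where
  "K2_algebra X I \<longleftrightarrow>
     (\<exists>P. minimal_resolution X I (trivial_module X) P \<and>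
        (\<forall>n m. \<forall>f\<in>cocycles P n m. yoneda_generated X I P n m f))"

end

theory Submission
  imports Defs "HOL.Vector_Spaces" "HOL-Library.Countable_Set"
begin

text \<open>
  Let \<open>A = T(V)/I\<close> and \<open>B = T(V)/J\<close>, and let \<open>D\<close> be the subalgebra of \<open>E(A)\<close> generated by \<open>E\<^sup>1(A)\<close> and \<open>E\<^sup>2(A)\<close>.
  The claim is that \<open>Ext\<^sub>A(N, K)\<close> equals \<open>D\<close> times the image of \<open>Ext\<^sub>B(N, K)\<close> under inflation, for the
  trivial module \<open>N = K\<close> and for all its syzygies over \<open>B\<close>. For \<open>N = K\<close> this gives the theorem, because
  inflation \<open>E(B) \<rightarrow> E(A)\<close> is a homomorphism of algebras and \<open>E(B)\<close> is generated in degrees one and two, so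
  that its image lies in \<open>D\<close> (lemma \<open>inflate_generated\<close>).

  To prove the claim, let \<open>F \<rightarrow> N\<close> be a minimal free cover over \<open>B\<close> with kernel \<open>N'\<close>, and consider the exact
  sequence \<open>Ext\<^sub>A\<^sup>n\<^sup>-\<^sup>1(N', K) \<rightarrow> Ext\<^sub>A\<^sup>n(N, K) \<rightarrow> Ext\<^sub>A\<^sup>n(F, K)\<close>. That \<open>B\<close> is a K2 module over \<open>A\<close> means that
  \<open>Ext\<^sub>A(B, K)\<close> is \<open>D\<close> times its part of degree \<open>0\<close> (lemma \<open>K2_module_generated\<close>, which translates the
  linear independence of the rows of \<open>[L\<^sub>n : E\<^sub>n]\<close>). The same holds for \<open>F\<close>, and \<open>F\<close> and \<open>N\<close> have the same classes
  of degree \<open>0\<close> by minimality. Hence a class of degree \<open>n\<close> on \<open>N\<close> can be changed by products of elements of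
  \<open>D\<close> with classes of degree \<open>0\<close> so that it vanishes on \<open>F\<close>, and then it comes from a class of degree \<open>n - 1\<close>
  on \<open>N'\<close>. Induction on \<open>n\<close> finishes the proof (lemma \<open>tower_generated\<close>). That lemma
  records the claim for the images of the classes in \<open>E(A)\<close> under iterated connecting maps, where products
  are available.

  All modules are handled through complexes of free modules, that is, through matrices over \<open>T(V)\<close> modulo
  \<open>I\<close>. Lifts exist by \<open>lift_chain_map\<close> and are unique, as far as homomorphisms to \<open>K\<close> are concerned, by
  \<open>chain_map_vanishes\<close>; the resolutions are minimal, so that cochains and cohomology classes coincide. Every
  syzygy has a minimal resolution over \<open>A\<close> by \<open>minimal_resolution_exists\<close>. The exact sequence is obtained in
  \<open>dimension_shift\<close>: the cone of a map from a resolution of \<open>N'\<close> to copies of a resolution of \<open>B\<close> is again a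
  resolution of \<open>N\<close>, and is compared with the minimal one.
\<close>

section \<open>Rows and matrices over a ring\<close>

abbreviation entry :: "('i \<Rightarrow>\<^sub>0 'a::zero) \<Rightarrow> 'i \<Rightarrow> 'a" where "entry \<equiv> Poly_Mapping.lookup"
abbreviation supp :: "('i \<Rightarrow>\<^sub>0 'a::zero) \<Rightarrow> 'i set" where "supp \<equiv> Poly_Mapping.keys"
abbreviation sng :: "'i \<Rightarrow> 'a \<Rightarrow> ('i \<Rightarrow>\<^sub>0 'a::zero)" where "sng \<equiv> Poly_Mapping.single"

definition scale_by :: "'a::ring_1 \<Rightarrow> ('i \<Rightarrow>\<^sub>0 'a) \<Rightarrow> ('i \<Rightarrow>\<^sub>0 'a)" where
  "scale_by a u = Poly_Mapping.map ((*) a) u"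

text \<open>
  This is the product \<open>\<star>\<close> of rows with matrices, over any ring and for any index types: the
  bases of the cones below are disjoint unions of products.
\<close>

definition comb :: "('i \<Rightarrow>\<^sub>0 'a::ring_1) \<Rightarrow> ('i \<Rightarrow> 'j \<Rightarrow>\<^sub>0 'a) \<Rightarrow> ('j \<Rightarrow>\<^sub>0 'a)" (infixl "\<odot>" 70) where
  "u \<odot> M = (\<Sum>i\<in>supp u. scale_by (entry u i) (M i))"

abbreviation unit_row :: "'i \<Rightarrow> ('i \<Rightarrow>\<^sub>0 'a::ring_1)" where "unit_row i \<equiv> sng i 1"

lemma row_scale_eq: "row_scale a u = scale_by a u"
  by (simp add: row_scale_def scale_by_def)

lemma row_mult_eq: "u \<star> M = u \<odot> M"
  by (simp add: row_mult_def comb_def row_scale_eq)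

lemma entry_scale_by [simp]: "entry (scale_by a u) i = a * entry u i"
  by (simp add: scale_by_def map.rep_eq when_def)

lemma supp_iff: "i \<in> supp u \<longleftrightarrow> entry u i \<noteq> 0"
  by (rule in_keys_iff)

lemma scale_by_0 [simp]: "scale_by 0 u = 0" "scale_by a 0 = 0"
  by (rule poly_mapping_eqI; simp)+

lemma scale_by_1 [simp]: "scale_by 1 u = u"
  by (rule poly_mapping_eqI) simp

lemma scale_by_add: "scale_by (a + b) u = scale_by a u + scale_by b u"
  "scale_by a (u + v) = scale_by a u + scale_by a v"
  by (rule poly_mapping_eqI; simp add: lookup_add distrib_left distrib_right)+

lemma scale_by_diff: "scale_by a (u - v) = scale_by a u - scale_by a v"
  by (rule poly_mapping_eqI; simp add: lookup_minus algebra_simps)+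

lemma scale_by_uminus: "scale_by (- a) u = - scale_by a u" "scale_by a (- u) = - scale_by a u"
  by (rule poly_mapping_eqI; simp)+

lemma scale_by_scale_by [simp]: "scale_by a (scale_by b u) = scale_by (a * b) u"
  by (rule poly_mapping_eqI) (simp add: mult.assoc)

lemma scale_by_sum: "scale_by a (sum f A) = (\<Sum>x\<in>A. scale_by a (f x))"
  by (rule poly_mapping_eqI) (simp add: lookup_sum sum_distrib_left)

lemma scale_by_single [simp]: "scale_by a (sng i b) = sng i (a * b)"
  by (rule poly_mapping_eqI) (simp add: lookup_single when_def)

lemma supp_scale_by: "supp (scale_by a u) \<subseteq> supp u"
  by (auto simp: supp_iff)

lemma comb_superset:
  assumes "finite A" "supp u \<subseteq> A"
  shows "u \<odot> M = (\<Sum>i\<in>A. scale_by (entry u i) (M i))"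
  unfolding comb_def using assms by (intro sum.mono_neutral_left) (auto simp: supp_iff)

lemma comb_zero [simp]: "0 \<odot> M = 0"
  by (simp add: comb_def)

lemma comb_add: "(u + v) \<odot> M = u \<odot> M + v \<odot> M"
proof -
  let ?A = "supp u \<union> supp v"
  have "supp (u + v) \<subseteq> ?A" by (rule Poly_Mapping.keys_add)
  then have "(u + v) \<odot> M = (\<Sum>i\<in>?A. scale_by (entry (u + v) i) (M i))"
    by (intro comb_superset) auto
  moreover have "u \<odot> M = (\<Sum>i\<in>?A. scale_by (entry u i) (M i))" by (intro comb_superset) auto
  moreover have "v \<odot> M = (\<Sum>i\<in>?A. scale_by (entry v i) (M i))" by (intro comb_superset) auto
  ultimately show ?thesis by (simp add: lookup_add scale_by_add sum.distrib)
qed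

lemma comb_uminus: "(- u) \<odot> M = - (u \<odot> M)"
  using comb_add[of "- u" u M] by (simp add: eq_neg_iff_add_eq_0)

lemma comb_diff: "(u - v) \<odot> M = u \<odot> M - v \<odot> M"
  using comb_add[of u "- v" M] by (simp add: comb_uminus)

lemma comb_sum: "(\<Sum>x\<in>A. f x) \<odot> M = (\<Sum>x\<in>A. f x \<odot> M)"
  by (induction A rule: infinite_finite_induct) (simp_all add: comb_add)

lemma comb_scale_by: "scale_by a u \<odot> M = scale_by a (u \<odot> M)"
  by (subst comb_superset[of "supp u"]) (auto simp: supp_scale_by comb_def scale_by_sum)

lemma comb_single [simp]: "sng i a \<odot> M = scale_by a (M i)"
  by (subst comb_superset[of "{i}"]) auto

lemma comb_cong: "(\<And>i. i \<in> supp u \<Longrightarrow> M i = N i) \<Longrightarrow> u \<odot> M = u \<odot> N"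
  by (simp add: comb_def)

lemma comb_zero_right [simp]: "u \<odot> (\<lambda>i. 0) = 0"
  by (simp add: comb_def)

lemma comb_add_right: "u \<odot> (\<lambda>i. M i + N i) = u \<odot> M + u \<odot> N"
  by (simp add: comb_def scale_by_add sum.distrib)

lemma comb_diff_right: "u \<odot> (\<lambda>i. M i - N i) = u \<odot> M - u \<odot> N"
  by (simp add: comb_def scale_by_diff sum_subtractf)

lemma comb_uminus_right: "u \<odot> (\<lambda>i. - M i) = - (u \<odot> M)"
  by (simp add: comb_def scale_by_uminus sum_negf)

lemma comb_sum_right: "u \<odot> (\<lambda>i. \<Sum>x\<in>A. M x i) = (\<Sum>x\<in>A. u \<odot> M x)"
  by (induction A rule: infinite_finite_induct) (simp_all add: comb_add_right)

lemma comb_assoc: "u \<odot> M \<odot> N = u \<odot> (\<lambda>i. M i \<odot> N)"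
  by (simp add: comb_def[of u] comb_sum comb_scale_by)

lemma comb_unit_row [simp]: "u \<odot> unit_row = u"
proof (rule poly_mapping_eqI)
  fix k
  have "entry (u \<odot> unit_row) k = (\<Sum>i\<in>supp u. if i = k then entry u i else 0)"
    by (simp add: comb_def lookup_sum lookup_single when_def)
  also have "\<dots> = entry u k" by (simp add: supp_iff)
  finally show "entry (u \<odot> unit_row) k = entry u k" .
qed

lemma entry_comb: "entry (u \<odot> M) k = (\<Sum>i\<in>supp u. entry u i * entry (M i) k)"
  by (simp add: comb_def lookup_sum)

lemma supp_comb: "(\<And>i. i \<in> supp u \<Longrightarrow> supp (M i) \<subseteq> S) \<Longrightarrow> supp (u \<odot> M) \<subseteq> S"
  unfolding comb_def
  by (rule order.trans[OF keys_sum]) (meson UN_least order.trans supp_scale_by)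

lemma supp_diff: "supp u \<subseteq> S \<Longrightarrow> supp v \<subseteq> S \<Longrightarrow> supp (u - v) \<subseteq> S"
  using keys_diff[of u v] by blast

lemma supp_plus: "supp u \<subseteq> S \<Longrightarrow> supp v \<subseteq> S \<Longrightarrow> supp (u + v) \<subseteq> S"
  using Poly_Mapping.keys_add[of u v] by blast

lemma supp_uminus [simp]: "supp (- u :: 'i \<Rightarrow>\<^sub>0 'a::ring_1) = supp u"
  by (auto simp: supp_iff)

section \<open>Entries\<close>

definition add_subgroup :: "'a::ab_group_add set \<Rightarrow> bool" where
  "add_subgroup C \<longleftrightarrow> 0 \<in> C \<and> (\<forall>a\<in>C. \<forall>b\<in>C. a - b \<in> C)"

lemma add_subgroupD:
  assumes "add_subgroup C"
  shows "0 \<in> C" "a \<in> C \<Longrightarrow> b \<in> C \<Longrightarrow> a - b \<in> C" "a \<in> C \<Longrightarrow> - a \<in> C"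
    "a \<in> C \<Longrightarrow> b \<in> C \<Longrightarrow> a + b \<in> C"
proof -
  show *: "0 \<in> C" "a \<in> C \<Longrightarrow> b \<in> C \<Longrightarrow> a - b \<in> C" for a b
    using assms by (auto simp: add_subgroup_def)
  show **: "a \<in> C \<Longrightarrow> - a \<in> C" for a using *(2)[OF *(1), of a] by simp
  show "a \<in> C \<Longrightarrow> b \<in> C \<Longrightarrow> a + b \<in> C" using *(2)[of a "- b"] **[of b] by simp
qed

lemma add_subgroup_sum: "add_subgroup C \<Longrightarrow> (\<And>x. x \<in> A \<Longrightarrow> f x \<in> C) \<Longrightarrow> sum f A \<in> C"
  by (induction A rule: infinite_finite_induct) (auto intro: add_subgroupD)

text \<open>
  Congruence of rows modulo an ideal depends only on the entries, so that it need not mention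
  the basis of the free module; a row over \<open>C\<close> with basis \<open>S\<close> is given by a support in \<open>S\<close> and
  entries in \<open>C\<close>.
\<close>

definition entries_in :: "'a::ring_1 set \<Rightarrow> ('i \<Rightarrow>\<^sub>0 'a) \<Rightarrow> bool" where
  "entries_in C u \<longleftrightarrow> (\<forall>i. entry u i \<in> C)"

lemma entries_in_mono: "entries_in C u \<Longrightarrow> C \<subseteq> D \<Longrightarrow> entries_in D u"
  by (auto simp: entries_in_def)

lemma entries_in_simps:
  assumes "add_subgroup C"
  shows "entries_in C 0" "entries_in C u \<Longrightarrow> entries_in C v \<Longrightarrow> entries_in C (u - v)"
    "entries_in C u \<Longrightarrow> entries_in C (- u)"
    "entries_in C u \<Longrightarrow> entries_in C v \<Longrightarrow> entries_in C (u + v)"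
  using add_subgroupD[OF assms] by (simp_all add: entries_in_def lookup_minus lookup_add)

lemma entries_in_sum:
  "add_subgroup C \<Longrightarrow> (\<And>x. x \<in> A \<Longrightarrow> entries_in C (f x)) \<Longrightarrow> entries_in C (sum f A)"
  by (auto simp: entries_in_def lookup_sum intro: add_subgroup_sum)

lemma entries_in_comb:
  assumes "add_subgroup E" "entries_in C u" "\<And>i. i \<in> supp u \<Longrightarrow> entries_in D (M i)"
    and "\<And>a b. a \<in> C \<Longrightarrow> b \<in> D \<Longrightarrow> a * b \<in> E"
  shows "entries_in E (u \<odot> M)"
  unfolding entries_in_def entry_comb
  using assms by (auto simp: entries_in_def intro!: add_subgroup_sum)

lemma rows_iff: "0 \<in> C \<Longrightarrow> u \<in> rows C S \<longleftrightarrow> supp u \<subseteq> S \<and> entries_in C u"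
  by (auto simp: rows_def entries_in_def supp_iff) (metis subsetD supp_iff)

section \<open>The graded pieces of the tensor algebra\<close>

definition homs :: "'x set \<Rightarrow> int \<Rightarrow> ('x, 'k::field) tensor set" where
  "homs X d = {p \<in> tensor_algebra X. homogeneous d p}"

lemma mem_homs: "p \<in> homs X d \<longleftrightarrow> (\<forall>w\<in>supp p. set w \<subseteq> X \<and> int (length w) = d)"
  by (auto simp: homs_def tensor_algebra_def homogeneous_def lists_eq_set)

lemma mem_tensor_algebra: "p \<in> tensor_algebra X \<longleftrightarrow> (\<forall>w\<in>supp p. set w \<subseteq> X)"
  by (auto simp: tensor_algebra_def lists_eq_set)

lemma supp_mult_tensor:
  "w \<in> supp (p * q :: ('x, 'k::field) tensor) \<Longrightarrow> \<exists>a\<in>supp p. \<exists>b\<in>supp q. w = a @ b"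
  using keys_mult[of p q] unfolding plus_list_def by blast

lemma one_tensor: "(1 :: ('x, 'k::field) tensor) = sng [] 1"
  by (simp add: zero_list_def flip: single_one)

lemma const_coeff_simps [simp]:
  "const_coeff (0 :: ('x, 'k::field) tensor) = 0" "const_coeff (1 :: ('x, 'k) tensor) = 1"
  "const_coeff (p + q) = const_coeff p + const_coeff q"
  "const_coeff (p - q) = const_coeff p - const_coeff q"
  "const_coeff (- p) = - const_coeff p"
  "const_coeff (sng [] c) = c"
  by (simp_all add: const_coeff_def lookup_add lookup_minus one_tensor)

lemma const_coeff_sum: "const_coeff (sum f A) = (\<Sum>x\<in>A. const_coeff (f x))"
  by (simp add: const_coeff_def lookup_sum)

text \<open>
  The empty word is a product in one way only. This makes reduction modulo \<open>T(V)\<^sub>+\<close>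
  multiplicative.
\<close>

lemma const_coeff_mult [simp]:
  "const_coeff (p * q :: ('x, 'k::field) tensor) = const_coeff p * const_coeff q"
proof -
  have inner: "(\<Sum>b. entry q b when [] = a + b) = (entry q [] when a = [])" for a :: "'x list"
  proof (cases "a = []")
    case True
    then have "(\<lambda>b. entry q b when [] = a + b) = (\<lambda>b. entry q b when b = [])"
      by (auto simp: plus_list_def when_def fun_eq_iff)
    with True show ?thesis by (simp only: Sum_any_when_equal) simp
  qed (simp add: plus_list_def)
  have "entry (p * q) [] = (\<Sum>a. entry p a * entry q [] when a = [])"
    by (simp add: lookup_mult inner mult_when)
  then show ?thesis by (simp add: const_coeff_def)
qed

lemma add_subgroup_keys: "add_subgroup {p. \<forall>w\<in>supp p. Q w}"
  unfolding add_subgroup_def using keys_diff by fastforce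

lemma add_subgroup_tensor_algebra: "add_subgroup (tensor_algebra X :: ('x, 'k::field) tensor set)"
proof -
  have "tensor_algebra X = {p :: ('x, 'k) tensor. \<forall>w\<in>supp p. set w \<subseteq> X}" by (intro set_eqI) (simp add: mem_tensor_algebra)
  then show ?thesis by (simp only: add_subgroup_keys)
qed

lemma add_subgroup_homs: "add_subgroup (homs X d :: ('x, 'k::field) tensor set)"
proof -
  have "homs X d = {p :: ('x, 'k) tensor. \<forall>w\<in>supp p. set w \<subseteq> X \<and> int (length w) = d}" by (intro set_eqI) (simp add: mem_homs)
  then show ?thesis by (simp only: add_subgroup_keys)
qed

lemma add_subgroup_tensor_plus: "add_subgroup (tensor_plus X)"
  using add_subgroup_tensor_algebra[of X] by (auto simp: add_subgroup_def tensor_plus_def)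

lemma homs_subset: "homs X d \<subseteq> tensor_algebra X"
  by (auto simp: homs_def)

lemma tensor_plus_subset: "tensor_plus X \<subseteq> tensor_algebra X"
  by (auto simp: tensor_plus_def)

lemma mult_tensor_algebra:
  "p \<in> tensor_algebra X \<Longrightarrow> q \<in> tensor_algebra X \<Longrightarrow> p * q \<in> tensor_algebra X"
  unfolding mem_tensor_algebra by (fastforce dest!: supp_mult_tensor)

lemma mult_homs: "p \<in> homs X d \<Longrightarrow> q \<in> homs X e \<Longrightarrow> p * q \<in> homs X (d + e)"
  unfolding mem_homs by (fastforce dest!: supp_mult_tensor)

lemma mult_tensor_plus:
  "p \<in> tensor_plus X \<Longrightarrow> q \<in> tensor_algebra X \<Longrightarrow> p * q \<in> tensor_plus X"
  "p \<in> tensor_algebra X \<Longrightarrow> q \<in> tensor_plus X \<Longrightarrow> p * q \<in> tensor_plus X"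
  by (auto simp: tensor_plus_def mult_tensor_algebra)

lemma scalar_homs [simp]: "sng [] c \<in> homs X 0" "sng [] c \<in> tensor_algebra X"
  by (auto simp: mem_homs mem_tensor_algebra)

lemma one_homs [simp]: "1 \<in> homs X 0" "1 \<in> tensor_algebra X"
  by (simp_all add: one_tensor)

lemma zero_mem_graded [simp]:
  "0 \<in> homs X d" "0 \<in> tensor_algebra X" "0 \<in> tensor_plus X"
  by (simp_all add: mem_homs mem_tensor_algebra tensor_plus_def)

lemma homs_0_scalar: "p \<in> homs X 0 \<Longrightarrow> p = sng [] (const_coeff p)"
proof (rule poly_mapping_eqI)
  fix w assume p: "p \<in> homs X 0"
  show "entry p w = entry (sng [] (const_coeff p)) w"
  proof (cases "w = []")
    case False
    then have "w \<notin> supp p" using p by (auto simp: mem_homs)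
    with False show ?thesis by (simp add: supp_iff lookup_single)
  qed (simp add: const_coeff_def)
qed

lemma const_coeff_homs: "p \<in> homs X d \<Longrightarrow> d \<noteq> 0 \<Longrightarrow> const_coeff p = 0"
  by (auto simp: mem_homs const_coeff_def supp_iff)

lemma homs_negative: "p \<in> homs X d \<Longrightarrow> d < 0 \<Longrightarrow> p = 0"
  by (rule poly_mapping_eqI) (force simp: mem_homs supp_iff)

definition hcomp :: "int \<Rightarrow> ('x, 'k::field) tensor \<Rightarrow> ('x, 'k) tensor" where
  "hcomp d p = Poly_Mapping.mapp (\<lambda>w c. if int (length w) = d then c else 0) p"

lemma entry_hcomp: "entry (hcomp d p) w = (if int (length w) = d then entry p w else 0)"
  by (auto simp: hcomp_def lookup_mapp when_def supp_iff)

lemma hcomp_simps [simp]: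
  "hcomp d 0 = 0" "hcomp d (p + q) = hcomp d p + hcomp d q"
  "hcomp d (p - q) = hcomp d p - hcomp d q"
  by (rule poly_mapping_eqI; simp add: entry_hcomp lookup_add lookup_minus)+

lemma hcomp_sum: "hcomp d (sum f A) = (\<Sum>x\<in>A. hcomp d (f x))"
  by (induction A rule: infinite_finite_induct) simp_all

lemma hcomp_homs [intro]: "p \<in> tensor_algebra X \<Longrightarrow> hcomp d p \<in> homs X d"
  by (auto simp: mem_homs mem_tensor_algebra supp_iff entry_hcomp split: if_splits)

lemma hcomp_of_homs: "p \<in> homs X e \<Longrightarrow> hcomp d p = (if d = e then p else 0)"
  by (auto simp: mem_homs supp_iff entry_hcomp intro!: poly_mapping_eqI)

lemma hcomp_of_homogeneous: "homogeneous e p \<Longrightarrow> hcomp d p = (if d = e then p else 0)"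
  by (auto simp: homogeneous_def supp_iff entry_hcomp intro!: poly_mapping_eqI)

lemma sum_hcomp:
  assumes "finite D" "\<And>w. w \<in> supp p \<Longrightarrow> int (length w) \<in> D"
  shows "(\<Sum>d\<in>D. hcomp d p) = p"
proof (rule poly_mapping_eqI)
  fix w
  have "entry (\<Sum>d\<in>D. hcomp d p) w = (\<Sum>d\<in>D. if int (length w) = d then entry p w else 0)"
    by (simp add: lookup_sum entry_hcomp)
  also have "\<dots> = entry p w" using assms by (auto simp: supp_iff)
  finally show "entry (\<Sum>d\<in>D. hcomp d p) w = entry p w" .
qed

text \<open>
  Split \<open>p\<close> into its components; the product of each with \<open>q\<close> is homogeneous, and only one of
  them has degree \<open>d\<close>.
\<close>

lemma hcomp_mult_homs:
  assumes "q \<in> homs X e" "p \<in> tensor_algebra X"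
  shows "hcomp d (q * p) = q * hcomp (d - e) p" "hcomp d (p * q) = hcomp (d - e) p * q"
proof -
  define D where "D = insert (d - e) ((\<lambda>w. int (length w)) ` supp p)"
  have D: "finite D" and p: "p = (\<Sum>c\<in>D. hcomp c p)"
    unfolding D_def by (auto intro!: sum_hcomp[symmetric])
  have in_D: "d - e \<in> D" by (simp add: D_def)
  have "hcomp d (q * hcomp c p) = (if c = d - e then q * hcomp c p else 0)" for c
    using hcomp_of_homs[OF mult_homs[OF assms(1) hcomp_homs[OF assms(2), of c]], of d] by auto
  then have "hcomp d (\<Sum>c\<in>D. q * hcomp c p) = q * hcomp (d - e) p"
    using D in_D by (simp add: hcomp_sum)
  then show "hcomp d (q * p) = q * hcomp (d - e) p"
    by (subst p) (simp add: sum_distrib_left)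
  have "hcomp d (hcomp c p * q) = (if c = d - e then hcomp c p * q else 0)" for c
    using hcomp_of_homs[OF mult_homs[OF hcomp_homs[OF assms(2), of c] assms(1)], of d] by auto
  then have "hcomp d (\<Sum>c\<in>D. hcomp c p * q) = hcomp (d - e) p * q"
    using D in_D by (simp add: hcomp_sum)
  then show "hcomp d (p * q) = hcomp (d - e) p * q"
    by (subst p) (simp add: sum_distrib_right)
qed

lemma sum_singles: "p = (\<Sum>w\<in>supp p. sng w (entry p w))"
  by (rule poly_mapping_eqI) (auto simp: lookup_sum lookup_single when_def supp_iff)

section \<open>Homogeneous rows\<close>

definition hrow ::
    "'x set \<Rightarrow> 'i set \<Rightarrow> ('i \<Rightarrow> int) \<Rightarrow> int \<Rightarrow> ('i \<Rightarrow>\<^sub>0 ('x, 'k::field) tensor) set" where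
  "hrow X S dg d = {u. supp u \<subseteq> S \<and> (\<forall>i. entry u i \<in> homs X (d - dg i))}"

lemma hrowD:
  "u \<in> hrow X S dg d \<Longrightarrow> supp u \<subseteq> S" "u \<in> hrow X S dg d \<Longrightarrow> entry u i \<in> homs X (d - dg i)"
  "u \<in> hrow X S dg d \<Longrightarrow> entries_in (tensor_algebra X) u"
  using homs_subset by (simp_all add: hrow_def entries_in_def) blast

lemma hrow_simps:
  "0 \<in> hrow X S dg d"
  "u \<in> hrow X S dg d \<Longrightarrow> v \<in> hrow X S dg d \<Longrightarrow> u - v \<in> hrow X S dg d"
  "u \<in> hrow X S dg d \<Longrightarrow> v \<in> hrow X S dg d \<Longrightarrow> u + v \<in> hrow X S dg d"
  "u \<in> hrow X S dg d \<Longrightarrow> - u \<in> hrow X S dg d"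
  by (simp_all add: hrow_def lookup_minus lookup_add supp_diff supp_plus
      add_subgroupD[OF add_subgroup_homs])

lemma hrow_sum: "(\<And>x. x \<in> A \<Longrightarrow> f x \<in> hrow X S dg d) \<Longrightarrow> sum f A \<in> hrow X S dg d"
  by (induction A rule: infinite_finite_induct) (auto intro: hrow_simps)

lemma hrow_single: "i \<in> S \<Longrightarrow> a \<in> homs X (d - dg i) \<Longrightarrow> sng i a \<in> hrow X S dg d"
  by (auto simp: hrow_def lookup_single when_def)

lemma unit_row_hrow [simp]: "i \<in> S \<Longrightarrow> d = dg i \<Longrightarrow> unit_row i \<in> hrow X S dg d"
  by (simp add: hrow_single)

lemma zero_hrow [simp]: "0 \<in> hrow X S dg d"
  by (rule hrow_simps)

lemma hrow_scale_by: "a \<in> homs X e \<Longrightarrow> u \<in> hrow X S dg d \<Longrightarrow> scale_by a u \<in> hrow X S dg (e + d)"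
  using supp_scale_by by (fastforce simp: hrow_def algebra_simps dest: mult_homs)

lemma hrow_comb:
  assumes "u \<in> hrow X S dg e" "\<And>i. i \<in> S \<Longrightarrow> M i \<in> hrow X S' dg' (dg i - m)"
  shows "u \<odot> M \<in> hrow X S' dg' (e - m)"
proof -
  have "scale_by (entry u i) (M i) \<in> hrow X S' dg' (e - m)" if "i \<in> supp u" for i
  proof -
    have "i \<in> S" using hrowD(1)[OF assms(1)] that by auto
    from hrow_scale_by[OF hrowD(2)[OF assms(1)] assms(2)[OF this]]
    have "scale_by (entry u i) (M i) \<in> hrow X S' dg' (e - dg i + (dg i - m))" .
    then show ?thesis by simp
  qed
  then show ?thesis unfolding comb_def by (rule hrow_sum)
qed

lemma hrow_comb0:
  assumes "u \<in> hrow X S dg e" "\<And>i. i \<in> S \<Longrightarrow> M i \<in> hrow X S' dg' (dg i)"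
  shows "u \<odot> M \<in> hrow X S' dg' e"
  using hrow_comb[of u X S dg e M S' dg' 0] assms by simp

lemma hrow_iff:
  "u \<in> hrow X S dg d \<longleftrightarrow> u \<in> rows (tensor_algebra X) S \<and> homogeneous_row dg d u"
  by (auto simp: hrow_def rows_iff homogeneous_row_def homs_def entries_in_def)

definition row_comp ::
    "('i \<Rightarrow> int) \<Rightarrow> int \<Rightarrow> ('i \<Rightarrow>\<^sub>0 ('x, 'k::field) tensor) \<Rightarrow> ('i \<Rightarrow>\<^sub>0 ('x, 'k) tensor)" where
  "row_comp dg d u = Poly_Mapping.mapp (\<lambda>i. hcomp (d - dg i)) u"

lemma entry_row_comp [simp]: "entry (row_comp dg d u) i = hcomp (d - dg i) (entry u i)"
  by (auto simp: row_comp_def lookup_mapp when_def supp_iff)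

lemma row_comp_simps [simp]:
  "row_comp dg d 0 = 0" "row_comp dg d (u + v) = row_comp dg d u + row_comp dg d v"
  "row_comp dg d (u - v) = row_comp dg d u - row_comp dg d v"
  by (rule poly_mapping_eqI; simp add: lookup_add lookup_minus)+

lemma row_comp_hrow:
  assumes "supp u \<subseteq> S" "entries_in (tensor_algebra X) u"
  shows "row_comp dg d u \<in> hrow X S dg d"
proof -
  have "supp (row_comp dg d u) \<subseteq> supp u" by (auto simp: row_comp_def dest: subsetD[OF keys_mapp_subset])
  with assms show ?thesis by (auto simp: hrow_def entries_in_def)
qed

lemma row_comp_of_hrow: "u \<in> hrow X S dg e \<Longrightarrow> row_comp dg d u = (if d = e then u else 0)"
  by (rule poly_mapping_eqI) (auto simp: hcomp_of_homs[OF hrowD(2)])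

lemma row_comp_decompose:
  obtains D where "finite D" "(\<Sum>d\<in>D. row_comp dg d u) = u"
proof -
  define D where "D = (\<Union>i\<in>supp u. (\<lambda>w. int (length w) + dg i) ` supp (entry u i))"
  have fin: "finite D" by (auto simp: D_def)
  have "entry (\<Sum>d\<in>D. row_comp dg d u) i = entry u i" for i
  proof (cases "i \<in> supp u")
    case True
    have "entry (\<Sum>d\<in>D. row_comp dg d u) i = (\<Sum>d\<in>(\<lambda>d. d - dg i) ` D. hcomp d (entry u i))"
      by (subst sum.reindex) (auto simp: lookup_sum inj_on_def)
    also have "\<dots> = entry u i"
      using True fin by (intro sum_hcomp) (force simp: D_def image_iff)+
    finally show ?thesis .
  qed (simp add: lookup_sum supp_iff)
  with fin show ?thesis by (intro that[of D]) (auto intro: poly_mapping_eqI)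
qed

text \<open>
  A matrix whose rows are homogeneous of the right degrees is a graded homomorphism, so that it
  respects components.
\<close>

lemma row_comp_comb:
  fixes u :: "'a \<Rightarrow>\<^sub>0 ('c, 'd::field) tensor" and M :: "'a \<Rightarrow> 'b \<Rightarrow>\<^sub>0 ('c, 'd) tensor"
  assumes "supp u \<subseteq> S" "entries_in (tensor_algebra X) u"
    and "\<And>i. i \<in> S \<Longrightarrow> M i \<in> hrow X S' dg' (dg i)"
  shows "row_comp dg' d (u \<odot> M) = row_comp dg d u \<odot> M"
proof -
  obtain D0 where D0: "finite D0" "(\<Sum>e\<in>D0. row_comp dg e u) = u"
    using row_comp_decompose by blast
  define h :: "('b \<Rightarrow>\<^sub>0 ('c, 'd) tensor) \<Rightarrow> _" where "h = row_comp dg' d"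
  have h: "h (sum f A) = (\<Sum>x\<in>A. h (f x))" for f and A :: "int set"
    by (induction A rule: infinite_finite_induct) (simp_all add: h_def)
  have rc: "h (row_comp dg e u \<odot> M) = (if d = e then row_comp dg e u \<odot> M else 0)" for e
    unfolding h_def
    by (rule row_comp_of_hrow[OF hrow_comb0[OF row_comp_hrow[OF assms(1,2)] assms(3)]])
  have z: "row_comp dg d u = 0" if "d \<notin> D0"
  proof -
    have "row_comp dg d u = (\<Sum>e\<in>D0. row_comp dg d (row_comp dg e u))"
    proof -
      have "row_comp dg d (sum f A) = (\<Sum>x\<in>A. row_comp dg d (f x))" for f and A :: "int set"
        by (induction A rule: infinite_finite_induct) simp_all
      then show ?thesis using D0(2) by metis
    qed
    also have "\<dots> = 0" using that
      by (intro sum.neutral) (auto simp: row_comp_of_hrow[OF row_comp_hrow[OF assms(1,2)]])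
    finally show ?thesis .
  qed
  have "h (u \<odot> M) = (\<Sum>e\<in>D0. h (row_comp dg e u \<odot> M))"
    by (subst D0(2)[symmetric]) (simp add: comb_sum h)
  also have "\<dots> = row_comp dg d u \<odot> M"
    using D0(1) z by (auto simp: rc)
  finally show ?thesis by (simp add: h_def)
qed

section \<open>Graded ideals\<close>

lemma two_sided_ideal_closed:
  fixes I :: "('x, 'k::field) tensor set"
  assumes "two_sided_ideal X I"
  shows "a \<in> tensor_algebra X \<Longrightarrow> p \<in> I \<Longrightarrow> a * p \<in> I"
    and "p \<in> I \<Longrightarrow> a \<in> tensor_algebra X \<Longrightarrow> p * a \<in> I"
    and "add_subgroup I"
proof -
  show l: "a * p \<in> I" if "a \<in> tensor_algebra X" "p \<in> I" for a p
    using assms that one_homs(2)[of X] unfolding two_sided_ideal_def by (metis mult.right_neutral)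
  show "p * a \<in> I" if "p \<in> I" "a \<in> tensor_algebra X"
    using assms that one_homs(2)[of X] unfolding two_sided_ideal_def by (metis mult.left_neutral)
  have "(- 1 :: ('x, 'k) tensor) \<in> tensor_algebra X"
    using add_subgroupD(3)[OF add_subgroup_tensor_algebra one_homs(2)] .
  then have "- p \<in> I" if "p \<in> I" for p
    using l[OF _ that, of "- 1"] by simp
  then show "add_subgroup I"
    using assms unfolding add_subgroup_def two_sided_ideal_def
    by (metis add.inverse_inverse uminus_add_conv_diff add.commute)
qed

text \<open>
  The ideals for which \<open>T(V)/I\<close> is a connected graded algebra. Both algebras of the theorem are
  treated as instances, and \<open>I\<close> may contain elements of degree one.
\<close>

locale graded_ideal =
  fixes X :: "'x set" and I :: "('x, 'k::field) tensor set"
  assumes ideal: "two_sided_ideal X I"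
    and hcomp_mem: "p \<in> I \<Longrightarrow> hcomp d p \<in> I"
    and subset_plus: "I \<subseteq> tensor_plus X"
begin

abbreviation T where "T \<equiv> tensor_algebra X :: ('x, 'k) tensor set"
abbreviation Tp where "Tp \<equiv> tensor_plus X :: ('x, 'k) tensor set"

lemma subset_T: "I \<subseteq> T"
  using ideal by (auto simp: two_sided_ideal_def)

lemmas mult_left = two_sided_ideal_closed(1)[OF ideal]
  and mult_right = two_sided_ideal_closed(2)[OF ideal]
  and add_subgroup_I = two_sided_ideal_closed(3)[OF ideal]

lemmas entries_I = entries_in_simps[OF add_subgroup_I]
lemmas entries_T = entries_in_simps[OF add_subgroup_tensor_algebra[of X]]
lemmas entries_P = entries_in_simps[OF add_subgroup_tensor_plus[of X]]

lemma entries_I_T: "entries_in I u \<Longrightarrow> entries_in T u"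
  using entries_in_mono subset_T by blast

lemma entries_I_P: "entries_in I u \<Longrightarrow> entries_in Tp u"
  using entries_in_mono subset_plus by blast

lemma comb_I_left:
  "entries_in I u \<Longrightarrow> (\<And>i. i \<in> supp u \<Longrightarrow> entries_in T (M i)) \<Longrightarrow> entries_in I (u \<odot> M)"
  by (rule entries_in_comb[OF add_subgroup_I]) (auto intro: mult_right)

lemma comb_I_right:
  "entries_in T u \<Longrightarrow> (\<And>i. i \<in> supp u \<Longrightarrow> entries_in I (M i)) \<Longrightarrow> entries_in I (u \<odot> M)"
  by (rule entries_in_comb[OF add_subgroup_I]) (auto intro: mult_left)

lemma comb_T:
  "entries_in T u \<Longrightarrow> (\<And>i. i \<in> supp u \<Longrightarrow> entries_in T (M i)) \<Longrightarrow> entries_in T (u \<odot> M)"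
  by (rule entries_in_comb[OF add_subgroup_tensor_algebra]) (auto intro: mult_tensor_algebra)

lemma comb_P_left:
  "entries_in Tp u \<Longrightarrow> (\<And>i. i \<in> supp u \<Longrightarrow> entries_in T (M i)) \<Longrightarrow> entries_in Tp (u \<odot> M)"
  by (rule entries_in_comb[OF add_subgroup_tensor_plus]) (auto intro: mult_tensor_plus)

lemma comb_P_right:
  "entries_in T u \<Longrightarrow> (\<And>i. i \<in> supp u \<Longrightarrow> entries_in Tp (M i)) \<Longrightarrow> entries_in Tp (u \<odot> M)"
  by (rule entries_in_comb[OF add_subgroup_tensor_plus]) (auto intro: mult_tensor_plus)

lemma row_comp_entries_I: "entries_in I u \<Longrightarrow> entries_in I (row_comp dg d u)"
  by (auto simp: entries_in_def hcomp_mem)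

end

text \<open>
  If an element of \<open>J\<close> had a constant term, this term would be one of its homogeneous components
  and hence a unit in \<open>J\<close>, contrary to \<open>J \<noteq> T(V)\<close>.
\<close>

lemma graded_ideal_factor:
  assumes "graded_factor_algebra X I J"
  shows "graded_ideal X J"
proof
  have J: "two_sided_ideal X J" "J \<noteq> tensor_algebra X"
    and dec: "\<And>p. p \<in> J \<Longrightarrow> \<exists>H. finite H \<and> H \<subseteq> J \<and> (\<forall>h\<in>H. \<exists>d. homogeneous d h) \<and> p = \<Sum>H"
    using assms by (auto simp: graded_factor_algebra_def)
  show "two_sided_ideal X J" by fact
  have sum_mem: "finite H \<Longrightarrow> H \<subseteq> J \<Longrightarrow> (\<And>h. h \<in> H \<Longrightarrow> f h \<in> J) \<Longrightarrow> sum f H \<in> J" for f H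
  proof (induction H rule: finite_induct)
    case (insert h H)
    then have "f h \<in> J" "sum f H \<in> J" by auto
    with insert show ?case using J(1) by (simp add: two_sided_ideal_def)
  qed (use J(1) in \<open>simp add: two_sided_ideal_def\<close>)
  show hc: "hcomp d p \<in> J" if "p \<in> J" for p d
  proof -
    obtain H where H: "finite H" "H \<subseteq> J" "\<forall>h\<in>H. \<exists>d. homogeneous d h" "p = \<Sum>H"
      using dec[OF \<open>p \<in> J\<close>] by blast
    have "hcomp d h \<in> J" if "h \<in> H" for h
    proof -
      obtain e where "homogeneous e h" using bspec[OF H(3) \<open>h \<in> H\<close>] by (elim exE)
      then have "hcomp d h = (if d = e then h else 0)" by (rule hcomp_of_homogeneous)
      moreover have "0 \<in> J" using J(1) by (simp add: two_sided_ideal_def)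
      ultimately show ?thesis using that H(2) by auto
    qed
    then show ?thesis unfolding H(4) hcomp_sum using sum_mem[OF H(1,2)] by blast
  qed
  show "J \<subseteq> tensor_plus X"
  proof
    fix p assume p: "p \<in> J"
    then have pT: "p \<in> tensor_algebra X" using J(1) by (auto simp: two_sided_ideal_def)
    have "const_coeff p = 0"
    proof (rule ccontr)
      assume c: "const_coeff p \<noteq> 0"
      have "hcomp 0 p = sng [] (const_coeff p)"
        using homs_0_scalar[OF hcomp_homs[OF pT, of 0]] by (simp add: const_coeff_def entry_hcomp)
      then have "sng [] (const_coeff p) \<in> J" using hc[OF p, of 0] by simp
      then have "sng [] (inverse (const_coeff p)) * sng [] (const_coeff p) * a \<in> J"
        if "a \<in> tensor_algebra X" for a
        using J(1) that by (simp add: two_sided_ideal_def)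
      then have "a \<in> J" if "a \<in> tensor_algebra X" for a
        using that c by (simp add: mult_single plus_list_def flip: one_tensor)
      then show False using J by (auto simp: two_sided_ideal_def)
    qed
    with pT show "p \<in> tensor_plus X" by (simp add: tensor_plus_def)
  qed
qed

text \<open>
  Every element of \<open>T(V)\<close> is a sum of monomials. Homogeneous components are easily computed for
  products with monomials, which is why only those are asked for.
\<close>

lemma ideal_by_monomials:
  assumes "C \<subseteq> tensor_algebra X" "add_subgroup C"
    and "\<And>w c p. set w \<subseteq> X \<Longrightarrow> p \<in> C \<Longrightarrow> sng w c * p \<in> C"
    and "\<And>w c p. set w \<subseteq> X \<Longrightarrow> p \<in> C \<Longrightarrow> p * sng w c \<in> C"
  shows "two_sided_ideal X (C :: ('x, 'k::field) tensor set)"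
proof -
  have l: "a * p \<in> C" if "a \<in> tensor_algebra X" "p \<in> C" for a p
  proof -
    have "a * p = (\<Sum>w\<in>supp a. sng w (entry a w) * p)"
      by (subst sum_singles[of a]) (simp add: sum_distrib_right)
    then show ?thesis
      using that by (auto simp: mem_tensor_algebra intro!: add_subgroup_sum[OF assms(2)] assms(3))
  qed
  have r: "p * a \<in> C" if "a \<in> tensor_algebra X" "p \<in> C" for a p
  proof -
    have "p * a = (\<Sum>w\<in>supp a. p * sng w (entry a w))"
      by (subst sum_singles[of a]) (simp add: sum_distrib_left)
    then show ?thesis
      using that by (auto simp: mem_tensor_algebra intro!: add_subgroup_sum[OF assms(2)] assms(4))
  qed
  show ?thesis
    unfolding two_sided_ideal_def using assms(1) add_subgroupD(1,4)[OF assms(2)] l r by blast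
qed

lemma add_subgroup_tensor_ge2: "add_subgroup (tensor_ge2 X :: ('x, 'k::field) tensor set)"
proof -
  have "tensor_ge2 X = {p :: ('x, 'k) tensor. \<forall>w\<in>supp p. set w \<subseteq> X \<and> 2 \<le> length w}"
    by (intro set_eqI) (auto simp: tensor_ge2_def mem_tensor_algebra)
  then show ?thesis by (simp only: add_subgroup_keys)
qed

lemma two_sided_ideal_tensor_ge2: "two_sided_ideal X (tensor_ge2 X :: ('x, 'k::field) tensor set)"
proof -
  have "p * q \<in> tensor_ge2 X" if "p \<in> tensor_algebra X" "q \<in> tensor_ge2 X" for p q :: "('x, 'k) tensor"
    using that by (auto simp: tensor_ge2_def mult_tensor_algebra dest!: supp_mult_tensor)
  moreover have "q * p \<in> tensor_ge2 X" if "p \<in> tensor_algebra X" "q \<in> tensor_ge2 X" for p q :: "('x, 'k) tensor"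
    using that by (auto simp: tensor_ge2_def mult_tensor_algebra dest!: supp_mult_tensor)
  moreover have "tensor_ge2 X \<subseteq> (tensor_algebra X :: ('x, 'k) tensor set)" by (auto simp: tensor_ge2_def)
  ultimately show ?thesis
    unfolding two_sided_ideal_def using add_subgroupD(1,4)[OF add_subgroup_tensor_ge2]
    by (intro conjI ballI) simp_all
qed

text \<open>
  Both parts use that \<open>I\<close> is the least ideal that contains the generators: \<open>T(V)\<^sub>\<ge>\<^sub>2\<close> is such an
  ideal, and so is the set of all elements whose components lie in \<open>I\<close>.
\<close>

lemma graded_algebra_ideal:
  fixes I :: "('x, 'k::field) tensor set"
  assumes "graded_algebra X I"
  shows "graded_ideal X I" "I \<subseteq> tensor_ge2 X"
proof -
  obtain G where G: "G \<subseteq> tensor_algebra X" "\<forall>g\<in>G. \<exists>d\<ge>2. homogeneous d g"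
    and I: "I = generated_ideal X G"
    using assms by (auto simp: graded_algebra_def)
  have least: "I \<subseteq> C" if "two_sided_ideal X C" "G \<subseteq> C" for C
    using that by (auto simp: I generated_ideal_def)
  have GI: "G \<subseteq> I" by (auto simp: I generated_ideal_def)
  have G2: "G \<subseteq> tensor_ge2 X"
  proof
    fix g assume "g \<in> G"
    then obtain d where "d \<ge> 2" "homogeneous d g" using G by auto
    with \<open>g \<in> G\<close> G(1) show "g \<in> tensor_ge2 X"
      by (auto simp: tensor_ge2_def homogeneous_def)
  qed
  show I2: "I \<subseteq> tensor_ge2 X" by (rule least[OF two_sided_ideal_tensor_ge2 G2])
  have idl: "two_sided_ideal X I"
    unfolding two_sided_ideal_def
  proof (intro conjI ballI)
    show "I \<subseteq> tensor_algebra X" using I2 by (auto simp: tensor_ge2_def)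
  qed (unfold I generated_ideal_def, (auto simp: two_sided_ideal_def)+)
  define C where "C = {p \<in> tensor_algebra X. \<forall>d. hcomp d p \<in> I}"
  note l = two_sided_ideal_closed[OF idl] and sub = two_sided_ideal_closed(3)[OF idl]
  have "two_sided_ideal X C"
  proof (rule ideal_by_monomials)
    show "C \<subseteq> tensor_algebra X" by (auto simp: C_def)
    show "add_subgroup C"
      using sub add_subgroup_tensor_algebra[of X, where ?'k = 'k] by (auto simp: C_def add_subgroup_def)
  next
    fix w :: "'x list" and c :: 'k and p assume w: "set w \<subseteq> X" and p: "p \<in> C"
    have m: "sng w c \<in> homs X (int (length w))" using w by (auto simp: mem_homs)
    then have mT: "sng w c \<in> tensor_algebra X" by (auto simp: homs_def)
    show "sng w c * p \<in> C" "p * sng w c \<in> C"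
      using p mT by (auto simp: C_def mult_tensor_algebra hcomp_mult_homs[OF m] intro: l)
  qed
  moreover have "G \<subseteq> C"
  proof
    fix g assume g: "g \<in> G"
    then obtain d where "homogeneous d g" using G by auto
    with g G(1) GI sub show "g \<in> C"
      by (auto simp: C_def hcomp_of_homogeneous add_subgroup_def)
  qed
  ultimately have "I \<subseteq> C" by (rule least)
  moreover have "tensor_ge2 X \<subseteq> (tensor_plus X :: ('x, 'k) tensor set)"
    by (force simp: tensor_ge2_def tensor_plus_def const_coeff_def supp_iff)
  ultimately show "graded_ideal X I"
    using idl I2 by unfold_locales (auto simp: C_def)
qed

section \<open>Complexes of graded free modules\<close>

record (overloaded) ('i, 'x, 'k) gcomplex =
  cbas :: "nat \<Rightarrow> 'i set"
  cdeg :: "nat \<Rightarrow> 'i \<Rightarrow> int"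
  cdiff :: "nat \<Rightarrow> 'i \<Rightarrow> 'i \<Rightarrow>\<^sub>0 ('x, 'k) tensor"

abbreviation chains :: "'x set \<Rightarrow> ('i, 'x, 'k::field) gcomplex \<Rightarrow> nat \<Rightarrow> int \<Rightarrow> ('i \<Rightarrow>\<^sub>0 ('x, 'k) tensor) set"
  where "chains X C n e \<equiv> hrow X (cbas C n) (cdeg C n) e"

definition free_complex :: "'x set \<Rightarrow> ('x, 'k::field) tensor set \<Rightarrow> ('i, 'x, 'k) gcomplex \<Rightarrow> bool" where
  "free_complex X I C \<longleftrightarrow>
     (\<forall>n. \<forall>i\<in>cbas C (Suc n). cdiff C n i \<in> chains X C n (cdeg C (Suc n) i)) \<and>
     (\<forall>n. \<forall>i\<in>cbas C (Suc (Suc n)). entries_in I (cdiff C (Suc n) i \<odot> cdiff C n))"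

definition minimal_complex :: "'x set \<Rightarrow> ('i, 'x, 'k::field) gcomplex \<Rightarrow> bool" where
  "minimal_complex X C \<longleftrightarrow> (\<forall>n. \<forall>i\<in>cbas C (Suc n). entries_in (tensor_plus X) (cdiff C n i))"

text \<open>
  The predicate \<open>Z\<close> stands for the kernel of an augmentation of the complex. With this device
  the module that is resolved need not be named. Only homogeneous cycles are considered.
\<close>

definition acyclic_over ::
    "'x set \<Rightarrow> ('x, 'k::field) tensor set \<Rightarrow> ('i, 'x, 'k) gcomplex \<Rightarrow> (('i \<Rightarrow>\<^sub>0 ('x, 'k) tensor) \<Rightarrow> bool) \<Rightarrow> bool" where
  "acyclic_over X I C Z \<longleftrightarrow>
     (\<forall>e. \<forall>u\<in>chains X C 0 e. Z u \<longrightarrow> (\<exists>v\<in>chains X C 1 e. entries_in I (u - v \<odot> cdiff C 0))) \<and>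
     (\<forall>n e. \<forall>u\<in>chains X C (Suc n) e. entries_in I (u \<odot> cdiff C n) \<longrightarrow>
        (\<exists>v\<in>chains X C (Suc (Suc n)) e. entries_in I (u - v \<odot> cdiff C (Suc n))))"

definition chain_map ::
    "'x set \<Rightarrow> ('x, 'k::field) tensor set \<Rightarrow> ('i, 'x, 'k) gcomplex \<Rightarrow> ('j, 'x, 'k) gcomplex \<Rightarrow> int \<Rightarrow>
     (nat \<Rightarrow> 'i \<Rightarrow> 'j \<Rightarrow>\<^sub>0 ('x, 'k) tensor) \<Rightarrow> bool" where
  "chain_map X I C D m F \<longleftrightarrow>
     (\<forall>n. \<forall>i\<in>cbas C n. F n i \<in> chains X D n (cdeg C n i - m)) \<and>
     (\<forall>n. \<forall>i\<in>cbas C (Suc n). entries_in I (F (Suc n) i \<odot> cdiff D n - cdiff C n i \<odot> F n))"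

lemma acyclic_overD:
  assumes "acyclic_over X I C Z"
  shows "u \<in> chains X C 0 e \<Longrightarrow> Z u \<Longrightarrow> \<exists>v\<in>chains X C (Suc 0) e. entries_in I (u - v \<odot> cdiff C 0)"
    and "u \<in> chains X C (Suc n) e \<Longrightarrow> entries_in I (u \<odot> cdiff C n) \<Longrightarrow>
      \<exists>v\<in>chains X C (Suc (Suc n)) e. entries_in I (u - v \<odot> cdiff C (Suc n))"
  using assms by (simp_all add: acyclic_over_def)

lemma free_complexD:
  assumes "free_complex X I C"
  shows "i \<in> cbas C (Suc n) \<Longrightarrow> cdiff C n i \<in> chains X C n (cdeg C (Suc n) i)"
    "i \<in> cbas C (Suc (Suc n)) \<Longrightarrow> entries_in I (cdiff C (Suc n) i \<odot> cdiff C n)"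
    "i \<in> cbas C (Suc n) \<Longrightarrow> supp (cdiff C n i) \<subseteq> cbas C n"
    "i \<in> cbas C (Suc n) \<Longrightarrow> entries_in (tensor_algebra X) (cdiff C n i)"
  using assms by (auto simp: free_complex_def dest: hrowD)

lemma chain_mapD:
  assumes "chain_map X I C D m F"
  shows "i \<in> cbas C n \<Longrightarrow> F n i \<in> chains X D n (cdeg C n i - m)"
    "i \<in> cbas C (Suc n) \<Longrightarrow> entries_in I (F (Suc n) i \<odot> cdiff D n - cdiff C n i \<odot> F n)"
    "i \<in> cbas C n \<Longrightarrow> supp (F n i) \<subseteq> cbas D n"
    "i \<in> cbas C n \<Longrightarrow> entries_in (tensor_algebra X) (F n i)"
  using assms by (auto simp: chain_map_def dest: hrowD)

lemma chains_diff:
  assumes "free_complex X I C" "u \<in> chains X C (Suc n) e"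
  shows "u \<odot> cdiff C n \<in> chains X C n e"
  using assms by (auto intro!: hrow_comb0 dest: free_complexD)

context graded_ideal
begin

text \<open>
  The comparison theorem. Each stage is chosen from acyclicity of \<open>D\<close>; that it can be continued
  is part of what is carried along. The integer \<open>m\<close> is the amount by which internal degrees
  drop.
\<close>

lemma lift_chain_map:
  fixes C :: "('i, 'x, 'k) gcomplex" and D :: "('j, 'x, 'k) gcomplex"
  assumes C: "free_complex X I C" and D: "free_complex X I D" "acyclic_over X I D Z"
    and F0: "\<And>i. i \<in> cbas C 0 \<Longrightarrow> F0 i \<in> chains X D 0 (cdeg C 0 i - m)"
    and Z: "\<And>i. i \<in> cbas C 1 \<Longrightarrow> Z (cdiff C 0 i \<odot> F0)"
  obtains F where "F 0 = F0" "chain_map X I C D m F"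
proof -
  define ker where "ker n u = (case n of 0 \<Rightarrow> Z u | Suc k \<Rightarrow> entries_in I (u \<odot> cdiff D k))" for n u
  have ex: "\<exists>v\<in>chains X D (Suc n) e. entries_in I (v \<odot> cdiff D n - u)"
    if "u \<in> chains X D n e" "ker n u" for n e u
  proof -
    have "\<exists>v\<in>chains X D (Suc n) e. entries_in I (u - v \<odot> cdiff D n)"
      using D(2) that by (cases n) (auto simp: acyclic_over_def ker_def)
    then show ?thesis using entries_I(3) by (metis minus_diff_eq)
  qed
  define P where "P n F \<longleftrightarrow> (n = 0 \<longrightarrow> F = F0) \<and>
      (\<forall>i\<in>cbas C n. F i \<in> chains X D n (cdeg C n i - m)) \<and>
      (\<forall>i\<in>cbas C (Suc n). ker n (cdiff C n i \<odot> F))" for n F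
  define Q where "Q n F F' \<longleftrightarrow>
      (\<forall>i\<in>cbas C (Suc n). entries_in I (F' i \<odot> cdiff D n - cdiff C n i \<odot> F))" for n F F'
  have "\<exists>F. \<forall>n. P n (F n) \<and> Q n (F n) (F (Suc n))"
  proof (rule dependent_nat_choice)
    show "\<exists>F. P 0 F" using F0 Z by (auto simp: P_def ker_def)
  next
    fix F n assume P: "P n F"
    have Fh: "F i \<in> chains X D n (cdeg C n i - m)" if "i \<in> cbas C n" for i using P that by (auto simp: P_def)
    have "\<exists>v\<in>chains X D (Suc n) (cdeg C (Suc n) i - m). entries_in I (v \<odot> cdiff D n - cdiff C n i \<odot> F)"
      if i: "i \<in> cbas C (Suc n)" for i
    proof (rule ex)
      show "cdiff C n i \<odot> F \<in> chains X D n (cdeg C (Suc n) i - m)"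
        using Fh by (rule hrow_comb[OF free_complexD(1)[OF C i]])
      show "ker n (cdiff C n i \<odot> F)" using P i by (auto simp: P_def)
    qed
    then obtain F' where F': "\<And>i. i \<in> cbas C (Suc n) \<Longrightarrow> F' i \<in> chains X D (Suc n) (cdeg C (Suc n) i - m)"
        "\<And>i. i \<in> cbas C (Suc n) \<Longrightarrow> entries_in I (F' i \<odot> cdiff D n - cdiff C n i \<odot> F)"
      by metis
    have "ker (Suc n) (cdiff C (Suc n) i \<odot> F')" if i: "i \<in> cbas C (Suc (Suc n))" for i
    proof -
      note ci = free_complexD[OF C]
      have "entries_in I (cdiff C (Suc n) i \<odot> (\<lambda>k. F' k \<odot> cdiff D n - cdiff C n k \<odot> F))"
        using ci(3,4)[OF i] F'(2) by (intro comb_I_right) auto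
      moreover have "entries_in I (cdiff C (Suc n) i \<odot> cdiff C n \<odot> F)"
      proof (rule comb_I_left[OF ci(2)[OF i]])
        fix k assume "k \<in> supp (cdiff C (Suc n) i \<odot> cdiff C n)"
        moreover have "\<dots> \<subseteq> cbas C n" using ci(3) i by (intro supp_comb) blast
        ultimately show "entries_in T (F k)" using Fh hrowD(3) by blast
      qed
      ultimately have "entries_in I (cdiff C (Suc n) i \<odot> F' \<odot> cdiff D n)"
        using entries_I(4) by (fastforce simp: comb_diff_right comb_assoc)
      then show ?thesis by (simp add: ker_def)
    qed
    with F' show "\<exists>F'. P (Suc n) F' \<and> Q n F F'" by (auto simp: P_def Q_def)
  qed
  then obtain F where "\<And>n. P n (F n)" "\<And>n. Q n (F n) (F (Suc n))" by blast
  then show thesis by (intro that[of F]) (auto simp: P_def Q_def chain_map_def)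
qed

text \<open>
  A chain map that lifts zero has the form \<open>s d + d s\<close> modulo \<open>I\<close>, and by minimality of both
  complexes the two terms have entries in \<open>T(V)\<^sub>+\<close>. Consequently, two lifts of the same map
  cannot be told apart by homomorphisms to \<open>K\<close>.
\<close>

lemma chain_map_vanishes:
  fixes C :: "('i, 'x, 'k) gcomplex" and D :: "('j, 'x, 'k) gcomplex"
  assumes C: "free_complex X I C" "minimal_complex X C"
    and D: "free_complex X I D" "minimal_complex X D" "acyclic_over X I D Z"
    and F: "chain_map X I C D m F"
    and Z: "\<And>i. i \<in> cbas C 0 \<Longrightarrow> Z (F 0 i)"
    and i: "i \<in> cbas C n"
  shows "entries_in Tp (F n i)"
proof -
  note cC = free_complexD[OF C(1)] and cD = free_complexD[OF D(1)] and cF = chain_mapD[OF F]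
  \<comment> \<open>The homotopy \<open>s\<close> in degree \<open>n\<close> is required to make \<open>F - d s\<close> a cycle in degree \<open>n + 1\<close>,
    which is what its next stage needs.\<close>
  define P where "P n s \<longleftrightarrow> (\<forall>i\<in>cbas C n. s i \<in> chains X D (Suc n) (cdeg C n i - m)) \<and>
      (\<forall>i\<in>cbas C (Suc n). entries_in I ((F (Suc n) i - cdiff C n i \<odot> s) \<odot> cdiff D n)) \<and>
      (\<forall>i\<in>cbas C n. entries_in Tp (F n i))" for n s
  have bd: "entries_in Tp (v \<odot> cdiff D n)" if "v \<in> chains X D (Suc n) e" for v n e
    using hrowD(1,3)[OF that] D(2) by (intro comb_P_right) (auto simp: minimal_complex_def)
  have "\<exists>s. P n s" for n
  proof (induction n)
    case 0
    have "\<exists>v\<in>chains X D 1 (cdeg C 0 i - m). entries_in I (F 0 i - v \<odot> cdiff D 0)" if "i \<in> cbas C 0" for i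
      using D(3) cF(1)[OF that] Z[OF that] by (auto simp: acyclic_over_def)
    then obtain s where s: "\<And>i. i \<in> cbas C 0 \<Longrightarrow> s i \<in> chains X D (Suc 0) (cdeg C 0 i - m)"
        "\<And>i. i \<in> cbas C 0 \<Longrightarrow> entries_in I (F 0 i - s i \<odot> cdiff D 0)"
      by (metis One_nat_def)
    have "entries_in I ((F (Suc 0) i - cdiff C 0 i \<odot> s) \<odot> cdiff D 0)" if i: "i \<in> cbas C (Suc 0)" for i
    proof -
      have "entries_in I (cdiff C 0 i \<odot> (\<lambda>k. F 0 k - s k \<odot> cdiff D 0))"
        using cC(3,4)[OF i] s(2) by (intro comb_I_right) auto
      from entries_I(4)[OF cF(2)[OF i] this] show ?thesis
        by (simp add: comb_diff_right comb_diff comb_assoc)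
    qed
    moreover have "entries_in Tp (F 0 i)" if "i \<in> cbas C 0" for i
      using entries_P(4)[OF entries_I_P[OF s(2)[OF that]] bd[OF s(1)[OF that]]] by simp
    ultimately show ?case using s by (auto simp: P_def)
  next
    case (Suc n)
    then obtain s where s: "\<And>i. i \<in> cbas C n \<Longrightarrow> s i \<in> chains X D (Suc n) (cdeg C n i - m)"
        "\<And>i. i \<in> cbas C (Suc n) \<Longrightarrow> entries_in I ((F (Suc n) i - cdiff C n i \<odot> s) \<odot> cdiff D n)"
      by (auto simp: P_def)
    have "\<exists>v\<in>chains X D (Suc (Suc n)) (cdeg C (Suc n) i - m).
        entries_in I (F (Suc n) i - cdiff C n i \<odot> s - v \<odot> cdiff D (Suc n))" if i: "i \<in> cbas C (Suc n)" for i
    proof -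
      have "F (Suc n) i - cdiff C n i \<odot> s \<in> chains X D (Suc n) (cdeg C (Suc n) i - m)"
        using cF(1)[OF i] hrow_comb[OF cC(1)[OF i] s(1)] by (rule hrow_simps(2))
      with D(3) s(2)[OF i] show ?thesis by (auto simp: acyclic_over_def)
    qed
    then obtain s' where s': "\<And>i. i \<in> cbas C (Suc n) \<Longrightarrow> s' i \<in> chains X D (Suc (Suc n)) (cdeg C (Suc n) i - m)"
        "\<And>i. i \<in> cbas C (Suc n) \<Longrightarrow> entries_in I (F (Suc n) i - cdiff C n i \<odot> s - s' i \<odot> cdiff D (Suc n))"
      by metis
    have "entries_in I ((F (Suc (Suc n)) i - cdiff C (Suc n) i \<odot> s') \<odot> cdiff D (Suc n))"
      if i: "i \<in> cbas C (Suc (Suc n))" for i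
    proof -
      have "entries_in I (cdiff C (Suc n) i \<odot> (\<lambda>k. F (Suc n) k - cdiff C n k \<odot> s - s' k \<odot> cdiff D (Suc n)))"
        using cC(3,4)[OF i] s'(2) by (intro comb_I_right) auto
      moreover have "entries_in I (cdiff C (Suc n) i \<odot> cdiff C n \<odot> s)"
      proof (rule comb_I_left[OF cC(2)[OF i]])
        fix k assume "k \<in> supp (cdiff C (Suc n) i \<odot> cdiff C n)"
        moreover have "\<dots> \<subseteq> cbas C n" using cC(3) i by (intro supp_comb) blast
        ultimately show "entries_in T (s k)" using s(1) hrowD(3) by blast
      qed
      ultimately have "entries_in I (cdiff C (Suc n) i \<odot> (\<lambda>k. F (Suc n) k - s' k \<odot> cdiff D (Suc n)))"
        using entries_I(4) by (fastforce simp: comb_diff_right comb_assoc)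
      from entries_I(4)[OF cF(2)[OF i] this] show ?thesis
        by (simp add: comb_diff_right comb_diff comb_assoc)
    qed
    moreover have "entries_in Tp (F (Suc n) i)" if i: "i \<in> cbas C (Suc n)" for i
    proof -
      have "entries_in Tp (cdiff C n i \<odot> s)"
      proof (rule comb_P_left)
        show "entries_in Tp (cdiff C n i)" using C(2) i by (auto simp: minimal_complex_def)
        show "entries_in T (s k)" if "k \<in> supp (cdiff C n i)" for k
          using cC(3)[OF i] that s(1) hrowD(3) by blast
      qed
      from entries_P(4)[OF entries_P(4)[OF entries_I_P[OF s'(2)[OF i]] bd[OF s'(1)[OF i]]] this]
      show ?thesis by simp
    qed
    ultimately show ?case using s' by (auto simp: P_def)
  qed
  with i show ?thesis by (auto simp: P_def)
qed

end

section \<open>The complex of a minimal resolution\<close>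

definition complex_of :: "('x, 'k::field) resolution \<Rightarrow> (nat, 'x, 'k) gcomplex" where
  "complex_of Q = \<lparr>cbas = bas Q, cdeg = bdeg Q, cdiff = (\<lambda>n. mat Q (Suc n))\<rparr>"

lemma complex_of_simps [simp]:
  "cbas (complex_of Q) = bas Q" "cdeg (complex_of Q) = bdeg Q" "cdiff (complex_of Q) n = mat Q (Suc n)"
  by (simp_all add: complex_of_def)

context graded_ideal
begin

lemma zero_mem_I: "0 \<in> I"
  using add_subgroup_I by (simp add: add_subgroup_def)

text \<open>
  A preimage of a homogeneous row is made homogeneous by passing to its component of that
  degree.
\<close>

lemma
  assumes "minimal_resolution X I W Q"
  shows resolution_free_complex: "free_complex X I (complex_of Q)"
    and resolution_minimal: "minimal_complex X (complex_of Q)"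
    and resolution_acyclic: "acyclic_over X I (complex_of Q) (\<lambda>u. u \<odot> mat Q 0 \<in> rels W)"
    and resolution_augmentation: "i \<in> bas Q 1 \<Longrightarrow> mat Q 1 i \<odot> mat Q 0 \<in> rels W"
proof -
  have mat: "mat Q (Suc n) i \<in> rows Tp (bas Q n)" "mat Q (Suc n) i \<in> chains X (complex_of Q) n (bdeg Q (Suc n) i)"
    if "i \<in> bas Q (Suc n)" for n i
    using assms that by (auto simp: minimal_resolution_def graded_free_resolution_def hrow_iff)
  have eq: "{u \<in> rows T (bas Q n). u \<odot> mat Q n \<in> zero_rows I W Q n} =
      {v \<odot> mat Q (Suc n) + w | v w. v \<in> rows T (bas Q (Suc n)) \<and> w \<in> rows I (bas Q n)}" for n
    using assms by (auto simp: minimal_resolution_def graded_free_resolution_def row_mult_eq)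
  have dd: "mat Q (Suc n) i \<odot> mat Q n \<in> zero_rows I W Q n" if "i \<in> bas Q (Suc n)" for n i
  proof -
    have "unit_row i \<in> rows T (bas Q (Suc n))" "0 \<in> rows I (bas Q n)"
      using that by (auto simp: rows_iff zero_mem_I entries_in_def lookup_single when_def)
    then have "unit_row i \<odot> mat Q (Suc n) + 0 \<in> {u \<in> rows T (bas Q n). u \<odot> mat Q n \<in> zero_rows I W Q n}"
      unfolding eq by blast
    then show ?thesis by simp
  qed
  show "free_complex X I (complex_of Q)"
    unfolding free_complex_def using mat(2) dd
    by (force simp: zero_rows_def rows_iff zero_mem_I)
  show "minimal_complex X (complex_of Q)"
    unfolding minimal_complex_def using mat(1) by (auto simp: rows_iff)
  show "mat Q 1 i \<odot> mat Q 0 \<in> rels W" if "i \<in> bas Q 1" using dd[of i 0] that by (simp add: zero_rows_def)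
  have ex: "\<exists>v\<in>chains X (complex_of Q) (Suc n) e. entries_in I (u - v \<odot> mat Q (Suc n))"
    if u: "u \<in> chains X (complex_of Q) n e" "u \<odot> mat Q n \<in> zero_rows I W Q n" for n e u
  proof -
    have "u \<in> {u \<in> rows T (bas Q n). u \<odot> mat Q n \<in> zero_rows I W Q n}"
      using u by (auto simp: hrow_iff)
    then obtain v w where vw: "u = v \<odot> mat Q (Suc n) + w" "v \<in> rows T (bas Q (Suc n))" "w \<in> rows I (bas Q n)"
      unfolding eq by blast
    then have v: "supp v \<subseteq> bas Q (Suc n)" "entries_in T v" and w: "entries_in I w"
      by (auto simp: rows_iff zero_mem_I)
    let ?v = "row_comp (bdeg Q (Suc n)) e v"
    have "u = row_comp (bdeg Q n) e u" using row_comp_of_hrow[OF u(1)] by simp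
    also have "\<dots> = ?v \<odot> mat Q (Suc n) + row_comp (bdeg Q n) e w"
      unfolding vw(1) row_comp_simps using mat(2) by (subst row_comp_comb[OF v]) auto
    finally have "entries_in I (u - ?v \<odot> mat Q (Suc n))"
      using row_comp_entries_I[OF w] by (metis add_diff_cancel_left')
    moreover have "?v \<in> chains X (complex_of Q) (Suc n) e" using row_comp_hrow[OF v] by simp
    ultimately show ?thesis by blast
  qed
  have "u \<odot> mat Q (Suc n) \<in> zero_rows I W Q (Suc n)"
    if "u \<in> chains X (complex_of Q) (Suc n) e" "entries_in I (u \<odot> mat Q (Suc n))" for n e u
  proof -
    have "supp (u \<odot> mat Q (Suc n)) \<subseteq> bas Q n"
      using hrowD(1)[OF that(1)] mat(1) by (intro supp_comb) (auto simp: rows_iff)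
    with that(2) show ?thesis by (simp add: zero_rows_def rows_iff zero_mem_I)
  qed
  with ex[where n = 0] ex[where n = "Suc _"]
  show "acyclic_over X I (complex_of Q) (\<lambda>u. u \<odot> mat Q 0 \<in> rels W)"
    by (auto simp: acyclic_over_def zero_rows_def)
qed

end

section \<open>Existence of minimal resolutions\<close>

abbreviation scalar_mult :: "'k::field \<Rightarrow> ('i \<Rightarrow>\<^sub>0 ('x, 'k) tensor) \<Rightarrow> ('i \<Rightarrow>\<^sub>0 ('x, 'k) tensor)" where
  "scalar_mult c u \<equiv> scale_by (sng [] c) u"

lemma scalar_tensor_mult: "sng [] (a * b) = (sng [] a * sng [] b :: ('x, 'k::field) tensor)"
  by (simp add: mult_single plus_list_def)

interpretation row_space: vector_space "scalar_mult :: 'k::field \<Rightarrow> ('i \<Rightarrow>\<^sub>0 ('x, 'k) tensor) \<Rightarrow> _"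
  by unfold_locales
    (simp_all add: scale_by_add single_add scalar_tensor_mult flip: one_tensor)

text \<open>
  Extend a basis of \<open>Y\<close> to a basis of \<open>V\<close>, and discard the basis of \<open>Y\<close>.
\<close>

lemma (in vector_space) independent_modulo_subspace:
  assumes "subspace Y" "Y \<subseteq> V"
  obtains B where "B \<subseteq> V" "V \<subseteq> span (Y \<union> B)" "independent B"
    "\<And>F c. finite F \<Longrightarrow> F \<subseteq> B \<Longrightarrow> (\<Sum>b\<in>F. scale (c b) b) \<in> Y \<Longrightarrow> \<forall>b\<in>F. c b = 0"
proof -
  obtain BY where BY: "BY \<subseteq> Y" "independent BY" "Y \<subseteq> span BY"
    by (rule maximal_independent_subset[of Y]) blast
  obtain B' where B': "BY \<subseteq> B'" "B' \<subseteq> V" "independent B'" "V \<subseteq> span B'"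
    by (rule maximal_independent_subset_extend[of BY V]) (use BY assms(2) in blast)+
  show thesis
  proof (rule that[of "B' - BY"])
    show "B' - BY \<subseteq> V" using B' by blast
    have "B' \<subseteq> Y \<union> (B' - BY)" using BY(1) by blast
    then show "V \<subseteq> span (Y \<union> (B' - BY))" using B'(4) span_mono by blast
    show "independent (B' - BY)" using B'(3) by (rule independent_mono) blast
    fix F c assume F: "finite F" "F \<subseteq> B' - BY" "(\<Sum>b\<in>F. scale (c b) b) \<in> Y"
    then have "(\<Sum>b\<in>F. scale (c b) b) \<in> span BY" using BY(3) by blast
    then obtain t r where t: "finite t" "t \<subseteq> BY" "(\<Sum>b\<in>F. scale (c b) b) = (\<Sum>a\<in>t. scale (r a) a)"
      unfolding span_explicit by blast
    define c' where "c' b = (if b \<in> F then c b else - r b)" for b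
    have dis: "F \<inter> t = {}" using F(2) t(2) by blast
    have "(\<Sum>b\<in>F \<union> t. scale (c' b) b) = (\<Sum>b\<in>F. scale (c' b) b) + (\<Sum>b\<in>t. scale (c' b) b)"
      using F(1) t(1) dis by (rule sum.union_disjoint)
    also have "(\<Sum>b\<in>F. scale (c' b) b) = (\<Sum>b\<in>F. scale (c b) b)"
      by (intro sum.cong) (auto simp: c'_def)
    also have "(\<Sum>b\<in>t. scale (c' b) b) = - (\<Sum>b\<in>t. scale (r b) b)"
      unfolding sum_negf[symmetric] using dis by (intro sum.cong) (auto simp: c'_def)
    finally have "(\<Sum>b\<in>F \<union> t. scale (c' b) b) = 0" using t(3) by simp
    moreover have "F \<union> t \<subseteq> B'" using F(2) t(2) B'(1) by blast
    ultimately have "c' b = 0" if "b \<in> F" for b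
      using independentD[OF B'(3), of "F \<union> t" c' b] F(1) t(1) that by blast
    then show "\<forall>b\<in>F. c b = 0" by (auto simp: c'_def)
  qed
qed

text \<open>
  A spanning set consists of the words of the right length at each of the finitely many basis
  elements of degree at most \<open>d\<close>. Only finitely many generators are therefore needed in each
  degree.
\<close>

lemma hrow_finite_span:
  assumes "finite X" "finite {j \<in> S. dg j \<le> d}"
  obtains G :: "('i \<Rightarrow>\<^sub>0 ('x, 'k::field) tensor) set"
  where "finite G" "hrow X S dg d \<subseteq> row_space.span G"
proof -
  define G :: "('i \<Rightarrow>\<^sub>0 ('x, 'k) tensor) set" where
    "G = (\<Union>j\<in>{j \<in> S. dg j \<le> d}. (\<lambda>w. sng j (sng w 1)) ` {w. set w \<subseteq> X \<and> length w = nat (d - dg j)})"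
  have "finite G" unfolding G_def using assms
    by (intro finite_UN_I finite_imageI finite_lists_length_eq) auto
  moreover have "u \<in> row_space.span G" if u: "u \<in> hrow X S dg d" for u
  proof -
    have "sng j (entry u j) \<in> row_space.span G" if "j \<in> supp u" for j
    proof -
      have "sng j (entry u j) = (\<Sum>w\<in>supp (entry u j). sng j (sng w (entry (entry u j) w)))"
        by (subst sum_singles[of "entry u j"], rule poly_mapping_eqI)
          (simp add: lookup_sum lookup_single when_def)
      also have "\<dots> \<in> row_space.span G"
      proof (rule row_space.span_sum)
        fix w assume w: "w \<in> supp (entry u j)"
        then have l: "set w \<subseteq> X" "int (length w) = d - dg j"
          using hrowD(2)[OF u, of j] by (auto simp: mem_homs)
        have "sng j (sng w (1::'k)) \<in> G"
          using l hrowD(1)[OF u] \<open>j \<in> supp u\<close> by (auto simp: G_def intro!: imageI exI[of _ j])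
        from row_space.span_scale[OF row_space.span_base[OF this], of "entry (entry u j) w"]
        show "sng j (sng w (entry (entry u j) w)) \<in> row_space.span G"
          by (simp add: mult_single plus_list_def)
      qed
      finally show ?thesis .
    qed
    then have "(\<Sum>j\<in>supp u. sng j (entry u j)) \<in> row_space.span G" by (rule row_space.span_sum)
    then show ?thesis by (simp flip: sum_singles)
  qed
  ultimately show thesis by (intro that[of G]) auto
qed

definition locally_finite :: "'i set \<Rightarrow> ('i \<Rightarrow> int) \<Rightarrow> bool" where
  "locally_finite S dg \<longleftrightarrow> (\<forall>m. finite {i \<in> S. dg i \<le> m})"

lemma locally_finite_lower_bound:
  assumes "locally_finite S dg"
  obtains b where "\<And>i. i \<in> S \<Longrightarrow> b \<le> dg i"
proof -
  have fin: "finite (insert 0 (dg ` {i \<in> S. dg i \<le> 0}))" using assms by (simp add: locally_finite_def)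
  show thesis
  proof (rule that)
    fix i assume "i \<in> S"
    then show "Min (insert 0 (dg ` {i \<in> S. dg i \<le> 0})) \<le> dg i"
      using fin by (cases "dg i \<le> 0") (auto intro: Min_le order.trans[OF Min_le[OF fin]])
  qed
qed

context graded_ideal
begin

text \<open>
  The submodules over \<open>T(V)/I\<close> of the free module on \<open>S\<close>, pulled back to \<open>T(V)\<close>.
\<close>

definition submodule :: "'i set \<Rightarrow> ('i \<Rightarrow>\<^sub>0 ('x, 'k) tensor) set \<Rightarrow> bool" where
  "submodule S Z \<longleftrightarrow> add_subgroup Z \<and> (\<forall>u\<in>Z. supp u \<subseteq> S \<and> entries_in T u) \<and>
     (\<forall>a\<in>T. \<forall>u\<in>Z. scale_by a u \<in> Z) \<and> {u. supp u \<subseteq> S \<and> entries_in I u} \<subseteq> Z"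

text \<open>
  The generators of degree \<open>d\<close> span a complement, in the part \<open>Z\<^sub>d\<close> of degree \<open>d\<close>, of the space
  \<open>Y\<^sub>d\<close> spanned by \<open>V Z\<^sub>d\<^sub>-\<^sub>1\<close> and the rows over \<open>I\<close>. They generate by induction on the degree,
  which is bounded below. A relation between them has no constant coefficients: in degree \<open>d\<close>
  these would be the coefficients of a relation modulo \<open>Y\<^sub>d\<close>. The last conclusion, which says
  this, is what makes the resolution built from such generators minimal.
\<close>

lemma minimal_generators:
  fixes Z :: "('i \<Rightarrow>\<^sub>0 ('x, 'k) tensor) set"
  assumes X: "finite X" and S: "locally_finite S dg" and Z: "submodule S Z"
  obtains S' :: "nat set" and dg' M where
    "locally_finite S' dg'"
    "\<And>i. i \<in> S' \<Longrightarrow> M i \<in> hrow X S dg (dg' i) \<inter> Z"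
    "\<And>e z. z \<in> hrow X S dg e \<inter> Z \<Longrightarrow> \<exists>v\<in>hrow X S' dg' e. entries_in I (z - v \<odot> M)"
    "\<And>v. supp v \<subseteq> S' \<Longrightarrow> entries_in T v \<Longrightarrow> entries_in I (v \<odot> M) \<Longrightarrow> entries_in Tp v"
proof -
  define Zd where "Zd d = hrow X S dg d \<inter> Z" for d
  have Zsub: "add_subgroup Z" and Zscale: "\<And>a u. a \<in> T \<Longrightarrow> u \<in> Z \<Longrightarrow> scale_by a u \<in> Z"
    and ZI: "\<And>u. supp u \<subseteq> S \<Longrightarrow> entries_in I u \<Longrightarrow> u \<in> Z"
    using Z by (auto simp: submodule_def)
  have Zd_scale: "scale_by a z \<in> Zd (e + d)" if "a \<in> homs X e" "z \<in> Zd d" for a e z d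
    using that hrow_scale_by Zscale[OF subsetD[OF homs_subset]] by (auto simp: Zd_def)
  have Zd_subspace: "row_space.subspace (Zd d)" for d
    unfolding row_space.subspace_def
    using Zd_scale[OF scalar_homs(1)] hrow_simps(1,3) add_subgroupD(1,4)[OF Zsub]
    by (fastforce simp: Zd_def)
  define YG where "YG d = {scale_by (var x) z | x z. x \<in> X \<and> z \<in> Zd (d - 1)} \<union>
      {r \<in> hrow X S dg d. entries_in I r}" for d
  define Y where "Y d = row_space.span (YG d)" for d
  have var: "var x \<in> homs X 1" if "x \<in> X" for x using that by (auto simp: var_def mem_homs)
  have YG_sub: "YG d \<subseteq> Zd d" for d
    using Zd_scale[OF var, of _ _ "d - 1"] ZI hrowD(1) by (fastforce simp: YG_def Zd_def)
  then have Y_sub: "Y d \<subseteq> Zd d" for d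
    unfolding Y_def by (rule row_space.span_minimal[OF _ Zd_subspace])
  have Y_subspace: "row_space.subspace (Y d)" for d by (simp add: Y_def row_space.subspace_span)
  \<comment> \<open>Peel off the first letter of each monomial of the multiplier.\<close>
  have Y_mult: "scale_by a z \<in> Y (e + d)" if a: "a \<in> homs X e" and e: "e > 0" and z: "z \<in> Zd d" for a e z d
  proof -
    have "scale_by a z = (\<Sum>w\<in>supp a. scale_by (sng w (entry a w)) z)"
    proof -
      have "scale_by (sum f A) z = (\<Sum>w\<in>A. scale_by (f w) z)" for f and A :: "'x list set"
        by (induction A rule: infinite_finite_induct) (simp_all add: scale_by_add)
      then show ?thesis using sum_singles[of a] by metis
    qed
    also have "\<dots> \<in> Y (e + d)"
      unfolding Y_def
    proof (rule row_space.span_sum, rule row_space.span_base)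
      fix w assume w: "w \<in> supp a"
      with a e obtain x w' where xw: "w = x # w'" "x \<in> X" "set w' \<subseteq> X" "int (length w') = e - 1"
        by (cases w) (auto simp: mem_homs)
      have "sng w' (entry a w) \<in> homs X (e - 1)" using xw by (auto simp: mem_homs)
      from Zd_scale[OF this z] have "scale_by (sng w' (entry a w)) z \<in> Zd (e + d - 1)" by (simp add: algebra_simps)
      moreover have "scale_by (sng w (entry a w)) z = scale_by (var x) (scale_by (sng w' (entry a w)) z)"
        using xw by (simp add: var_def mult_single plus_list_def)
      ultimately show "scale_by (sng w (entry a w)) z \<in> YG (e + d)" using xw(2) by (auto simp: YG_def)
    qed
    finally show ?thesis .
  qed
  define complements where "complements d B \<longleftrightarrow>
      B \<subseteq> Zd d \<and> Zd d \<subseteq> row_space.span (Y d \<union> B) \<and> row_space.independent B \<and>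
      (\<forall>F c. finite F \<longrightarrow> F \<subseteq> B \<longrightarrow> (\<Sum>b\<in>F. scalar_mult (c b) b) \<in> Y d \<longrightarrow> (\<forall>b\<in>F. c b = 0))"
    for d B
  have "\<exists>B. complements d B" for d
    unfolding complements_def by (rule row_space.independent_modulo_subspace[OF Y_subspace Y_sub]) blast
  then obtain B where B0: "\<And>d. complements d (B d)" by metis
  note B = B0[unfolded complements_def, THEN conjunct1]
    B0[unfolded complements_def, THEN conjunct2, THEN conjunct1]
    B0[unfolded complements_def, THEN conjunct2, THEN conjunct2, THEN conjunct1]
    B0[unfolded complements_def, THEN conjunct2, THEN conjunct2, THEN conjunct2, rule_format]
  have finB: "finite (B d)" for d
  proof -
    obtain G :: "('i \<Rightarrow>\<^sub>0 ('x, 'k) tensor) set" where "finite G" "hrow X S dg d \<subseteq> row_space.span G"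
    proof (rule hrow_finite_span[OF X])
      show "finite {j \<in> S. dg j \<le> d}" using S by (simp add: locally_finite_def)
    qed
    moreover from this(2) have "B d \<subseteq> row_space.span G" using B(1)[of d] unfolding Zd_def by blast
    ultimately show ?thesis using row_space.independent_span_bound[OF _ B(3)] by blast
  qed
  have nonzero: "0 \<notin> B d" for d
    using B(3)[of d] row_space.dependent_zero by blast
  obtain lb where lb: "\<And>i. i \<in> S \<Longrightarrow> lb \<le> dg i"
    using locally_finite_lower_bound[OF S] by blast
  have Zd_low: "Zd d \<subseteq> {0}" if "d < lb" for d
  proof
    fix z assume "z \<in> Zd d"
    then have z: "z \<in> hrow X S dg d" by (simp add: Zd_def)
    have "entry z i = 0" for i
    proof (cases "i \<in> S")
      case True then show ?thesis using homs_negative[OF hrowD(2)[OF z]] lb[OF True] that by simp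
    next
      case False then show ?thesis using hrowD(1)[OF z] by (auto simp: supp_iff)
    qed
    then show "z \<in> {0}" by (auto intro: poly_mapping_eqI)
  qed
  \<comment> \<open>Generators are indexed by their degree together with their value; this countable set is
    then coded by natural numbers.\<close>
  define U where "U = Sigma UNIV B"
  have cU: "countable U" unfolding U_def using finB by (intro countable_SIGMA) (auto intro: countable_finite)
  define S' where "S' = to_nat_on U ` U"
  define g where "g = from_nat_into U"
  define dg' where "dg' i = fst (g i)" for i
  define M where "M i = snd (g i)" for i
  have g: "g (to_nat_on U p) = p" if "p \<in> U" for p using that cU by (simp add: g_def)
  have M_B: "M i \<in> B (dg' i)" if "i \<in> S'" for i
    using that g by (auto simp: S'_def M_def dg'_def U_def)
  then have M_Zd: "M i \<in> Zd (dg' i)" if "i \<in> S'" for i using that B(1) by blast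
  have inj: "i = j" if "i \<in> S'" "j \<in> S'" "dg' i = dg' j" "M i = M j" for i j
    using that g by (auto simp: S'_def M_def dg'_def)
  show thesis
  proof (rule that)
    have "{i \<in> S'. dg' i \<le> m} \<subseteq> to_nat_on U ` (Sigma {lb..m} B)" for m
    proof
      fix i assume i: "i \<in> {i \<in> S'. dg' i \<le> m}"
      then have "lb \<le> dg' i" using M_B[of i] nonzero B(1)[of "dg' i"] Zd_low[of "dg' i"] by force
      moreover have "i = to_nat_on U (dg' i, M i)" using i g by (auto simp: S'_def M_def dg'_def)
      ultimately show "i \<in> to_nat_on U ` (Sigma {lb..m} B)" using i M_B[of i] by auto
    qed
    moreover have "finite (to_nat_on U ` (Sigma {lb..m} B))" for m using finB by auto
    ultimately show "locally_finite S' dg'" unfolding locally_finite_def using finite_subset by blast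
    show "M i \<in> hrow X S dg (dg' i) \<inter> Z" if "i \<in> S'" for i using M_Zd[OF that] by (simp add: Zd_def)
    have Mh: "M i \<in> hrow X S dg (dg' i)" if "i \<in> S'" for i using M_Zd[OF that] by (simp add: Zd_def)
    show "\<exists>v\<in>hrow X S' dg' e. entries_in I (z - v \<odot> M)" if "z \<in> hrow X S dg e \<inter> Z" for e z
    proof -
      define G where "G e = {z. \<exists>v\<in>hrow X S' dg' e. entries_in I (z - v \<odot> M)}" for e
      have "z \<in> G e" if "z \<in> Zd e" for e z
        using that
      proof (induction "nat (e - lb + 1)" arbitrary: e z rule: less_induct)
        case less
        show ?case
        proof (cases "e < lb")
          case True
          with less.prems Zd_low have "z = 0" by blast
          then show ?thesis using entries_I(1) by (auto simp: G_def intro!: bexI[of _ 0])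
        next
          case False
          have subsp: "row_space.subspace (G e)"
            unfolding row_space.subspace_def
          proof (intro conjI ballI allI)
            show "0 \<in> G e" using entries_I(1) by (auto simp: G_def intro!: bexI[of _ 0])
            fix a assume "a \<in> G e"
            then obtain v where v: "v \<in> hrow X S' dg' e" "entries_in I (a - v \<odot> M)" by (auto simp: G_def)
            show "a + b \<in> G e" if b: "b \<in> G e" for b
            proof -
              obtain v' where v': "v' \<in> hrow X S' dg' e" "entries_in I (b - v' \<odot> M)"
                using b by (auto simp: G_def)
              have "entries_in I (a + b - (v + v') \<odot> M)"
                using entries_I(4)[OF v(2) v'(2)] by (simp add: comb_add algebra_simps)
              then show ?thesis using hrow_simps(3)[OF v(1) v'(1)] by (auto simp: G_def)
            qed
            show "scalar_mult c a \<in> G e" for c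
            proof -
              have "entries_in I (scalar_mult c (a - v \<odot> M))"
                using v(2) mult_left by (auto simp: entries_in_def)
              then have "entries_in I (scalar_mult c a - scalar_mult c v \<odot> M)"
                by (simp add: scale_by_diff comb_scale_by)
              then show ?thesis using hrow_scale_by[OF scalar_homs(1) v(1), of c] by (auto simp: G_def)
            qed
          qed
          have "B e \<subseteq> G e"
          proof
            fix b assume b: "b \<in> B e"
            define i where "i = to_nat_on U (e, b)"
            have i: "i \<in> S'" "dg' i = e" "M i = b"
              using b g[of "(e, b)"] by (auto simp: i_def S'_def U_def dg'_def M_def)
            then show "b \<in> G e" using entries_I(1) by (auto simp: G_def intro!: bexI[of _ "unit_row i"])
          qed
          moreover have "YG e \<subseteq> G e"
          proof
            fix y assume "y \<in> YG e"
            then consider x z where "y = scale_by (var x) z" "x \<in> X" "z \<in> Zd (e - 1)"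
              | "y \<in> hrow X S dg e" "entries_in I y" by (auto simp: YG_def)
            then show "y \<in> G e"
            proof cases
              case 1
              have "z \<in> G (e - 1)" using less.hyps[OF _ 1(3)] False by simp
              then obtain v where v: "v \<in> hrow X S' dg' (e - 1)" "entries_in I (z - v \<odot> M)" by (auto simp: G_def)
              have "entries_in I (scale_by (var x) (z - v \<odot> M))"
                using v(2) mult_left[OF subsetD[OF homs_subset var[OF 1(2)]]] by (auto simp: entries_in_def)
              then have "entries_in I (y - scale_by (var x) v \<odot> M)"
                by (simp add: 1 scale_by_diff comb_scale_by)
              then show ?thesis using hrow_scale_by[OF var[OF 1(2)] v(1)] by (auto simp: G_def)
            next
              case 2 then show ?thesis by (auto simp: G_def intro!: bexI[of _ 0])
            qed
          qed
          then have "Y e \<subseteq> G e" unfolding Y_def by (rule row_space.span_minimal[OF _ subsp])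
          ultimately have "row_space.span (Y e \<union> B e) \<subseteq> G e"
            by (intro row_space.span_minimal[OF _ subsp]) blast
          then show ?thesis using B(2)[of e] less.prems by blast
        qed
      qed
      then show ?thesis using that by (auto simp: G_def Zd_def)
    qed
    show "entries_in Tp v" if v: "supp v \<subseteq> S'" "entries_in T v" "entries_in I (v \<odot> M)" for v
    proof -
      have "const_coeff (entry v i) = 0" if i: "i \<in> S'" for i
      proof (rule ccontr)
        assume nz: "const_coeff (entry v i) \<noteq> 0"
        define d where "d = dg' i"
        define w where "w = row_comp dg' d v"
        have wh: "w \<in> hrow X S' dg' d" unfolding w_def by (rule row_comp_hrow[OF v(1,2)])
        have "w \<odot> M = row_comp dg d (v \<odot> M)"
          unfolding w_def using row_comp_comb[OF v(1,2) Mh] by simp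
        then have wI: "entries_in I (w \<odot> M)" using row_comp_entries_I[OF v(3)] by simp
        have wY: "w \<odot> M \<in> Y d"
          unfolding Y_def using hrow_comb0[OF wh Mh] wI by (intro row_space.span_base) (simp add: YG_def)
        define F where "F = {j \<in> supp w. dg' j = d}"
        define c where "c j = const_coeff (entry w j)" for j
        have wi: "c i \<noteq> 0" using nz by (simp add: c_def w_def d_def const_coeff_def entry_hcomp)
        then have iF: "i \<in> F" by (auto simp: F_def d_def c_def supp_iff)
        have F: "F \<subseteq> S'" "finite F" using hrowD(1)[OF wh] by (auto simp: F_def)
        have injF: "inj_on M F"
        proof (rule inj_onI)
          fix j j' assume "j \<in> F" "j' \<in> F" "M j = M j'"
          then show "j = j'" using inj[of j j'] F(1) by (auto simp: F_def)
        qed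
        have sc: "entry w j = sng [] (c j)" if "j \<in> F" for j
          using homs_0_scalar[of "entry w j" X] hrowD(2)[OF wh, of j] that by (simp add: F_def c_def)
        have rest: "scale_by (entry w j) (M j) \<in> Y d" if "j \<in> supp w - F" for j
        proof -
          have "j \<in> S'" using that hrowD(1)[OF wh] by blast
          moreover have "d - dg' j > 0"
            using that homs_negative[OF hrowD(2)[OF wh, of j]] by (force simp: F_def supp_iff)
          ultimately show ?thesis using Y_mult[OF hrowD(2)[OF wh] _ M_Zd, of j j] by simp
        qed
        define rst where "rst = (\<Sum>j\<in>supp w - F. scale_by (entry w j) (M j))"
        have "w \<odot> M = (\<Sum>j\<in>F. scale_by (entry w j) (M j)) + rst"
          unfolding comb_def rst_def by (subst add.commute, rule sum.subset_diff) (auto simp: F_def)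
        then have "(\<Sum>j\<in>F. scale_by (entry w j) (M j)) = w \<odot> M - rst" by simp
        moreover have "rst \<in> Y d"
          unfolding rst_def using rest by (rule row_space.subspace_sum[OF Y_subspace])
        ultimately have "(\<Sum>j\<in>F. scale_by (entry w j) (M j)) \<in> Y d"
          using row_space.subspace_diff[OF Y_subspace wY] by simp
        moreover have "(\<Sum>j\<in>F. scale_by (entry w j) (M j)) = (\<Sum>b\<in>M ` F. scalar_mult (c (the_inv_into F M b)) b)"
          by (subst sum.reindex[OF injF]) (simp add: sc the_inv_into_f_f[OF injF])
        moreover have "M ` F \<subseteq> B d" using M_B F(1) by (auto simp: F_def)
        ultimately have "\<forall>b\<in>M ` F. c (the_inv_into F M b) = 0"
          using B(4)[of "M ` F" d "\<lambda>b. c (the_inv_into F M b)"] F(2) by auto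
        then have "c i = 0" using iF by (simp add: the_inv_into_f_f[OF injF])
        with wi show False by simp
      qed
      moreover have "entry v i = 0" if "i \<notin> S'" for i using that v(1) by (auto simp: supp_iff)
      ultimately show ?thesis
        using v(2) by (auto simp: entries_in_def tensor_plus_def) (metis const_coeff_simps(1))
    qed
  qed
qed

text \<open>
  Iterate the choice of minimal generators: the relations between the generators of one stage
  form the submodule that is to be generated in the next. The basis in degree \<open>0\<close> is prescribed
  and the augmentation is the identity there; this is possible because \<open>Z\<close> has entries in
  \<open>T(V)\<^sub>+\<close>.
\<close>

lemma minimal_resolution_exists:
  fixes U :: "nat set" and Z :: "(nat \<Rightarrow>\<^sub>0 ('x, 'k) tensor) set"
  assumes X: "finite X" and U: "locally_finite U dg" and Z: "submodule U Z"
    and Zp: "\<And>z. z \<in> Z \<Longrightarrow> entries_in Tp z"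
  obtains C :: "(nat, 'x, 'k) gcomplex" where
    "cbas C 0 = U" "cdeg C 0 = dg" "\<And>n. locally_finite (cbas C n) (cdeg C n)"
    "free_complex X I C" "minimal_complex X C" "acyclic_over X I C (\<lambda>u. u \<in> Z)"
    "\<And>i. i \<in> cbas C 1 \<Longrightarrow> cdiff C 0 i \<in> Z"
proof -
  define good where "good s \<longleftrightarrow> (case s of (S, dg, Z) \<Rightarrow>
      locally_finite S dg \<and> submodule S Z \<and> (\<forall>z\<in>Z. entries_in Tp z))"
    for s :: "nat set \<times> (nat \<Rightarrow> int) \<times> (nat \<Rightarrow>\<^sub>0 ('x, 'k) tensor) set"
  define covers where "covers s s' M \<longleftrightarrow> (case (s, s') of ((S, dg, Z), (S', dg', Z')) \<Rightarrow>
      (\<forall>i\<in>S'. M i \<in> hrow X S dg (dg' i) \<inter> Z) \<and>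
      (\<forall>e. \<forall>z\<in>hrow X S dg e \<inter> Z. \<exists>v\<in>hrow X S' dg' e. entries_in I (z - v \<odot> M)) \<and>
      Z' = {v. supp v \<subseteq> S' \<and> entries_in T v \<and> entries_in I (v \<odot> M)})"
    for s s' :: "nat set \<times> (nat \<Rightarrow> int) \<times> (nat \<Rightarrow>\<^sub>0 ('x, 'k) tensor) set" and M
  have "\<exists>s. \<forall>n. (good (s n) \<and> (n = 0 \<longrightarrow> s n = (U, dg, Z))) \<and> (\<exists>M. covers (s n) (s (Suc n)) M)"
  proof (rule dependent_nat_choice)
    show "\<exists>s. good s \<and> (0 = (0::nat) \<longrightarrow> s = (U, dg, Z))"
      using U Z Zp by (auto simp: good_def)
  next
    fix s :: "nat set \<times> (nat \<Rightarrow> int) \<times> (nat \<Rightarrow>\<^sub>0 ('x, 'k) tensor) set" and n :: nat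
    assume g: "good s \<and> (n = 0 \<longrightarrow> s = (U, dg, Z))"
    obtain S dg1 Z1 where s: "s = (S, dg1, Z1)" by (cases s) auto
    with g have g': "locally_finite S dg1" "submodule S Z1" by (auto simp: good_def)
    obtain S' :: "nat set" and dg' M where m: "locally_finite S' dg'"
      "\<And>i. i \<in> S' \<Longrightarrow> M i \<in> hrow X S dg1 (dg' i) \<inter> Z1"
      "\<And>e z. z \<in> hrow X S dg1 e \<inter> Z1 \<Longrightarrow> \<exists>v\<in>hrow X S' dg' e. entries_in I (z - v \<odot> M)"
      "\<And>v. supp v \<subseteq> S' \<Longrightarrow> entries_in T v \<Longrightarrow> entries_in I (v \<odot> M) \<Longrightarrow> entries_in Tp v"
      using minimal_generators[OF X g'] by metis
    define Z' where "Z' = {v. supp v \<subseteq> S' \<and> entries_in T v \<and> entries_in I (v \<odot> M)}"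
    have MT: "entries_in T (M i)" if "i \<in> S'" for i using m(2)[OF that] hrowD(3) by blast
    have "submodule S' Z'"
      unfolding submodule_def
    proof (intro conjI ballI subsetI)
      show "add_subgroup Z'"
        by (auto simp: add_subgroup_def Z'_def comb_diff entries_I entries_T supp_diff
            dest!: subsetD[OF keys_diff])
      show "scale_by a u \<in> Z'" if "a \<in> T" "u \<in> Z'" for a u
        using that supp_scale_by[of a u] mult_left[OF that(1)] mult_tensor_algebra[OF that(1)]
        by (auto simp: Z'_def comb_scale_by entries_in_def)
      show "u \<in> Z'" if "u \<in> {u. supp u \<subseteq> S' \<and> entries_in I u}" for u
        using that MT by (auto simp: Z'_def entries_I_T intro!: comb_I_left)
    qed (auto simp: Z'_def)
    then have "good (S', dg', Z')" using m(1,4) by (auto simp: good_def Z'_def)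
    moreover have "covers s (S', dg', Z') M" using m(2,3) by (auto simp: covers_def s Z'_def)
    ultimately show "\<exists>s'. (good s' \<and> (Suc n = 0 \<longrightarrow> s' = (U, dg, Z))) \<and> (\<exists>M. covers s s' M)" by blast
  qed
  then obtain s where s: "\<And>n. good (s n)" "s 0 = (U, dg, Z)" and "\<And>n. \<exists>M. covers (s n) (s (Suc n)) M"
    by blast
  then obtain M where M: "\<And>n. covers (s n) (s (Suc n)) (M n)" by metis
  define C where "C = \<lparr>cbas = (\<lambda>n. fst (s n)), cdeg = (\<lambda>n. fst (snd (s n))), cdiff = M\<rparr>"
  define Zn where "Zn n = snd (snd (s n))" for n
  have C: "s n = (cbas C n, cdeg C n, Zn n)" for n by (simp add: C_def Zn_def)
  have M_eq: "M = cdiff C" by (simp add: C_def)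
  have cov: "\<And>i. i \<in> cbas C (Suc n) \<Longrightarrow> cdiff C n i \<in> chains X C n (cdeg C (Suc n) i) \<inter> Zn n"
      "\<And>z e. z \<in> chains X C n e \<inter> Zn n \<Longrightarrow> \<exists>v\<in>chains X C (Suc n) e. entries_in I (z - v \<odot> cdiff C n)"
      "Zn (Suc n) = {v. supp v \<subseteq> cbas C (Suc n) \<and> entries_in T v \<and> entries_in I (v \<odot> cdiff C n)}" for n
    using M[of n] unfolding C M_eq covers_def by auto
  have gd: "locally_finite (cbas C n) (cdeg C n)" "z \<in> Zn n \<Longrightarrow> entries_in Tp z" for n z
    using s(1)[of n] unfolding C good_def by auto
  have Z0: "Zn 0 = Z" "cbas C 0 = U" "cdeg C 0 = dg" using s(2) C[of 0] by auto
  show thesis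
  proof (rule that[OF Z0(2,3) gd(1)])
    show "free_complex X I C"
      unfolding free_complex_def using cov(1) cov(3) by (metis (no_types, lifting) Int_iff mem_Collect_eq)
    show "minimal_complex X C" unfolding minimal_complex_def using cov(1) gd(2) by blast
    show "acyclic_over X I C (\<lambda>u. u \<in> Z)"
      unfolding acyclic_over_def
    proof (intro conjI allI ballI impI)
      show "\<exists>v\<in>chains X C 1 e. entries_in I (u - v \<odot> cdiff C 0)" if "u \<in> chains X C 0 e" "u \<in> Z" for u e
        using cov(2)[of u 0 e] that Z0(1) by simp
      show "\<exists>v\<in>chains X C (Suc (Suc n)) e. entries_in I (u - v \<odot> cdiff C (Suc n))"
        if "u \<in> chains X C (Suc n) e" "entries_in I (u \<odot> cdiff C n)" for u n e
        using cov(2)[of u "Suc n" e] that cov(3)[of n] hrowD(1,3)[OF that(1)] by simp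
    qed
    show "cdiff C 0 i \<in> Z" if "i \<in> cbas C 1" for i using cov(1)[of i 0] that Z0(1) by simp
  qed
qed

end

section \<open>Augmentations of cyclic modules\<close>

context graded_ideal
begin

text \<open>
  As the augmentation is onto, some basis element \<open>b\<close> is sent to an element with nonzero
  constant term; by homogeneity its degree is \<open>0\<close> and its value a constant. From any other basis
  element one could subtract a multiple of \<open>b\<close> to obtain an element of the kernel that is not in
  \<open>T(V)\<^sub>+ Q\<^sup>0\<close>, contrary to minimality.
\<close>

lemma cyclic_module_augmentation:
  assumes Q: "minimal_resolution X I (cyclic_module N) Q"
    and N: "N \<subseteq> Tp" "0 \<in> N"
  obtains b \<kappa> where "\<kappa> \<noteq> 0" "bas Q 0 = {b}" "bdeg Q 0 b = 0" "mat Q 0 b = sng 0 (sng [] \<kappa>)"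
proof -
  have mat: "mat Q 0 i \<in> hrow X {0} (\<lambda>_. 0) (bdeg Q 0 i)" if "i \<in> bas Q 0" for i
    using Q that by (auto simp: minimal_resolution_def graded_free_resolution_def cyclic_module_def hrow_iff)
  have mat0: "mat Q 0 i = sng 0 (entry (mat Q 0 i) 0)" if "i \<in> bas Q 0" for i
  proof (rule poly_mapping_eqI)
    fix k show "entry (mat Q 0 i) k = entry (sng 0 (entry (mat Q 0 i) 0)) k"
      using hrowD(1)[OF mat[OF that]] by (cases "k = 0") (auto simp: lookup_single supp_iff)
  qed
  have "unit_row 0 \<in> rows T {0::nat}"
    by (auto simp: rows_iff entries_in_def lookup_one when_def)
  then obtain u where u: "u \<in> rows T (bas Q 0)" "unit_row 0 - u \<odot> mat Q 0 \<in> rows N {0}"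
    using Q by (auto simp: minimal_resolution_def graded_free_resolution_def cyclic_module_def row_mult_eq)
  have "const_coeff (entry (unit_row 0 - u \<odot> mat Q 0) 0) = 0"
    using u(2) N by (auto simp: rows_iff entries_in_def tensor_plus_def)
  then have "(\<Sum>i\<in>supp u. const_coeff (entry u i) * const_coeff (entry (mat Q 0 i) 0)) = 1"
    by (simp add: lookup_minus entry_comb const_coeff_sum)
  then obtain b where b: "b \<in> supp u" "const_coeff (entry (mat Q 0 b) 0) \<noteq> 0"
    by (metis (no_types, lifting) mult_zero_right sum.neutral zero_neq_one)
  then have bQ: "b \<in> bas Q 0" using u(1) by (auto simp: rows_def)
  define \<kappa> where "\<kappa> = const_coeff (entry (mat Q 0 b) 0)"
  have deg: "bdeg Q 0 b = 0"
    using const_coeff_homs[OF hrowD(2)[OF mat[OF bQ]], of 0] b(2) by auto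
  then have b\<kappa>: "mat Q 0 b = sng 0 (sng [] \<kappa>)"
    using homs_0_scalar[of "entry (mat Q 0 b) 0" X] hrowD(2)[OF mat[OF bQ], of 0] mat0[OF bQ]
    by (simp add: \<kappa>_def)
  have \<kappa>: "\<kappa> \<noteq> 0" using b(2) by (simp add: \<kappa>_def)
  have "i = b" if i: "i \<in> bas Q 0" for i
  proof (rule ccontr)
    assume ne: "i \<noteq> b"
    define u where "u = unit_row i - sng b (entry (mat Q 0 i) 0 * sng [] (inverse \<kappa>))"
    have "entry (mat Q 0 i) 0 * sng [] (inverse \<kappa>) \<in> homs X (bdeg Q 0 i + 0)"
      using hrowD(2)[OF mat[OF i], of 0] by (intro mult_homs) auto
    then have uh: "u \<in> chains X (complex_of Q) 0 (bdeg Q 0 i)"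
      unfolding u_def using i bQ deg by (intro hrow_simps hrow_single) auto
    have inv: "sng [] (inverse \<kappa>) * sng [] \<kappa> = (1 :: ('x, 'k) tensor)"
      using \<kappa> by (simp add: mult_single plus_list_def one_tensor)
    have "u \<odot> mat Q 0 = mat Q 0 i - sng 0 (entry (mat Q 0 i) 0)"
      by (simp add: u_def comb_diff b\<kappa> mult.assoc inv)
    then have "u \<odot> mat Q 0 = 0" using mat0[OF i] by simp
    then have "u \<odot> mat Q 0 \<in> rels (cyclic_module N)"
      using N(2) by (auto simp: cyclic_module_def rows_iff entries_in_def)
    then obtain v where v: "v \<in> chains X (complex_of Q) 1 (bdeg Q 0 i)"
        "entries_in I (u - v \<odot> mat Q 1)"
      using acyclic_overD(1)[OF resolution_acyclic[OF Q] uh] by auto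
    have "entries_in Tp (v \<odot> mat Q 1)"
      using hrowD(1,3)[OF v(1)] resolution_minimal[OF Q]
      by (intro comb_P_right) (auto simp: minimal_complex_def)
    then have "entries_in Tp u" using entries_P(4)[OF entries_I_P[OF v(2)]] by fastforce
    then have "const_coeff (entry u i) = 0" by (auto simp: entries_in_def tensor_plus_def)
    then show False using ne by (simp add: u_def lookup_minus lookup_single)
  qed
  with bQ have "bas Q 0 = {b}" by blast
  from that[OF \<kappa> this deg b\<kappa>] show thesis .
qed

end

section \<open>The cone of a resolution of a syzygy\<close>

text \<open>
  The basis elements of a cone are of two kinds: \<open>Inl (j, u)\<close> is the basis element \<open>j\<close> of a
  complex \<open>Q\<close> in its copy with index \<open>u\<close>, and \<open>Inr k\<close> is a basis element of a complex \<open>R\<close>. Here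
  \<open>inl u\<close> and \<open>prl u\<close> are the inclusion of and the projection to one copy, \<open>prq\<close> is the
  projection to all copies, and \<open>inr\<close> and \<open>prr\<close> belong to the other summand. As matrices, they
  act by \<open>\<odot>\<close> from the right.
\<close>

definition inl :: "'u \<Rightarrow> 'j \<Rightarrow> (('j \<times> 'u) + 'r \<Rightarrow>\<^sub>0 'a::ring_1)" where
  "inl u j = unit_row (Inl (j, u))"

definition inr :: "'r \<Rightarrow> (('j \<times> 'u) + 'r \<Rightarrow>\<^sub>0 'a::ring_1)" where
  "inr k = unit_row (Inr k)"

definition prl :: "'u \<Rightarrow> ('j \<times> 'u) + 'r \<Rightarrow> ('j \<Rightarrow>\<^sub>0 'a::ring_1)" where
  "prl u x = (case x of Inl (j, u') \<Rightarrow> if u' = u then unit_row j else 0 | Inr k \<Rightarrow> 0)"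

definition prq :: "('j \<times> 'u) + 'r \<Rightarrow> (('j \<times> 'u) + 'r \<Rightarrow>\<^sub>0 'a::ring_1)" where
  "prq x = (case x of Inl y \<Rightarrow> unit_row (Inl y) | Inr k \<Rightarrow> 0)"

definition prr :: "('j \<times> 'u) + 'r \<Rightarrow> ('r \<Rightarrow>\<^sub>0 'a::ring_1)" where
  "prr x = (case x of Inl y \<Rightarrow> 0 | Inr k \<Rightarrow> unit_row k)"

lemma pr_in [simp]:
  "prl u (Inl (j, u')) = (if u' = u then unit_row j else 0)" "prl u (Inr k) = 0"
  "prq (Inl y) = unit_row (Inl y)" "prq (Inr k) = 0"
  "prr (Inl y) = 0" "prr (Inr k) = unit_row k"
  by (simp_all add: prl_def prq_def prr_def)

lemma split_sum_row: "w = w \<odot> prq + w \<odot> prr \<odot> inr"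
proof -
  have "w \<odot> prq + w \<odot> prr \<odot> inr = w \<odot> (\<lambda>x. prq x + prr x \<odot> inr)"
    by (simp add: comb_add_right comb_assoc)
  also have "\<dots> = w \<odot> unit_row"
    by (rule comb_cong) (simp add: prq_def prr_def inr_def split: sum.split)
  finally show ?thesis by simp
qed

text \<open>
  The tensor product of \<open>Q\<close> with the graded vector space that has basis \<open>U\<close>. It has the index type of
  a cone so that it becomes a subcomplex of one.
\<close>

definition copies :: "('j, 'x, 'k::field) gcomplex \<Rightarrow> 'u set \<Rightarrow> ('u \<Rightarrow> int) \<Rightarrow> (('j \<times> 'u) + 'r, 'x, 'k) gcomplex" where
  "copies Q U dg = \<lparr>cbas = (\<lambda>n. Inl ` (cbas Q n \<times> U)),
     cdeg = (\<lambda>n x. case x of Inl (j, u) \<Rightarrow> cdeg Q n j + dg u | Inr k \<Rightarrow> 0),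
     cdiff = (\<lambda>n x. case x of Inl (j, u) \<Rightarrow> cdiff Q n j \<odot> inl u | Inr k \<Rightarrow> 0)\<rparr>"

lemma copies_simps [simp]:
  "cbas (copies Q U dg) n = Inl ` (cbas Q n \<times> U)"
  "cdeg (copies Q U dg) n (Inl (j, u)) = cdeg Q n j + dg u"
  "cdiff (copies Q U dg) n (Inl (j, u)) = cdiff Q n j \<odot> inl u"
  by (simp_all add: copies_def)

text \<open>
  The differential of \<open>R\<close> keeps its sign; for the square of the differential to vanish, \<open>\<sigma>\<close> has
  to anticommute with the differentials. It will be a chain map from \<open>neg_complex R\<close>.
\<close>

definition cone ::
    "('j, 'x, 'k::field) gcomplex \<Rightarrow> 'u set \<Rightarrow> ('u \<Rightarrow> int) \<Rightarrow> ('r, 'x, 'k) gcomplex \<Rightarrow>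
     (nat \<Rightarrow> 'r \<Rightarrow> ('j \<times> 'u) + 'r \<Rightarrow>\<^sub>0 ('x, 'k) tensor) \<Rightarrow> (('j \<times> 'u) + 'r, 'x, 'k) gcomplex" where
  "cone Q U dg R \<sigma> = \<lparr>
     cbas = (\<lambda>n. Inl ` (cbas Q n \<times> U) \<union> (case n of 0 \<Rightarrow> {} | Suc m \<Rightarrow> Inr ` cbas R m)),
     cdeg = (\<lambda>n x. case x of Inl (j, u) \<Rightarrow> cdeg Q n j + dg u | Inr k \<Rightarrow> cdeg R (n - 1) k),
     cdiff = (\<lambda>n x. case x of Inl (j, u) \<Rightarrow> cdiff Q n j \<odot> inl u
        | Inr k \<Rightarrow> \<sigma> n k + (case n of 0 \<Rightarrow> 0 | Suc m \<Rightarrow> cdiff R m k \<odot> inr))\<rparr>"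

lemma cone_simps [simp]:
  "cbas (cone Q U dg R \<sigma>) 0 = Inl ` (cbas Q 0 \<times> U)"
  "cbas (cone Q U dg R \<sigma>) (Suc n) = Inl ` (cbas Q (Suc n) \<times> U) \<union> Inr ` cbas R n"
  "cdeg (cone Q U dg R \<sigma>) n (Inl (j, u)) = cdeg Q n j + dg u"
  "cdeg (cone Q U dg R \<sigma>) (Suc n) (Inr k) = cdeg R n k"
  "cdiff (cone Q U dg R \<sigma>) n (Inl (j, u)) = cdiff Q n j \<odot> inl u"
  "cdiff (cone Q U dg R \<sigma>) 0 (Inr k) = \<sigma> 0 k"
  "cdiff (cone Q U dg R \<sigma>) (Suc n) (Inr k) = \<sigma> (Suc n) k + cdiff R n k \<odot> inr"
  by (simp_all add: cone_def)

definition neg_complex :: "('r, 'x, 'k::field) gcomplex \<Rightarrow> ('r, 'x, 'k) gcomplex" where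
  "neg_complex R = R\<lparr>cdiff := (\<lambda>n k. - cdiff R n k)\<rparr>"

lemma neg_complex_simps [simp]:
  "cbas (neg_complex R) = cbas R" "cdeg (neg_complex R) = cdeg R" "cdiff (neg_complex R) n = (\<lambda>k. - cdiff R n k)"
  by (simp_all add: neg_complex_def)

lemma inl_hrow: "j \<in> cbas Q n \<Longrightarrow> u \<in> U \<Longrightarrow> inl u j \<in> chains X (copies Q U dg) n (cdeg Q n j + dg u)"
  by (auto simp: inl_def intro!: hrow_single)

lemma hrow_inl:
  assumes "v \<in> chains X Q n e" "u \<in> U"
  shows "v \<odot> inl u \<in> chains X (copies Q U dg) n (e + dg u)"
  using hrow_comb[OF assms(1), of "inl u" _ _ "- dg u"] inl_hrow assms(2) by fastforce

lemma prl_hrow: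
  assumes "w \<in> chains X (copies Q U dg) n e"
  shows "w \<odot> prl u \<in> chains X Q n (e - dg u)"
  by (rule hrow_comb[OF assms]) auto

lemma inl_prl: "v \<odot> inl u \<odot> prl u' = (if u = u' then v else 0)"
  by (simp add: comb_assoc inl_def)

lemma entries_in_comb_01:
  assumes "add_subgroup C" "entries_in C w" "\<And>i. entries_in {0, 1} (M i)"
  shows "entries_in C (w \<odot> M)"
  by (rule entries_in_comb[OF assms]) (auto simp: add_subgroupD(1)[OF assms(1)])

lemma
  assumes "add_subgroup C"
  shows inl_entries: "entries_in C v \<Longrightarrow> entries_in C (v \<odot> inl u)"
    and prl_entries: "entries_in C w \<Longrightarrow> entries_in C (w \<odot> prl u)"
    and pr_entries: "entries_in C w \<Longrightarrow> entries_in C (w \<odot> prq)"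
      "entries_in C w \<Longrightarrow> entries_in C (w \<odot> prr)"
      "entries_in C b \<Longrightarrow> entries_in C (b \<odot> inr)"
  by (erule entries_in_comb_01[OF assms];
      simp add: entries_in_def inl_def prl_def prq_def prr_def inr_def lookup_single when_def split: sum.split)+

lemma copies_diff: "v \<odot> inl u \<odot> cdiff (copies Q U dg) n = v \<odot> cdiff Q n \<odot> inl u"
  by (simp add: comb_assoc inl_def)

lemma diff_prl:
  assumes "supp w \<subseteq> Inl ` A"
  shows "w \<odot> cdiff (copies Q U dg) n \<odot> prl u = w \<odot> prl u \<odot> cdiff Q n"
  unfolding comb_assoc
proof (rule comb_cong)
  fix x assume "x \<in> supp w"
  then obtain j u' where "x = Inl (j, u')" using assms by fastforce
  then show "cdiff (copies Q U dg) n x \<odot> prl u = prl u x \<odot> cdiff Q n"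
    by (simp add: inl_prl)
qed

context graded_ideal
begin

lemma copies_free_complex:
  "free_complex X I Q \<Longrightarrow> free_complex X I (copies Q U dg :: (('j \<times> 'u) + 'r, 'x, 'k) gcomplex)"
  unfolding free_complex_def
proof (intro conjI allI ballI)
  fix n and x :: "('j \<times> 'u) + 'r"
  assume Q: "(\<forall>n. \<forall>i\<in>cbas Q (Suc n). cdiff Q n i \<in> chains X Q n (cdeg Q (Suc n) i)) \<and>
    (\<forall>n. \<forall>i\<in>cbas Q (Suc (Suc n)). entries_in I (cdiff Q (Suc n) i \<odot> cdiff Q n))"
  show "cdiff (copies Q U dg) n x \<in> chains X (copies Q U dg) n (cdeg (copies Q U dg) (Suc n) x)"
    if "x \<in> cbas (copies Q U dg) (Suc n)"
  proof -
    obtain j u where ju: "x = Inl (j, u)" "j \<in> cbas Q (Suc n)" "u \<in> U"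
      using \<open>x \<in> cbas (copies Q U dg) (Suc n)\<close> by auto
    with Q have "cdiff Q n j \<in> chains X Q n (cdeg Q (Suc n) j)" by blast
    from hrow_inl[OF this ju(3), of dg] show ?thesis by (simp add: ju(1))
  qed
  show "entries_in I (cdiff (copies Q U dg) (Suc n) x \<odot> cdiff (copies Q U dg) n)"
    if "x \<in> cbas (copies Q U dg) (Suc (Suc n))"
    using that Q by (auto simp: copies_diff intro!: inl_entries add_subgroup_I)
qed

text \<open>
  A row meets only finitely many copies, and preimages are chosen in each of them separately.
\<close>

lemma copies_acyclic_at:
  fixes w :: "('j \<times> 'u) + 'r \<Rightarrow>\<^sub>0 ('x, 'k) tensor"
  assumes w: "w \<in> chains X (copies Q U dg) n e"
    and ex: "\<And>u. u \<in> U \<Longrightarrow> \<exists>v\<in>chains X Q (Suc n) (e - dg u). entries_in I (w \<odot> prl u - v \<odot> cdiff Q n)"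
  shows "\<exists>v\<in>chains X (copies Q U dg) (Suc n) e. entries_in I (w - v \<odot> cdiff (copies Q U dg) n)"
proof -
  define F where "F = (\<lambda>x. case x of Inl (j, u) \<Rightarrow> u | Inr k \<Rightarrow> undefined) ` supp w"
  have supp: "supp w \<subseteq> Inl ` (cbas Q n \<times> U)" using hrowD(1)[OF w] by simp
  have F: "finite F" "F \<subseteq> U" using supp by (auto simp: F_def)
  obtain v where v: "\<And>u. u \<in> U \<Longrightarrow> v u \<in> chains X Q (Suc n) (e - dg u)"
      "\<And>u. u \<in> U \<Longrightarrow> entries_in I (w \<odot> prl u - v u \<odot> cdiff Q n)"
    using ex by metis
  have "w = w \<odot> (\<lambda>x. \<Sum>u\<in>F. prl u x \<odot> inl u)"
  proof -
    have "(\<Sum>u\<in>F. prl u x \<odot> inl u) = unit_row x" if x: "x \<in> supp w" for x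
    proof -
      obtain j u' where ju: "x = Inl (j, u')" using supp x by fastforce
      with x have "u' \<in> F" by (force simp: F_def)
      moreover have "(\<Sum>u\<in>F. prl u x \<odot> inl u) = (\<Sum>u\<in>F. if u' = u then unit_row x else 0)"
        by (intro sum.cong) (auto simp: ju inl_def)
      ultimately show ?thesis using F(1) by simp
    qed
    then have "w \<odot> (\<lambda>x. \<Sum>u\<in>F. prl u x \<odot> inl u) = w \<odot> unit_row" by (rule comb_cong)
    then show ?thesis by simp
  qed
  then have w_eq: "w = (\<Sum>u\<in>F. w \<odot> prl u \<odot> inl u)"
    by (simp add: comb_sum_right comb_assoc)
  define V :: "('j \<times> 'u) + 'r \<Rightarrow>\<^sub>0 ('x, 'k) tensor" where "V = (\<Sum>u\<in>F. v u \<odot> inl u)"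
  have "v u \<odot> inl u \<in> chains X (copies Q U dg :: (('j \<times> 'u) + 'r, 'x, 'k) gcomplex) (Suc n) e" if "u \<in> F" for u
    using hrow_inl[OF v(1), of u u U dg] F(2) that by auto
  then have "V \<in> chains X (copies Q U dg) (Suc n) e" unfolding V_def by (rule hrow_sum)
  moreover have "w - V \<odot> cdiff (copies Q U dg) n = (\<Sum>u\<in>F. (w \<odot> prl u - v u \<odot> cdiff Q n) \<odot> inl u)"
    by (subst w_eq) (simp add: V_def comb_sum copies_diff comb_diff sum_subtractf)
  moreover have "entries_in I (\<Sum>u\<in>F. (w \<odot> prl u - v u \<odot> cdiff Q n) \<odot> inl u)"
    using F(2) v(2) by (intro entries_in_sum inl_entries add_subgroup_I) auto
  ultimately show ?thesis by (intro bexI[of _ V]) simp_all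
qed

lemma copies_acyclic:
  fixes Q :: "('j, 'x, 'k) gcomplex"
  assumes Q: "acyclic_over X I Q (entries_in J)" and J: "add_subgroup J"
  shows "acyclic_over X I (copies Q U dg :: (('j \<times> 'u) + 'r, 'x, 'k) gcomplex) (entries_in J)"
  unfolding acyclic_over_def
proof (intro conjI allI ballI impI)
  fix e and w :: "('j \<times> 'u) + 'r \<Rightarrow>\<^sub>0 ('x, 'k) tensor"
  assume w: "w \<in> chains X (copies Q U dg) 0 e" "entries_in J w"
  have "\<exists>v\<in>chains X (copies Q U dg) (Suc 0) e. entries_in I (w - v \<odot> cdiff (copies Q U dg) 0)"
    using Q prl_hrow[OF w(1)] prl_entries[OF J w(2)]
    by (intro copies_acyclic_at[OF w(1)]) (simp add: acyclic_over_def)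
  then show "\<exists>v\<in>chains X (copies Q U dg) 1 e. entries_in I (w - v \<odot> cdiff (copies Q U dg) 0)" by simp
next
  fix n e and w :: "('j \<times> 'u) + 'r \<Rightarrow>\<^sub>0 ('x, 'k) tensor"
  assume w: "w \<in> chains X (copies Q U dg) (Suc n) e" "entries_in I (w \<odot> cdiff (copies Q U dg) n)"
  have "entries_in I (w \<odot> prl u \<odot> cdiff Q n)" for u
    using prl_entries[OF add_subgroup_I w(2), of u] hrowD(1)[OF w(1)] by (simp add: diff_prl)
  then show "\<exists>v\<in>chains X (copies Q U dg) (Suc (Suc n)) e. entries_in I (w - v \<odot> cdiff (copies Q U dg) (Suc n))"
    using Q prl_hrow[OF w(1)]
    by (intro copies_acyclic_at[OF w(1)]) (simp add: acyclic_over_def)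
qed

lemma cone_chains:
  assumes "w \<in> chains X (cone Q U dg R \<sigma>) (Suc n) e"
  shows "w \<odot> prq \<in> chains X (copies Q U dg) (Suc n) e" "w \<odot> prr \<in> chains X R n e"
proof -
  show "w \<odot> prq \<in> chains X (copies Q U dg) (Suc n) e" by (rule hrow_comb0[OF assms]) auto
  show "w \<odot> prr \<in> chains X R n e" by (rule hrow_comb0[OF assms]) auto
qed

lemma copies_subset_cone:
  fixes Q :: "('a, 'x, 'k) gcomplex" and R :: "('c, 'x, 'k) gcomplex" and U :: "'b set"
  shows "chains X (copies Q U dg) n e \<subseteq> chains X (cone Q U dg R \<sigma>) n e"
proof
  fix w :: "('a \<times> 'b) + 'c \<Rightarrow>\<^sub>0 ('x, 'k) tensor"
  assume w: "w \<in> chains X (copies Q U dg) n e"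
  have sub: "cbas (copies Q U dg) n \<subseteq> cbas (cone Q U dg R \<sigma>) n" by (cases n) auto
  have eq: "cdeg (cone Q U dg R \<sigma>) n x = cdeg (copies Q U dg) n x" if "x \<in> cbas (copies Q U dg) n" for x
    using that by auto
  have "entry w x \<in> homs X (e - cdeg (cone Q U dg R \<sigma>) n x)" for x
  proof (cases "x \<in> cbas (copies Q U dg) n")
    case True then show ?thesis using hrowD(2)[OF w, of x] by (simp only: eq)
  next
    case False
    then have "x \<notin> supp w" using hrowD(1)[OF w] by blast
    then show ?thesis by (simp add: supp_iff)
  qed
  then show "w \<in> chains X (cone Q U dg R \<sigma>) n e" using hrowD(1)[OF w] sub by (auto simp: hrow_def)
qed

lemma inr_cone_chains: "v \<in> chains X R n e \<Longrightarrow> v \<odot> inr \<in> chains X (cone Q U dg R \<sigma>) (Suc n) e"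
  by (erule hrow_comb0) (auto simp: inr_def intro!: hrow_single)

lemma cone_diff_copies:
  assumes "supp w \<subseteq> Inl ` A"
  shows "w \<odot> cdiff (cone Q U dg R \<sigma>) n = w \<odot> cdiff (copies Q U dg) n"
proof (rule comb_cong)
  fix x assume "x \<in> supp w"
  then obtain j u where "x = Inl (j, u)" using assms by fastforce
  then show "cdiff (cone Q U dg R \<sigma>) n x = cdiff (copies Q U dg) n x" by simp
qed

lemma cone_diff_inr:
  "v \<odot> inr \<odot> cdiff (cone Q U dg R \<sigma>) 0 = v \<odot> \<sigma> 0"
  "v \<odot> inr \<odot> cdiff (cone Q U dg R \<sigma>) (Suc n) = v \<odot> \<sigma> (Suc n) + v \<odot> cdiff R n \<odot> inr"
  by (simp_all add: comb_assoc comb_add_right inr_def)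

lemma cone_free_complex:
  assumes Q: "free_complex X I Q" and R: "free_complex X I R"
    and \<sigma>: "chain_map X I (neg_complex R) (copies Q U dg) 0 \<sigma>"
  shows "free_complex X I (cone Q U dg R \<sigma>)"
  unfolding free_complex_def
proof (intro conjI allI ballI)
  let ?C = "cone Q U dg R \<sigma>" and ?QU = "copies Q U dg"
  have \<sigma>h: "\<sigma> n k \<in> chains X ?QU n (cdeg R n k)" if "k \<in> cbas R n" for n k
    using chain_mapD(1)[OF \<sigma>] that by simp
  have \<sigma>d: "entries_in I (\<sigma> (Suc n) k \<odot> cdiff ?QU n + cdiff R n k \<odot> \<sigma> n)" if "k \<in> cbas R (Suc n)" for n k
    using chain_mapD(2)[OF \<sigma>] that by (simp add: comb_uminus)
  note cR = free_complexD[OF R] and cQU = free_complexD[OF copies_free_complex[OF Q, of U dg]]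
  show "cdiff ?C n x \<in> chains X ?C n (cdeg ?C (Suc n) x)" if "x \<in> cbas ?C (Suc n)" for n x
  proof (cases x)
    case (Inl y)
    with that cQU(1)[of x n] subsetD[OF copies_subset_cone] show ?thesis by auto
  next
    case (Inr k)
    then have k: "k \<in> cbas R n" using that by auto
    then have "\<sigma> n k \<in> chains X ?C n (cdeg R n k)" using \<sigma>h subsetD[OF copies_subset_cone] by blast
    moreover have "cdiff R m k \<odot> inr \<in> chains X ?C (Suc m) (cdeg R (Suc m) k)" if "n = Suc m" for m
      using cR(1) k that by (intro inr_cone_chains) auto
    ultimately show ?thesis by (cases n) (auto simp: Inr intro: hrow_simps)
  qed
  show "entries_in I (cdiff ?C (Suc n) x \<odot> cdiff ?C n)" if x: "x \<in> cbas ?C (Suc (Suc n))" for n x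
  proof (cases x)
    case (Inl y)
    then have x': "x \<in> cbas ?QU (Suc (Suc n))" using x by auto
    have "cdiff ?C (Suc n) x = cdiff ?QU (Suc n) x" using x' by auto
    then show ?thesis using cQU(2,3)[OF x'] by (simp add: cone_diff_copies)
  next
    case (Inr k)
    then have k: "k \<in> cbas R (Suc n)" using x by auto
    have "\<sigma> (Suc n) k \<odot> cdiff ?C n = \<sigma> (Suc n) k \<odot> cdiff ?QU n"
      using hrowD(1)[OF \<sigma>h[OF k]] by (simp add: cone_diff_copies)
    then have "cdiff ?C (Suc n) x \<odot> cdiff ?C n =
        \<sigma> (Suc n) k \<odot> cdiff ?QU n + cdiff R n k \<odot> \<sigma> n +
        (case n of 0 \<Rightarrow> 0 | Suc m \<Rightarrow> cdiff R n k \<odot> cdiff R m \<odot> inr)"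
      by (cases n) (simp_all add: Inr comb_add cone_diff_inr)
    moreover have "entries_in I (case n of 0 \<Rightarrow> 0 | Suc m \<Rightarrow> cdiff R n k \<odot> cdiff R m \<odot> inr)"
      using cR(2) k by (cases n) (auto intro!: pr_entries add_subgroup_I entries_I(1))
    ultimately show ?thesis using entries_I(4)[OF \<sigma>d[OF k]] by simp
  qed
qed

text \<open>
  The hypotheses on \<open>\<sigma>\<close> express that \<open>R\<close> resolves the kernel of a map from the module resolved
  by the copies of \<open>Q\<close>: \<open>cover\<close> that the kernel is reached, \<open>inj\<close> that nothing else is divided
  out. In a cycle \<open>a + b\<close>, with \<open>a\<close> from the copies and \<open>b\<close> from \<open>R\<close>, the part \<open>b\<close> is a cycle of
  \<open>R\<close>, hence a boundary; once a preimage of it has been subtracted, acyclicity of the copies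
  applies to the rest.
\<close>

lemma cone_acyclic:
  assumes Q: "free_complex X I Q" "acyclic_over X I Q (entries_in J)"
    and QJ: "\<And>i. i \<in> cbas Q 1 \<Longrightarrow> entries_in J (cdiff Q 0 i)"
    and R: "free_complex X I R" "acyclic_over X I R ZR"
    and \<sigma>: "chain_map X I (neg_complex R) (copies Q U dg) 0 \<sigma>"
    and J: "two_sided_ideal X J" "I \<subseteq> J"
    and cover: "\<And>w e. w \<in> chains X (copies Q U dg) 0 e \<Longrightarrow> Z w \<Longrightarrow>
        \<exists>b\<in>chains X R 0 e. entries_in J (w - b \<odot> \<sigma> 0)"
    and inj: "\<And>b e. b \<in> chains X R 0 e \<Longrightarrow> entries_in J (b \<odot> \<sigma> 0) \<Longrightarrow> ZR b"
  shows "acyclic_over X I (cone Q U dg R \<sigma>) Z"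
  unfolding acyclic_over_def
proof (intro conjI allI ballI impI)
  let ?C = "cone Q U dg R \<sigma>" and ?QU = "copies Q U dg"
  note J_closed = two_sided_ideal_closed[OF J(1)]
  have \<sigma>h: "\<sigma> n k \<in> chains X ?QU n (cdeg R n k)" if "k \<in> cbas R n" for n k
    using chain_mapD(1)[OF \<sigma>] that by simp
  have \<sigma>d: "entries_in I (\<sigma> (Suc n) k \<odot> cdiff ?QU n + cdiff R n k \<odot> \<sigma> n)" if "k \<in> cbas R (Suc n)" for n k
    using chain_mapD(2)[OF \<sigma>] that by (simp add: comb_uminus)
  have QU: "acyclic_over X I ?QU (entries_in J)" by (rule copies_acyclic[OF Q(2) J_closed(3)])
  show "\<exists>v\<in>chains X ?C 1 e. entries_in I (w - v \<odot> cdiff ?C 0)" if w: "w \<in> chains X ?C 0 e" "Z w" for w e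
  proof -
    have w': "w \<in> chains X ?QU 0 e"
      using hrow_comb0[OF w(1), of unit_row "cbas ?QU 0" "cdeg ?QU 0"] by fastforce
    then obtain b where b: "b \<in> chains X R 0 e" "entries_in J (w - b \<odot> \<sigma> 0)" using cover w(2) by blast
    have "w - b \<odot> \<sigma> 0 \<in> chains X ?QU 0 e"
      using w' hrow_comb0[OF b(1) \<sigma>h] by (rule hrow_simps(2))
    then obtain a where a: "a \<in> chains X ?QU 1 e" "entries_in I (w - b \<odot> \<sigma> 0 - a \<odot> cdiff ?QU 0)"
      using acyclic_overD(1)[OF QU _ b(2)] by (metis One_nat_def)
    have "w - (a + b \<odot> inr) \<odot> cdiff ?C 0 = w - b \<odot> \<sigma> 0 - a \<odot> cdiff ?QU 0"
      using hrowD(1)[OF a(1)] by (simp add: comb_add cone_diff_copies cone_diff_inr)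
    moreover have "a + b \<odot> inr \<in> chains X ?C 1 e"
      using hrow_simps(3)[OF subsetD[OF copies_subset_cone a(1)] inr_cone_chains[OF b(1), folded One_nat_def]] .
    ultimately show ?thesis using a(2) by metis
  qed
  show "\<exists>v\<in>chains X ?C (Suc (Suc n)) e. entries_in I (w - v \<odot> cdiff ?C (Suc n))"
    if w: "w \<in> chains X ?C (Suc n) e" "entries_in I (w \<odot> cdiff ?C n)" for w n e
  proof -
    define a where "a = w \<odot> prq"
    define b where "b = w \<odot> prr"
    have a: "a \<in> chains X ?QU (Suc n) e" and b: "b \<in> chains X R n e"
      using cone_chains[OF w(1)] by (simp_all add: a_def b_def)
    have w_eq: "w = a + b \<odot> inr" unfolding a_def b_def by (rule split_sum_row)
    have b\<sigma>: "b \<odot> \<sigma> n \<in> chains X ?QU n e" by (rule hrow_comb0[OF b \<sigma>h])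
    have ad: "a \<odot> cdiff ?QU n \<in> chains X ?QU n e"
      by (rule chains_diff[OF copies_free_complex[OF Q(1)] a])
    have wd: "w \<odot> cdiff ?C n = a \<odot> cdiff ?QU n + b \<odot> \<sigma> n + (case n of 0 \<Rightarrow> 0 | Suc m \<Rightarrow> b \<odot> cdiff R m \<odot> inr)"
      using hrowD(1)[OF a] by (cases n) (simp_all add: w_eq comb_add cone_diff_copies cone_diff_inr)
    have prq_id: "x \<odot> prq = x" "x \<odot> prr = 0" if "x \<in> chains X ?QU n e" for x
    proof -
      have "x \<odot> prq = x \<odot> unit_row" "x \<odot> prr = x \<odot> (\<lambda>_. 0)"
        using hrowD(1)[OF that] by (intro comb_cong, force)+
      then show "x \<odot> prq = x" "x \<odot> prr = 0" by simp_all
    qed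
    have inr_pr: "x \<odot> inr \<odot> prq = 0" "x \<odot> inr \<odot> prr = x" for x
      by (simp_all add: comb_assoc inr_def)
    have first: "entries_in I (a \<odot> cdiff ?QU n + b \<odot> \<sigma> n)"
    proof -
      have "w \<odot> cdiff ?C n \<odot> prq = a \<odot> cdiff ?QU n + b \<odot> \<sigma> n"
        unfolding wd comb_add prq_id(1)[OF ad] prq_id(1)[OF b\<sigma>] by (simp add: inr_pr split: nat.split)
      then show ?thesis using pr_entries(1)[OF add_subgroup_I w(2)] by simp
    qed
    have "\<exists>b'\<in>chains X R (Suc n) e. entries_in I (b - b' \<odot> cdiff R n)"
    proof (cases n)
      \<comment> \<open>In the lowest degree, \<open>b\<close> lies in the kernel of the augmentation because \<open>b \<sigma>\<close> is,
        modulo \<open>I\<close>, a boundary in the copies of \<open>Q\<close>, and these vanish in the copies of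
        \<open>T(V)/J\<close>.\<close>
      case 0
      have "entries_in J (a \<odot> cdiff ?QU 0)"
      proof (rule entries_in_comb[OF J_closed(3) hrowD(3)[OF a], where D = J])
        fix x assume "x \<in> supp a"
        then obtain j u where "x = Inl (j, u)" "j \<in> cbas Q 1" using hrowD(1)[OF a] 0 by fastforce
        then show "entries_in J (cdiff ?QU 0 x)" using QJ by (simp add: inl_entries J_closed(3))
      qed (rule J_closed(1))
      then have "entries_in J (a \<odot> cdiff ?QU 0 + b \<odot> \<sigma> 0 - a \<odot> cdiff ?QU 0)"
        using entries_in_mono[OF first J(2)] 0 by (intro entries_in_simps(2)[OF J_closed(3)]) simp_all
      then have "ZR b" using inj b 0 by simp
      then show ?thesis using R(2) b 0 by (auto simp: acyclic_over_def)
    next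
      case (Suc m)
      have "entries_in I (b \<odot> cdiff R m)"
        using pr_entries(2)[OF add_subgroup_I w(2)]
        unfolding wd comb_add prq_id(2)[OF ad] prq_id(2)[OF b\<sigma>] by (simp add: inr_pr Suc)
      then show ?thesis using R(2) b Suc by (auto simp: acyclic_over_def)
    qed
    then obtain b' where b': "b' \<in> chains X R (Suc n) e" "entries_in I (b - b' \<odot> cdiff R n)" by blast
    have "entries_in I ((a - b' \<odot> \<sigma> (Suc n)) \<odot> cdiff ?QU n)"
    proof -
      have "entries_in I (b' \<odot> (\<lambda>k. \<sigma> (Suc n) k \<odot> cdiff ?QU n + cdiff R n k \<odot> \<sigma> n))"
        using hrowD(1,3)[OF b'(1)] \<sigma>d by (intro comb_I_right) auto
      moreover have "entries_in I ((b - b' \<odot> cdiff R n) \<odot> \<sigma> n)"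
      proof (rule comb_I_left[OF b'(2)])
        fix k assume "k \<in> supp (b - b' \<odot> cdiff R n)"
        then have "k \<in> cbas R n"
          using supp_diff[OF hrowD(1)[OF b] hrowD(1)[OF chains_diff[OF R(1) b'(1)]]] by blast
        then show "entries_in T (\<sigma> n k)" using \<sigma>h hrowD(3) by blast
      qed
      ultimately have "entries_in I (a \<odot> cdiff ?QU n + b \<odot> \<sigma> n -
          (b' \<odot> (\<lambda>k. \<sigma> (Suc n) k \<odot> cdiff ?QU n + cdiff R n k \<odot> \<sigma> n)) - (b - b' \<odot> cdiff R n) \<odot> \<sigma> n)"
        using first by (intro entries_I(2))
      then show ?thesis by (simp add: comb_diff comb_add_right comb_assoc algebra_simps)
    qed
    moreover have "a - b' \<odot> \<sigma> (Suc n) \<in> chains X ?QU (Suc n) e"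
      using a hrow_comb0[OF b'(1) \<sigma>h] by (rule hrow_simps(2))
    ultimately obtain a' where a': "a' \<in> chains X ?QU (Suc (Suc n)) e"
        "entries_in I (a - b' \<odot> \<sigma> (Suc n) - a' \<odot> cdiff ?QU (Suc n))"
      using QU unfolding acyclic_over_def by blast
    have "w - (a' + b' \<odot> inr) \<odot> cdiff ?C (Suc n) =
        (a - b' \<odot> \<sigma> (Suc n) - a' \<odot> cdiff ?QU (Suc n)) + (b - b' \<odot> cdiff R n) \<odot> inr"
      using hrowD(1)[OF a'(1)] by (simp add: w_eq comb_add comb_diff cone_diff_copies cone_diff_inr)
    then have "entries_in I (w - (a' + b' \<odot> inr) \<odot> cdiff ?C (Suc n))"
      using entries_I(4)[OF a'(2) pr_entries(3)[OF add_subgroup_I b'(2)]] by simp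
    moreover have "a' + b' \<odot> inr \<in> chains X ?C (Suc (Suc n)) e"
      using hrow_simps(3)[OF subsetD[OF copies_subset_cone a'(1)] inr_cone_chains[OF b'(1)]] .
    ultimately show ?thesis by blast
  qed
qed

end

section \<open>Evaluation of cochains\<close>

lemma apply_cochain_superset:
  assumes "finite A" "supp u \<subseteq> A"
  shows "apply_cochain f u = (\<Sum>j\<in>A. const_coeff (entry u j) * entry f j)"
  unfolding apply_cochain_def using assms by (intro sum.mono_neutral_left) (auto simp: supp_iff)

lemma apply_cochain_zero [simp]: "apply_cochain f 0 = 0" "apply_cochain 0 u = 0"
  by (simp_all add: apply_cochain_def)

lemma apply_cochain_add: "apply_cochain f (u + v) = apply_cochain f u + apply_cochain f v"
proof -
  have "finite (supp u \<union> supp v)" "supp (u + v) \<subseteq> supp u \<union> supp v"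
    using Poly_Mapping.keys_add[of u v] by simp_all
  then show ?thesis
    by (simp add: apply_cochain_superset[of "supp u \<union> supp v"] lookup_add distrib_right sum.distrib)
qed

lemma apply_cochain_scale_by: "apply_cochain f (scale_by a u) = const_coeff a * apply_cochain f u"
  by (subst apply_cochain_superset[of "supp u"])
    (use supp_scale_by[of a u] in \<open>auto simp: apply_cochain_def sum_distrib_left mult.assoc\<close>)

lemma apply_cochain_diff: "apply_cochain f (u - v) = apply_cochain f u - apply_cochain f v"
  using apply_cochain_add[of f "u - v" v] by simp

lemma apply_cochain_sum: "apply_cochain f (\<Sum>x\<in>A. g x) = (\<Sum>x\<in>A. apply_cochain f (g x))"
  by (induction A rule: infinite_finite_induct) (simp_all add: apply_cochain_add)

lemma apply_cochain_comb:
  "apply_cochain f (u \<odot> M) = (\<Sum>i\<in>supp u. const_coeff (entry u i) * apply_cochain f (M i))"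
  by (simp add: comb_def apply_cochain_sum apply_cochain_scale_by)

lemma apply_cochain_single [simp]: "apply_cochain f (sng i a) = const_coeff a * entry f i"
  by (subst apply_cochain_superset[of "{i}"]) auto

lemma apply_cochain_add_left: "apply_cochain (f + g) u = apply_cochain f u + apply_cochain g u"
  by (simp add: apply_cochain_def lookup_add distrib_left sum.distrib)

lemma entry_map_times [simp]: "entry (Poly_Mapping.map ((*) c) f) i = (c :: 'k::field) * entry f i"
  by (simp add: map.rep_eq when_def)

lemma apply_cochain_scale_left:
  "apply_cochain (Poly_Mapping.map ((*) c) f) u = c * apply_cochain f u"
  by (simp add: apply_cochain_def sum_distrib_left mult_ac)

lemma apply_cochain_sum_left: "apply_cochain (\<Sum>x\<in>A. g x) u = (\<Sum>x\<in>A. apply_cochain (g x) u)"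
  by (induction A rule: infinite_finite_induct) (simp_all add: apply_cochain_add_left)

lemma apply_cochain_plus: "entries_in (tensor_plus X) u \<Longrightarrow> apply_cochain f u = 0"
  by (simp add: apply_cochain_def entries_in_def tensor_plus_def)

lemma apply_cochain_comb_cochain:
  assumes "\<And>i. i \<in> supp u \<Longrightarrow> entry f i = apply_cochain g (M i)"
  shows "apply_cochain f u = apply_cochain g (u \<odot> M)"
  using assms by (simp add: apply_cochain_comb) (simp add: apply_cochain_def)

lemma apply_cochain_degree':
  assumes "\<And>j. entry f j \<noteq> 0 \<Longrightarrow> dg j = m" "u \<in> hrow X S dg e" "e \<noteq> m"
  shows "apply_cochain f u = 0"
  unfolding apply_cochain_def
proof (rule sum.neutral, rule ballI)
  fix j
  show "const_coeff (entry u j) * entry f j = 0"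
    using const_coeff_homs[OF hrowD(2)[OF assms(2), of j]] assms(1)[of j] assms(3) by auto
qed

lemma apply_cochain_degree:
  assumes "f \<in> cochains P n m" "u \<in> hrow X (bas P n) (bdeg P n) e" "e \<noteq> m"
  shows "apply_cochain f u = 0"
  using assms(1) by (intro apply_cochain_degree'[OF _ assms(2,3)]) (auto simp: cochains_def supp_iff)

definition cochain_on :: "nat set \<Rightarrow> (nat \<Rightarrow> 'k) \<Rightarrow> 'k::field cochain" where
  "cochain_on A \<phi> = (\<Sum>i\<in>A. sng i (\<phi> i))"

lemma entry_cochain_on: "finite A \<Longrightarrow> entry (cochain_on A \<phi>) i = (if i \<in> A then \<phi> i else 0)"
  by (simp add: cochain_on_def lookup_sum lookup_single when_def)

lemma cochain_on_cochains:
  "finite {i \<in> bas P n. bdeg P n i = m} \<Longrightarrow> cochain_on {i \<in> bas P n. bdeg P n i = m} \<phi> \<in> cochains P n m"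
  unfolding cochains_def supp_iff subset_iff mem_Collect_eq
  by (simp only: entry_cochain_on split: if_splits) simp

lemma cochains_iff:
  "f \<in> cochains P n m \<longleftrightarrow> (\<forall>i. entry f i \<noteq> 0 \<longrightarrow> i \<in> bas P n \<and> bdeg P n i = m)"
  by (auto simp: cochains_def supp_iff)

lemma cochains_closed:
  "0 \<in> cochains P n m"
  "f \<in> cochains P n m \<Longrightarrow> g \<in> cochains P n m \<Longrightarrow> f + g \<in> cochains P n m"
  "f \<in> cochains P n m \<Longrightarrow> Poly_Mapping.map ((*) c) f \<in> cochains P n m"
  unfolding cochains_iff by (simp, (metis lookup_add add.right_neutral), simp)

section \<open>Shifted complexes and composition\<close>

definition shift :: "nat \<Rightarrow> ('i, 'x, 'k::field) gcomplex \<Rightarrow> ('i, 'x, 'k) gcomplex" where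
  "shift p C = \<lparr>cbas = (\<lambda>n. cbas C (p + n)), cdeg = (\<lambda>n. cdeg C (p + n)), cdiff = (\<lambda>n. cdiff C (p + n))\<rparr>"

lemma shift_simps [simp]:
  "cbas (shift p C) n = cbas C (p + n)" "cdeg (shift p C) n = cdeg C (p + n)"
  "cdiff (shift p C) n = cdiff C (p + n)"
  by (simp_all add: shift_def)

lemma shift_complex:
  "free_complex X I C \<Longrightarrow> free_complex X I (shift p C)"
  "minimal_complex X C \<Longrightarrow> minimal_complex X (shift p C)"
  by (auto simp: free_complex_def minimal_complex_def)

context graded_ideal
begin

lemma chain_map_comp:
  assumes C: "free_complex X I C" and D: "free_complex X I D"
    and F: "chain_map X I C D m F" and G: "chain_map X I D E l G"
  shows "chain_map X I C E (m + l) (\<lambda>n i. F n i \<odot> G n)"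
  unfolding chain_map_def
proof (intro conjI allI ballI)
  note cF = chain_mapD[OF F] and cG = chain_mapD[OF G]
  show "F n i \<odot> G n \<in> chains X E n (cdeg C n i - (m + l))" if "i \<in> cbas C n" for n i
    using hrow_comb[OF cF(1)[OF that] cG(1)] by (simp add: algebra_simps)
  show "entries_in I (F (Suc n) i \<odot> G (Suc n) \<odot> cdiff E n - cdiff C n i \<odot> (\<lambda>i. F n i \<odot> G n))"
    if i: "i \<in> cbas C (Suc n)" for n i
  proof -
    have "entries_in I (F (Suc n) i \<odot> (\<lambda>k. G (Suc n) k \<odot> cdiff E n - cdiff D n k \<odot> G n))"
      using cF(3,4)[OF i] cG(2) by (intro comb_I_right) auto
    moreover have "entries_in I ((F (Suc n) i \<odot> cdiff D n - cdiff C n i \<odot> F n) \<odot> G n)"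
    proof (rule comb_I_left[OF cF(2)[OF i]])
      fix k assume k: "k \<in> supp (F (Suc n) i \<odot> cdiff D n - cdiff C n i \<odot> F n)"
      have "F (Suc n) i \<odot> cdiff D n - cdiff C n i \<odot> F n \<in> chains X D n (cdeg C (Suc n) i - m)"
        by (intro hrow_simps(2) chains_diff[OF D cF(1)[OF i]] hrow_comb[OF free_complexD(1)[OF C i] cF(1)])
      then show "entries_in T (G n k)" using hrowD(1) k cG(4) by blast
    qed
    ultimately show ?thesis
      using entries_I(4) by (fastforce simp: comb_diff_right comb_diff comb_assoc)
  qed
qed

end

section \<open>Linear functionals on rows\<close>

text \<open>
  The vectors \<open>y i\<close> are linearly independent modulo \<open>Y\<close>. Hence they are part of a basis,
  together with a basis of \<open>Y\<close>, and a linear functional is prescribed on it.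
\<close>

lemma (in vector_space) functional_extension:
  assumes S: "finite S" and Y: "subspace Y"
    and ind: "\<And>c. (\<Sum>i\<in>S. scale (c i) (y i)) \<in> Y \<Longrightarrow> \<forall>i\<in>S. c i = 0"
  obtains \<phi> where "\<And>u v. \<phi> (u + v) = \<phi> u + \<phi> v" "\<And>c u. \<phi> (scale c u) = c * \<phi> u"
    "\<And>u. u \<in> Y \<Longrightarrow> \<phi> u = 0" "\<And>i. i \<in> S \<Longrightarrow> \<phi> (y i) = g i"
proof -
  interpret field: vector_space "(*) :: 'a \<Rightarrow> 'a \<Rightarrow> 'a" by unfold_locales (simp_all add: algebra_simps)
  interpret pair: vector_space_pair scale "(*) :: 'a \<Rightarrow> 'a \<Rightarrow> 'a" ..
  obtain B where B: "B \<subseteq> Y" "independent B" "Y \<subseteq> span B"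
    by (rule maximal_independent_subset[of Y]) blast
  have spanB: "span B \<subseteq> Y" by (rule span_minimal[OF B(1) Y])
  have inj: "i = j" if "i \<in> S" "j \<in> S" "y i = y j" for i j
  proof (rule ccontr)
    assume "i \<noteq> j"
    define c where "c k = (if k = i then 1 else if k = j then -1 else (0::'a))" for k
    have "(\<Sum>k\<in>S. scale (c k) (y k)) = (\<Sum>k\<in>{i, j}. scale (c k) (y k))"
      using S that by (intro sum.mono_neutral_right) (auto simp: c_def)
    also have "\<dots> = 0" using that \<open>i \<noteq> j\<close> by (simp add: c_def)
    finally have "c i = 0" using ind[of c] subspace_0[OF Y] that by auto
    then show False by (simp add: c_def)
  qed
  then have inj_y: "inj_on y S" by (auto intro: inj_onI)
  have dis: "y i \<notin> span B" if "i \<in> S" for i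
  proof
    assume "y i \<in> span B"
    then have "(\<Sum>k\<in>S. scale (if k = i then 1 else 0) (y k)) \<in> Y"
      using S that spanB by (simp add: if_distrib[of "\<lambda>c. scale c _"] cong: if_cong) blast
    then show False using ind[of "\<lambda>k. if k = i then 1 else 0"] that by auto
  qed
  have "independent (B \<union> y ` S)"
    unfolding independent_explicit_module
  proof (intro allI impI)
    fix t u v assume t: "finite t" "t \<subseteq> B \<union> y ` S" "(\<Sum>v\<in>t. scale (u v) v) = 0" "v \<in> t"
    define c where "c i = (if y i \<in> t then u (y i) else 0)" for i
    have B_part: "(\<Sum>v\<in>t \<inter> B. scale (u v) v) \<in> Y"
      using B(1) by (intro subspace_sum[OF Y] subspace_scale[OF Y]) auto
    have "(\<Sum>i\<in>S. scale (c i) (y i)) = (\<Sum>v\<in>y ` S. scale (if v \<in> t then u v else 0) v)"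
      by (simp add: sum.reindex[OF inj_y] c_def)
    also have "\<dots> = (\<Sum>v\<in>t \<inter> y ` S. scale (u v) v)"
      using S by (intro sum.mono_neutral_cong_right) auto
    also have "t \<inter> y ` S = t - B" using t(2) dis span_base by blast
    also have "(\<Sum>v\<in>t - B. scale (u v) v) = - (\<Sum>v\<in>t \<inter> B. scale (u v) v)"
      using sum.Int_Diff[OF t(1), of "\<lambda>v. scale (u v) v" B] t(3) by (simp add: eq_neg_iff_add_eq_0 add.commute)
    finally have "\<forall>i\<in>S. c i = 0" using ind[of c] subspace_neg[OF Y B_part] by simp
    then have S_zero: "u v = 0" if "v \<in> t - B" for v using that t(2) by (force simp: c_def)
    then have "(\<Sum>v\<in>t \<inter> B. scale (u v) v) = 0"
      using sum.Int_Diff[OF t(1), of "\<lambda>v. scale (u v) v" B] t(3) by simp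
    then have "u v = 0" if "v \<in> t \<inter> B" for v
      using independentD[OF B(2), of "t \<inter> B" u v] t(1) that by blast
    with S_zero t(4) show "u v = 0" by blast
  qed
  then obtain \<phi> where \<phi>: "Vector_Spaces.linear scale (*) \<phi>"
      "\<forall>x\<in>B \<union> y ` S. \<phi> x = (if x \<in> B then 0 else g (the_inv_into S y x))"
    using pair.linear_independent_extend[of "B \<union> y ` S" "\<lambda>x. if x \<in> B then 0 else g (the_inv_into S y x)"]
    by blast
  interpret lin: Vector_Spaces.linear scale "(*)" \<phi> by (fact \<phi>(1))
  show thesis
  proof (rule that)
    show "\<phi> (u + v) = \<phi> u + \<phi> v" for u v by (rule lin.add)
    show "\<phi> (scale c u) = c * \<phi> u" for c u by (rule lin.scale)
    show "\<phi> u = 0" if "u \<in> Y" for u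
    proof -
      have "subspace {u. \<phi> u = 0}" by (auto simp: subspace_def lin.add lin.scale lin.zero)
      moreover have "B \<subseteq> {u. \<phi> u = 0}" using \<phi>(2) by auto
      ultimately have "span B \<subseteq> {u. \<phi> u = 0}" by (intro span_minimal)
      with B(3) that show ?thesis by blast
    qed
    show "\<phi> (y i) = g i" if "i \<in> S" for i
      using \<phi>(2) that dis[OF that] span_base by (auto simp: the_inv_into_f_f[OF inj_y])
  qed
qed

locale linear_functional =
  fixes \<mu> :: "('x, 'k::field) tensor \<Rightarrow> 'k"
  assumes add: "\<mu> (p + q) = \<mu> p + \<mu> q" and scalar: "\<mu> (sng [] c * p) = c * \<mu> p"
begin

lemma zero: "\<mu> 0 = 0" using scalar[of 0 0] by simp

lemma diff: "\<mu> (p - q) = \<mu> p - \<mu> q" using add[of "p - q" q] by simp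

lemma sum: "\<mu> (\<Sum>x\<in>A. f x) = (\<Sum>x\<in>A. \<mu> (f x))"
  by (induction A rule: infinite_finite_induct) (simp_all add: zero add)

end

lemma ideal'I:
  assumes "p = (\<Sum>x\<in>X. f x * var x) + (\<Sum>x\<in>X. var x * g x)" "f ` X \<subseteq> I" "g ` X \<subseteq> I"
  shows "p \<in> ideal' X I"
  unfolding ideal'_def mem_Collect_eq by (rule exI[of _ f], rule exI[of _ g]) (intro conjI assms)

lemma ideal'E:
  assumes "p \<in> ideal' X I"
  obtains f g where "p = (\<Sum>x\<in>X. f x * var x) + (\<Sum>x\<in>X. var x * g x)" "f ` X \<subseteq> I" "g ` X \<subseteq> I"
  using assms unfolding ideal'_def mem_Collect_eq by (elim exE conjE)

lemma add_subgroup_ideal':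
  fixes I :: "('x, 'k::field) tensor set"
  assumes "add_subgroup I"
  shows "add_subgroup (ideal' X I)"
  unfolding add_subgroup_def
proof (intro conjI ballI)
  show "0 \<in> ideal' X I"
    by (rule ideal'I[where f = "\<lambda>_. 0" and g = "\<lambda>_. 0"]) (use assms in \<open>auto simp: add_subgroup_def\<close>)
  fix p q assume "p \<in> ideal' X I" "q \<in> ideal' X I"
  from this(1) obtain f g where
    p: "p = (\<Sum>x\<in>X. f x * var x) + (\<Sum>x\<in>X. var x * g x)" "f ` X \<subseteq> I" "g ` X \<subseteq> I"
    by (rule ideal'E)
  from \<open>q \<in> ideal' X I\<close> obtain f' g' where
    q: "q = (\<Sum>x\<in>X. f' x * var x) + (\<Sum>x\<in>X. var x * g' x)" "f' ` X \<subseteq> I" "g' ` X \<subseteq> I"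
    by (rule ideal'E)
  have "p - q = (\<Sum>x\<in>X. (f x - f' x) * var x) + (\<Sum>x\<in>X. var x * (g x - g' x))"
    unfolding p(1) q(1) by (simp add: algebra_simps sum_subtractf)
  moreover have "(\<lambda>x. f x - f' x) ` X \<subseteq> I" "(\<lambda>x. g x - g' x) ` X \<subseteq> I"
    using p(2,3) q(2,3) by (auto intro!: add_subgroupD(2)[OF assms])
  ultimately show "p - q \<in> ideal' X I" by (rule ideal'I)
qed

lemma tensor_plus_supp: "a \<in> tensor_plus X \<Longrightarrow> w \<in> supp a \<Longrightarrow> set w \<subseteq> X \<and> w \<noteq> []"
  by (auto simp: tensor_plus_def mem_tensor_algebra const_coeff_def supp_iff)

lemma tensor_plus_mult: "a \<in> tensor_plus X \<Longrightarrow> b \<in> tensor_plus X \<Longrightarrow> a * b \<in> tensor_ge2 X"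
  unfolding tensor_ge2_def mem_Collect_eq
proof (intro conjI ballI)
  assume ab: "a \<in> tensor_plus X" "b \<in> tensor_plus X"
  then show "a * b \<in> tensor_algebra X"
    using tensor_plus_subset by (blast intro: mult_tensor_algebra)
  fix w assume "w \<in> supp (a * b)"
  then obtain u v where uv: "u \<in> supp a" "v \<in> supp b" "w = u @ v" by (blast dest: supp_mult_tensor)
  then have "u \<noteq> []" "v \<noteq> []" using tensor_plus_supp ab by blast+
  then show "2 \<le> length w" using uv(3) by (cases u; cases v) simp_all
qed

context graded_ideal
begin

text \<open>
  A monomial of positive degree begins and ends with a variable, and the rest of it is absorbed
  by \<open>I\<close>. So \<open>I'\<close> contains all products of \<open>T(V)\<^sub>+\<close> with \<open>I\<close>, on either side.
\<close>

lemma plus_mult_ideal: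
  assumes X: "finite X" and a: "a \<in> Tp" and p: "p \<in> I"
  shows "a * p \<in> ideal' X I" "p * a \<in> ideal' X I"
proof -
  have 0: "0 \<in> I" by (rule zero_mem_I)
  have l: "var x * q \<in> ideal' X I" if "x \<in> X" "q \<in> I" for x q
  proof -
    have "var x * q = (\<Sum>y\<in>X. 0 * var y) + (\<Sum>y\<in>X. var y * (if y = x then q else 0))"
      using X that(1) by (simp add: if_distrib[of "\<lambda>z. _ * z"] cong: if_cong)
    moreover have "(\<lambda>y. 0) ` X \<subseteq> I" "(\<lambda>y. if y = x then q else 0) ` X \<subseteq> I" using 0 that by auto
    ultimately show ?thesis by (rule ideal'I)
  qed
  have r: "q * var x \<in> ideal' X I" if "x \<in> X" "q \<in> I" for x q
  proof -
    have "q * var x = (\<Sum>y\<in>X. (if y = x then q else 0) * var y) + (\<Sum>y\<in>X. var y * 0)"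
      using X that(1) by (simp add: if_distrib[of "\<lambda>z. z * _"] cong: if_cong)
    moreover have "(\<lambda>y. if y = x then q else 0) ` X \<subseteq> I" "(\<lambda>y. 0) ` X \<subseteq> I" using 0 that by auto
    ultimately show ?thesis by (rule ideal'I)
  qed
  note sub = add_subgroup_ideal'[OF add_subgroup_I, of X]
  have "a * p = (\<Sum>w\<in>supp a. sng w (entry a w) * p)"
    by (subst sum_singles[of a]) (simp add: sum_distrib_right)
  moreover have "sng w (entry a w) * p \<in> ideal' X I" if wa: "w \<in> supp a" for w
  proof -
    obtain x v where w: "w = x # v" "x \<in> X" "set v \<subseteq> X"
      using tensor_plus_supp[OF a wa] by (cases w) auto
    have "sng v (entry a w) * p \<in> I" using w(3) by (intro mult_left p) (auto simp: mem_tensor_algebra)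
    from l[OF w(2) this] show ?thesis
      by (simp add: var_def w(1) mult_single plus_list_def flip: mult.assoc)
  qed
  ultimately show "a * p \<in> ideal' X I" by (auto intro: add_subgroup_sum[OF sub])
  have "p * a = (\<Sum>w\<in>supp a. p * sng w (entry a w))"
    by (subst sum_singles[of a]) (simp add: sum_distrib_left)
  moreover have "p * sng w (entry a w) \<in> ideal' X I" if wa: "w \<in> supp a" for w
  proof -
    obtain x v where w: "w = v @ [x]" "x \<in> X" "set v \<subseteq> X"
      using tensor_plus_supp[OF a wa] by (cases w rule: rev_cases) auto
    have "p * sng v (entry a w) \<in> I" using w(3) by (intro mult_right p) (auto simp: mem_tensor_algebra)
    from r[OF w(2) this] show ?thesis
      by (simp add: var_def w(1) mult_single plus_list_def mult.assoc)
  qed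
  ultimately show "p * a \<in> ideal' X I" by (auto intro: add_subgroup_sum[OF sub])
qed

end

section \<open>Minimal resolutions of the trivial module\<close>

locale trivial_resolution = graded_ideal X I for X :: "'x set" and I :: "('x, 'k::field) tensor set" +
  fixes P :: "('x, 'k) resolution" and b :: nat and \<kappa> :: 'k
  assumes finite_X: "finite X"
    and resolution: "minimal_resolution X I (trivial_module X) P"
    and aug: "\<kappa> \<noteq> 0" "bas P 0 = {b}" "bdeg P 0 b = 0" "mat P 0 b = sng 0 (sng [] \<kappa>)"
begin

abbreviation "CP \<equiv> complex_of P"

lemmas P_complex = resolution_free_complex[OF resolution]
  and P_minimal = resolution_minimal[OF resolution]

lemma P_finite: "finite {i \<in> bas P n. bdeg P n i = m}"
proof -
  have "finite {i \<in> bas P n. bdeg P n i \<le> m}"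
    using resolution by (auto simp: minimal_resolution_def graded_free_resolution_def)
  then show ?thesis by (rule rev_finite_subset) auto
qed

lemma supp_b: "supp u \<subseteq> {b} \<Longrightarrow> u = sng b (entry u b)"
  by (rule poly_mapping_eqI) (auto simp: lookup_single when_def supp_iff)

lemma aug_b: "supp u \<subseteq> {b} \<Longrightarrow> u \<odot> mat P 0 = sng 0 (entry u b * sng [] \<kappa>)"
  by (subst supp_b, assumption) (simp add: aug)

lemma P_acyclic: "acyclic_over X I CP (entries_in Tp)"
proof -
  have "u \<odot> mat P 0 \<in> rels (trivial_module X)" if "u \<in> chains X CP 0 e" "entries_in Tp u" for u e
  proof -
    have "entry u b * sng [] \<kappa> \<in> Tp"
      using that(2) by (intro mult_tensor_plus) (auto simp: entries_in_def)
    then show ?thesis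
      using aug_b[of u] hrowD(1)[OF that(1)] aug(2)
      by (auto simp: trivial_module_def cyclic_module_def rows_iff entries_in_def lookup_single when_def)
  qed
  with resolution_acyclic[OF resolution] show ?thesis by (auto simp: acyclic_over_def)
qed

lemma cocycles_eq: "cocycles P n m = cochains P n m"
  using P_minimal by (auto simp: cocycles_def minimal_complex_def intro: apply_cochain_plus)

lemma coboundary_zero:
  assumes "f \<in> coboundaries P n m"
  shows "f = 0"
proof (cases n)
  case (Suc k)
  with assms obtain e where f: "f \<in> cochains P n m"
      "\<forall>i\<in>bas P n. entry f i = apply_cochain e (mat P n i)"
    by (auto simp: coboundaries_def)
  have "entry f i = 0" if "i \<in> bas P n" for i
    using f(2) that P_minimal Suc by (auto simp: minimal_complex_def intro: apply_cochain_plus)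
  with f(1) show ?thesis by (intro poly_mapping_eqI) (auto simp: cochains_iff)
qed (use assms in \<open>simp add: coboundaries_def\<close>)

text \<open>
  Sending \<open>i\<close> to \<open>\<phi> i\<close> times the generator \<open>b\<close> is a map to \<open>P\<^sup>0\<close>. It carries boundaries into
  \<open>T(V)\<^sub>+\<close> because \<open>C\<close> is minimal, so that it can be lifted.
\<close>

lemma lift_functional:
  fixes C :: "('i, 'x, 'k) gcomplex" and \<phi> :: "'i \<Rightarrow> 'k"
  assumes C: "free_complex X I C" "minimal_complex X C"
    and \<phi>: "\<And>i. i \<in> cbas C 0 \<Longrightarrow> \<phi> i \<noteq> 0 \<Longrightarrow> cdeg C 0 i = m"
  obtains F where "chain_map X I C CP m F" "\<And>i. F 0 i = sng b (sng [] (\<phi> i))"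
proof -
  define F0 :: "'i \<Rightarrow> nat \<Rightarrow>\<^sub>0 ('x, 'k) tensor" where "F0 i = sng b (sng [] (\<phi> i))" for i
  have F0: "F0 i \<in> chains X CP 0 (cdeg C 0 i - m)" if "i \<in> cbas C 0" for i
    unfolding F0_def using that \<phi>[OF that] aug by (cases "\<phi> i = 0") (auto intro!: hrow_single)
  have "entries_in Tp (cdiff C 0 i \<odot> F0)" if "i \<in> cbas C 1" for i
    using that C(2) hrowD(3)[OF F0] free_complexD(3)[OF C(1), of i 0]
    by (intro comb_P_left) (auto simp: minimal_complex_def)
  then obtain F where "F 0 = F0" "chain_map X I C CP m F"
    using lift_chain_map[OF C(1) P_complex P_acyclic F0] by blast
  then show thesis by (intro that[of F]) (auto simp: F0_def)
qed

lemma chain_lift_iff: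
  "chain_lift X I P p m f F \<longleftrightarrow> chain_map X I (shift p CP) CP m F \<and>
     (\<forall>i\<in>bas P p. const_coeff (entry (F 0 i) b) * \<kappa> = entry f i)"
proof -
  have r: "u \<in> rows I (bas P k) \<longleftrightarrow> entries_in I u" if "u \<in> rows T (bas P k)" for u k
    using that by (auto simp: rows_iff zero_mem_I)
  have hr: "u \<in> rows T (bas P k) \<and> homogeneous_row (bdeg P k) d u \<longleftrightarrow> u \<in> chains X CP k d" for u k d
    by (simp add: hrow_iff)
  have "F (Suc k) i \<odot> mat P (Suc k) - mat P (p + Suc k) i \<odot> F k \<in> chains X CP k (bdeg P (p + Suc k) i - m)"
    if i: "i \<in> bas P (p + Suc k)"
      and F: "\<forall>k. \<forall>i\<in>bas P (p + k). F k i \<in> chains X CP k (bdeg P (p + k) i - m)" for i k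
  proof (rule hrow_simps(2))
    have "F (Suc k) i \<in> chains X CP (Suc k) (bdeg P (p + Suc k) i - m)" using F i by blast
    from chains_diff[OF P_complex this]
    show "F (Suc k) i \<odot> mat P (Suc k) \<in> chains X CP k (bdeg P (p + Suc k) i - m)" by simp
    have "mat P (p + Suc k) i \<in> chains X CP (p + k) (bdeg P (p + Suc k) i)"
      using free_complexD(1)[OF P_complex, of i "p + k"] i by simp
    then show "mat P (p + Suc k) i \<odot> F k \<in> chains X CP k (bdeg P (p + Suc k) i - m)"
      using F by (intro hrow_comb) auto
  qed
  then have r': "F (Suc k) i \<odot> mat P (Suc k) - mat P (p + Suc k) i \<odot> F k \<in> rows I (bas P k) \<longleftrightarrow>
      entries_in I (F (Suc k) i \<odot> mat P (Suc k) - mat P (p + Suc k) i \<odot> F k)"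
    if "i \<in> bas P (p + Suc k)"
      and "\<forall>k. \<forall>i\<in>bas P (p + k). F k i \<in> chains X CP k (bdeg P (p + k) i - m)" for i k
    using that by (intro r) (simp add: hrow_iff)
  have a: "const_coeff (entry (F 0 i \<odot> mat P 0) 0) = const_coeff (entry (F 0 i) b) * \<kappa>"
    if "i \<in> bas P p" and "\<forall>k. \<forall>i\<in>bas P (p + k). F k i \<in> chains X CP k (bdeg P (p + k) i - m)" for i
    using aug_b[of "F 0 i"] that hrowD(1)[of "F 0 i"] aug(2) by fastforce
  show ?thesis
    unfolding chain_lift_def chain_map_def row_mult_eq hr
    using r' a by (auto; fastforce)
qed

lemma chain_lift_exists:
  assumes "f \<in> cochains P p m"
  obtains F where "chain_lift X I P p m f F"
proof -
  have "\<And>i. entry f i * inverse \<kappa> \<noteq> 0 \<Longrightarrow> bdeg P p i = m"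
    using assms by (auto simp: cochains_iff)
  then obtain F where F: "chain_map X I (shift p CP) CP m F" "\<And>i. F 0 i = sng b (sng [] (entry f i * inverse \<kappa>))"
    using lift_functional[OF shift_complex(1)[OF P_complex] shift_complex(2)[OF P_minimal],
        of p "\<lambda>i. entry f i * inverse \<kappa>" m] by auto
  then show thesis using aug(1) by (intro that[of F]) (simp add: chain_lift_iff)
qed

text \<open>
  Over a minimal resolution all cochains are cocycles and coboundaries vanish, so that cochains
  and classes are the same.
\<close>

lemma generated_cochain: "yoneda_generated X I P n m f \<Longrightarrow> f \<in> cochains P n m"
proof (induction rule: yoneda_generated.induct)
  case (coboundary f n m)
  then show ?case using coboundary_zero cochains_closed(1) by metis
next
  case (product q l g p m f h)
  then obtain F where F: "chain_lift X I P p m f F" "supp h \<subseteq> bas P (p + q)"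
      "\<forall>i\<in>bas P (p + q). entry h i = apply_cochain g (F q i)"
    by (auto simp: yoneda_product_def)
  have "bdeg P (p + q) i = m + l" if "entry h i \<noteq> 0" for i
  proof (rule ccontr)
    assume ne: "bdeg P (p + q) i \<noteq> m + l"
    have i: "i \<in> bas P (p + q)" using that F(2) by (auto simp: supp_iff)
    have "F q i \<in> hrow X (bas P q) (bdeg P q) (bdeg P (p + q) i - m)"
      using F(1) chain_mapD(1)[of X I "shift p CP" CP m F i q] i by (auto simp: chain_lift_iff)
    from apply_cochain_degree[OF product.IH(1) this] ne that i F(3) show False by auto
  qed
  then show ?case using F(2) by (auto simp: cochains_iff supp_iff)
qed (auto simp: cocycles_eq cochains_closed)

lemma generated_zero: "yoneda_generated X I P n m 0"
  by (rule yoneda_generated.coboundary)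
    (auto simp: coboundaries_def cochains_closed split: nat.split intro!: bexI[of _ 0])

lemma generated_sum:
  "(\<And>x. x \<in> A \<Longrightarrow> yoneda_generated X I P n m (f x)) \<Longrightarrow> yoneda_generated X I P n m (sum f A)"
  by (induction A rule: infinite_finite_induct) (auto intro: generated_zero yoneda_generated.add)

text \<open>
  The definition of products leaves the lift open. It is essential below that a particular lift may
  be used, since lifts arise as composites of other chain maps.
\<close>

lemma generated_product:
  assumes "yoneda_generated X I P q l g" "yoneda_generated X I P p m f" "chain_lift X I P p m f F"
  obtains h where "yoneda_generated X I P (p + q) (m + l) h"
    "\<And>i. i \<in> bas P (p + q) \<Longrightarrow> entry h i = apply_cochain g (F q i)"
proof -
  define A where "A = {i \<in> bas P (p + q). bdeg P (p + q) i = m + l}"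
  define h where "h = cochain_on A (\<lambda>i. apply_cochain g (F q i))"
  have fin: "finite A" unfolding A_def by (rule P_finite)
  have h: "entry h i = apply_cochain g (F q i)" if i: "i \<in> bas P (p + q)" for i
  proof (cases "i \<in> A")
    case False
    have "F q i \<in> hrow X (bas P q) (bdeg P q) (bdeg P (p + q) i - m)"
      using assms(3) chain_mapD(1)[of X I "shift p CP" CP m F i q] i by (auto simp: chain_lift_iff)
    from apply_cochain_degree[OF generated_cochain[OF assms(1)] this] False i fin
    show ?thesis by (auto simp: h_def entry_cochain_on A_def)
  qed (simp add: h_def entry_cochain_on fin)
  have "supp h \<subseteq> bas P (p + q)"
    using fin by (auto simp: h_def supp_iff entry_cochain_on A_def split: if_splits)
  then have "yoneda_product X I P q g p m f h" using assms(3) h by (auto simp: yoneda_product_def)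
  with assms(1,2) h show thesis by (intro that[of h] yoneda_generated.product)
qed

end

section \<open>Products with classes of degree one and two\<close>

lemma scalar_commute: "p * sng [] c = sng [] c * (p :: ('x, 'k::field) tensor)"
proof -
  have "p * sng [] c = (\<Sum>w\<in>supp p. sng w (entry p w) * sng [] c)"
    by (subst sum_singles[of p]) (simp add: sum_distrib_right)
  also have "\<dots> = (\<Sum>w\<in>supp p. sng [] c * sng w (entry p w))"
    by (simp add: mult_single plus_list_def mult.commute)
  also have "\<dots> = sng [] c * p"
    by (subst (2) sum_singles[of p]) (simp add: sum_distrib_left)
  finally show ?thesis .
qed

lemma minus_const_plus: "a \<in> tensor_algebra X \<Longrightarrow> a - sng [] (const_coeff a) \<in> tensor_plus X"
  by (simp add: tensor_plus_def add_subgroupD(2)[OF add_subgroup_tensor_algebra])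

context linear_functional
begin

text \<open>
  Replace each coefficient by its constant term; the difference lies in \<open>T(V)\<^sub>+\<close> and does not
  matter for \<open>\<mu>\<close>.
\<close>

lemma comb_left:
  assumes "entries_in (tensor_algebra X) u" "\<And>i. i \<in> supp u \<Longrightarrow> entries_in C (M i)"
    and van: "\<And>a p. a \<in> tensor_plus X \<Longrightarrow> p \<in> C \<Longrightarrow> \<mu> (a * p) = 0"
  shows "\<mu> (entry (u \<odot> M) k) = (\<Sum>i\<in>supp u. const_coeff (entry u i) * \<mu> (entry (M i) k))"
  unfolding entry_comb sum
proof (rule sum.cong[OF refl])
  fix i assume i: "i \<in> supp u"
  let ?c = "const_coeff (entry u i)"
  have "entry u i * entry (M i) k = (entry u i - sng [] ?c) * entry (M i) k + sng [] ?c * entry (M i) k"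
    by (simp add: algebra_simps)
  moreover have "\<mu> ((entry u i - sng [] ?c) * entry (M i) k) = 0"
    using assms(1,2) i by (intro van minus_const_plus) (auto simp: entries_in_def)
  ultimately show "\<mu> (entry u i * entry (M i) k) = ?c * \<mu> (entry (M i) k)"
    by (simp add: add scalar)
qed

lemma comb_right:
  assumes "entries_in C u" "\<And>i. i \<in> supp u \<Longrightarrow> entries_in (tensor_algebra X) (M i)"
    and van: "\<And>a p. a \<in> tensor_plus X \<Longrightarrow> p \<in> C \<Longrightarrow> \<mu> (p * a) = 0"
  shows "\<mu> (entry (u \<odot> M) k) = (\<Sum>i\<in>supp u. \<mu> (entry u i) * const_coeff (entry (M i) k))"
  unfolding entry_comb sum
proof (rule sum.cong[OF refl])
  fix i assume i: "i \<in> supp u"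
  let ?c = "const_coeff (entry (M i) k)"
  have "entry u i * entry (M i) k = entry u i * (entry (M i) k - sng [] ?c) + sng [] ?c * entry u i"
    by (simp add: algebra_simps scalar_commute)
  moreover have "\<mu> (entry u i * (entry (M i) k - sng [] ?c)) = 0"
    using assms(1,2) i by (intro van minus_const_plus) (auto simp: entries_in_def)
  ultimately show "\<mu> (entry u i * entry (M i) k) = \<mu> (entry u i) * ?c"
    by (simp add: add scalar)
qed

end

context trivial_resolution
begin

text \<open>
  Functionals on \<open>V\<close> and on \<open>I/I'\<close> give classes in \<open>E\<^sup>1(A)\<close> and \<open>E\<^sup>2(A)\<close>. They are defined through
  the matrices of \<open>P\<close>, so that the bases of \<open>P\<^sup>1\<close> and \<open>P\<^sup>2\<close> need not be identified with bases of
  \<open>V\<close> and \<open>I/I'\<close>. As \<open>\<mu>\<close> is not assumed to be homogeneous, the part of internal degree \<open>l\<close> is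
  cut out.
\<close>

definition class1 :: "(('x, 'k) tensor \<Rightarrow> 'k) \<Rightarrow> int \<Rightarrow> 'k cochain" where
  "class1 \<mu> l = cochain_on {i \<in> bas P 1. bdeg P 1 i = l} (\<lambda>i. \<mu> (entry (mat P 1 i) b))"

definition class2 :: "(('x, 'k) tensor \<Rightarrow> 'k) \<Rightarrow> int \<Rightarrow> 'k cochain" where
  "class2 \<mu> l = cochain_on {i \<in> bas P 2. bdeg P 2 i = l} (\<lambda>i. \<mu> (entry (mat P 2 i \<odot> mat P 1) b))"

lemma class_generated: "yoneda_generated X I P 1 l (class1 \<mu> l)" "yoneda_generated X I P 2 l (class2 \<mu> l)"
proof -
  have "class1 \<mu> l \<in> cocycles P 1 l" "class2 \<mu> l \<in> cocycles P 2 l"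
    unfolding class1_def class2_def cocycles_eq by (rule cochain_on_cochains[OF P_finite])+
  then show "yoneda_generated X I P 1 l (class1 \<mu> l)" "yoneda_generated X I P 2 l (class2 \<mu> l)"
    by (blast intro: yoneda_generated.deg1 yoneda_generated.deg2)+
qed

lemma apply_cochain_on:
  assumes u: "u \<in> hrow X (bas P n) (bdeg P n) l"
  shows "apply_cochain (cochain_on {i \<in> bas P n. bdeg P n i = l} \<phi>) u =
    (\<Sum>i\<in>supp u. const_coeff (entry u i) * \<phi> i)"
  unfolding apply_cochain_def
proof (rule sum.cong[OF refl])
  fix j assume "j \<in> supp u"
  then have "j \<in> bas P n" using hrowD(1)[OF u] by blast
  moreover have "const_coeff (entry u j) = 0" if "bdeg P n j \<noteq> l"
    using const_coeff_homs[OF hrowD(2)[OF u, of j]] that by simp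
  ultimately show "const_coeff (entry u j) * entry (cochain_on {i \<in> bas P n. bdeg P n i = l} \<phi>) j =
      const_coeff (entry u j) * \<phi> j"
    using P_finite[of n l] by (auto simp: entry_cochain_on)
qed

text \<open>
  Applying the class to \<open>F\<^sub>1(i)\<close> amounts to applying \<open>\<mu>\<close> to \<open>F\<^sub>1(i) M\<^sub>1\<close>. Modulo \<open>I\<close> this is the
  product of a row of the differential of \<open>C\<close> with \<open>F\<^sub>0\<close>, of which \<open>\<mu>\<close> only sees the part that is
  linear in \<open>V\<close>.
\<close>

lemma class1_eval:
  fixes C :: "('i, 'x, 'k) gcomplex"
  assumes \<mu>: "linear_functional \<mu>" "\<And>p. p \<in> tensor_ge2 X \<Longrightarrow> \<mu> p = 0" and I2: "I \<subseteq> tensor_ge2 X"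
    and C: "free_complex X I C" "minimal_complex X C" and F: "chain_map X I C CP e F"
    and i: "i \<in> cbas C 1" "cdeg C 1 i = e + l"
  shows "apply_cochain (class1 \<mu> l) (F 1 i) =
    (\<Sum>j\<in>supp (cdiff C 0 i). \<mu> (entry (cdiff C 0 i) j) * const_coeff (entry (F 0 j) b))"
proof -
  interpret linear_functional \<mu> by fact
  note cF = chain_mapD[OF F] and cC = free_complexD[OF C(1)]
  have u: "F 1 i \<in> hrow X (bas P 1) (bdeg P 1) l" using cF(1)[OF i(1)] i(2) by simp
  have "apply_cochain (class1 \<mu> l) (F 1 i) = \<mu> (entry (F 1 i \<odot> mat P 1) b)"
    unfolding class1_def apply_cochain_on[OF u]
    using hrowD(1,3)[OF u] P_minimal
    by (intro comb_left[where C = Tp, symmetric]) (auto simp: minimal_complex_def intro!: \<mu>(2) tensor_plus_mult)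
  also have "\<dots> = \<mu> (entry (cdiff C 0 i \<odot> F 0) b)"
  proof -
    have "entry (F 1 i \<odot> mat P 1 - cdiff C 0 i \<odot> F 0) b \<in> tensor_ge2 X"
      using cF(2)[of i 0] i(1) I2 by (auto simp: entries_in_def)
    then show ?thesis using \<mu>(2) diff by (fastforce simp: lookup_minus)
  qed
  also have "\<dots> = (\<Sum>j\<in>supp (cdiff C 0 i). \<mu> (entry (cdiff C 0 i) j) * const_coeff (entry (F 0 j) b))"
  proof (rule comb_right)
    show "entries_in Tp (cdiff C 0 i)" using C(2) i(1) by (simp add: minimal_complex_def)
    show "entries_in T (F 0 j)" if "j \<in> supp (cdiff C 0 i)" for j
      using that cC(3)[of i 0] i(1) cF(4) by auto
    show "\<mu> (p * a) = 0" if "a \<in> Tp" "p \<in> Tp" for a p using that by (intro \<mu>(2) tensor_plus_mult)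
  qed
  finally show ?thesis .
qed

text \<open>
  As for degree one, with two differentials: \<open>F\<^sub>2(i) M\<^sub>2 M\<^sub>1\<close> agrees with the product of two
  differentials of \<open>C\<close> with \<open>F\<^sub>0\<close>, up to terms in \<open>I T(V)\<^sub>+\<close> and \<open>T(V)\<^sub>+ I\<close>. These lie in \<open>I'\<close>.
\<close>

lemma class2_eval:
  fixes C :: "('i, 'x, 'k) gcomplex"
  assumes \<mu>: "linear_functional \<mu>" "\<And>p. p \<in> ideal' X I \<Longrightarrow> \<mu> p = 0"
    and C: "free_complex X I C" "minimal_complex X C" and F: "chain_map X I C CP e F"
    and i: "i \<in> cbas C 2" "cdeg C 2 i = e + l"
  shows "apply_cochain (class2 \<mu> l) (F 2 i) =
    (\<Sum>j\<in>supp (cdiff C 1 i \<odot> cdiff C 0).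
      \<mu> (entry (cdiff C 1 i \<odot> cdiff C 0) j) * const_coeff (entry (F 0 j) b))"
proof -
  interpret linear_functional \<mu> by fact
  note cF = chain_mapD[OF F] and cC = free_complexD[OF C(1)]
  have i': "i \<in> cbas C (Suc (Suc 0))" "i \<in> cbas C (Suc 1)" using i(1) by (simp_all add: numeral_2_eq_2)
  have van: "\<mu> (a * p) = 0" "\<mu> (p * a) = 0" if "a \<in> Tp" "p \<in> I" for a p
    using plus_mult_ideal[OF finite_X that] \<mu>(2) by auto
  have u: "F 2 i \<in> hrow X (bas P 2) (bdeg P 2) l" using cF(1)[OF i(1)] i(2) by simp
  have supp1: "j \<in> cbas C 1" if "j \<in> supp (cdiff C 1 i)" for j
    using that cC(3)[OF i'(2)] by auto
  have supp0: "j \<in> cbas C 0" if "j \<in> supp (cdiff C 1 i \<odot> cdiff C 0)" for j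
    using that supp_comb[of "cdiff C 1 i" "cdiff C 0" "cbas C 0"] supp1 cC(3)[of _ 0] by auto
  have min: "entries_in Tp (cdiff C 1 i)" "\<And>k. k \<in> bas P 1 \<Longrightarrow> entries_in Tp (mat P 1 k)"
    using C(2) i'(2) P_minimal by (auto simp: minimal_complex_def)
  have "apply_cochain (class2 \<mu> l) (F 2 i) = \<mu> (entry (F 2 i \<odot> (\<lambda>k. mat P 2 k \<odot> mat P 1)) b)"
    unfolding class2_def apply_cochain_on[OF u]
    using hrowD(1,3)[OF u] free_complexD(2)[OF P_complex, of _ 0] van
    by (intro comb_left[where C = I, symmetric]) (auto simp: numeral_2_eq_2)
  also have "\<dots> = \<mu> (entry (F 2 i \<odot> mat P 2 \<odot> mat P 1) b)" by (simp add: comb_assoc)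
  also have "\<dots> = \<mu> (entry (cdiff C 1 i \<odot> cdiff C 0 \<odot> F 0) b)"
  proof -
    define r where "r = F 2 i \<odot> mat P 2 - cdiff C 1 i \<odot> F 1"
    define s where "s k = F 1 k \<odot> mat P 1 - cdiff C 0 k \<odot> F 0" for k
    have r: "entries_in I r" using cF(2)[OF i'(2)] by (simp add: r_def numeral_2_eq_2)
    have s: "entries_in I (s k)" if "k \<in> cbas C 1" for k
      using cF(2)[of k 0] that by (simp add: s_def)
    have rsupp: "supp r \<subseteq> bas P 1"
      unfolding r_def using cF(3)[OF i(1)] free_complexD(3)[OF P_complex, of _ 1] supp1 cF(3)[of _ 1]
      by (intro supp_diff supp_comb) (auto simp: numeral_2_eq_2)
    have "F 2 i \<odot> mat P 2 \<odot> mat P 1 = r \<odot> mat P 1 + cdiff C 1 i \<odot> s + cdiff C 1 i \<odot> cdiff C 0 \<odot> F 0"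
      by (simp add: r_def s_def[abs_def] comb_diff comb_diff_right comb_assoc)
    moreover have "\<mu> (entry (r \<odot> mat P 1) b) = 0"
      unfolding entry_comb sum using r rsupp min(2) van(2)
      by (intro sum.neutral) (auto simp: entries_in_def)
    moreover have "\<mu> (entry (cdiff C 1 i \<odot> s) b) = 0"
      unfolding entry_comb sum using s supp1 min(1) van(1)
      by (intro sum.neutral) (auto simp: entries_in_def)
    ultimately show ?thesis by (simp add: lookup_add add)
  qed
  also have "\<dots> = (\<Sum>j\<in>supp (cdiff C 1 i \<odot> cdiff C 0).
      \<mu> (entry (cdiff C 1 i \<odot> cdiff C 0) j) * const_coeff (entry (F 0 j) b))"
    using cC(2)[OF i'(1)] supp0 cF(4) van(2) by (intro comb_right[where C = I]) auto
  finally show ?thesis .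
qed

text \<open>
  If \<open>D\<close> lifts the class \<open>d\<close> over \<open>P\<close>, then \<open>G\<close> followed by \<open>D\<close> lifts the class that \<open>d\<close> induces
  on \<open>C\<close>. So the product of \<open>L\<close> with \<open>d\<close>, restricted along \<open>G\<close>, is obtained by applying \<open>L\<close> to
  this composite \<open>F\<close>, a chain map of which the part in degree \<open>0\<close> is known.
\<close>

lemma product_along:
  fixes C :: "(nat, 'x, 'k) gcomplex"
  assumes C: "free_complex X I C" and G: "chain_map X I C CP 0 G"
    and d: "yoneda_generated X I P n e d" and L: "yoneda_generated X I P q l L"
  shows "\<exists>h F. yoneda_generated X I P (n + q) (e + l) h \<and> chain_map X I (shift n C) CP e F \<and>
    (\<forall>j\<in>cbas C n. const_coeff (entry (F 0 j) b) = inverse \<kappa> * apply_cochain d (G n j)) \<and>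
    (\<forall>i\<in>cbas C (n + q). apply_cochain h (G (n + q) i) = apply_cochain L (F q i))"
proof -
  obtain D where D: "chain_lift X I P n e d D"
    using chain_lift_exists[OF generated_cochain[OF d]] by blast
  obtain h where h: "yoneda_generated X I P (n + q) (e + l) h"
      "\<And>i. i \<in> bas P (n + q) \<Longrightarrow> entry h i = apply_cochain L (D q i)"
    using generated_product[OF L d D] by blast
  define F where "F k i = G (n + k) i \<odot> D k" for k i
  have "chain_map X I (shift n C) (shift n CP) 0 (\<lambda>k. G (n + k))"
    using G by (auto simp: chain_map_def)
  moreover have D': "chain_map X I (shift n CP) CP e D" using D by (simp add: chain_lift_iff)
  ultimately have F: "chain_map X I (shift n C) CP e F"
    unfolding F_def[abs_def]
    using chain_map_comp[OF shift_complex(1)[OF C] shift_complex(1)[OF P_complex]] by fastforce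
  have "const_coeff (entry (F 0 j) b) = inverse \<kappa> * apply_cochain d (G n j)" if j: "j \<in> cbas C n" for j
  proof -
    have "const_coeff (entry (F 0 j) b) = (\<Sum>k\<in>supp (G n j). const_coeff (entry (G n j) k) * const_coeff (entry (D 0 k) b))"
      by (simp add: F_def entry_comb const_coeff_sum)
    also have "\<dots> = (\<Sum>k\<in>supp (G n j). const_coeff (entry (G n j) k) * (inverse \<kappa> * entry d k))"
    proof (rule sum.cong[OF refl])
      fix k assume "k \<in> supp (G n j)"
      then have "k \<in> bas P n" using chain_mapD(3)[OF G j] by auto
      then have "const_coeff (entry (D 0 k) b) * \<kappa> = entry d k" using D by (simp add: chain_lift_iff)
      then have "inverse \<kappa> * entry d k = inverse \<kappa> * (const_coeff (entry (D 0 k) b) * \<kappa>)" by simp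
      then have "inverse \<kappa> * entry d k = const_coeff (entry (D 0 k) b)" using aug(1) by simp
      then show "const_coeff (entry (G n j) k) * const_coeff (entry (D 0 k) b) =
          const_coeff (entry (G n j) k) * (inverse \<kappa> * entry d k)" by simp
    qed
    also have "\<dots> = inverse \<kappa> * apply_cochain d (G n j)"
      by (simp add: apply_cochain_def sum_distrib_left mult_ac)
    finally show ?thesis .
  qed
  moreover have "apply_cochain h (G (n + q) i) = apply_cochain L (F q i)" if "i \<in> cbas C (n + q)" for i
  proof -
    have "supp (G (n + q) i) \<subseteq> bas P (n + q)" using that chain_mapD(3)[OF G] by auto
    then show ?thesis unfolding F_def using h(2) by (intro apply_cochain_comb_cochain) auto
  qed
  ultimately show ?thesis using h(1) F by blast
qed

lemma entry_Inl_Inr: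
  "entry (u \<odot> (\<lambda>j. unit_row (Inl j)) :: 'i + 'j \<Rightarrow>\<^sub>0 'a::ring_1) (Inl k) = entry u k"
  "entry (u \<odot> (\<lambda>j. unit_row (Inl j)) :: 'i + 'j \<Rightarrow>\<^sub>0 'a) (Inr k') = 0"
  "entry (v \<odot> (\<lambda>j. unit_row (Inr j)) :: 'i + 'j \<Rightarrow>\<^sub>0 'a) (Inr k') = entry v k'"
  "entry (v \<odot> (\<lambda>j. unit_row (Inr j)) :: 'i + 'j \<Rightarrow>\<^sub>0 'a) (Inl k) = 0"
  by (simp_all add: entry_comb lookup_single when_def if_distrib[of "\<lambda>z. _ * z"] supp_iff cong: if_cong)

end

section \<open>The cohomology of a K2 module\<close>

context trivial_resolution
begin

lemma ideal'_scalar: "p \<in> ideal' X I \<Longrightarrow> sng [] c * p \<in> ideal' X I"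
proof (erule ideal'E)
  fix f g assume *: "p = (\<Sum>x\<in>X. f x * var x) + (\<Sum>x\<in>X. var x * g x)" "f ` X \<subseteq> I" "g ` X \<subseteq> I"
  show "sng [] c * p \<in> ideal' X I"
  proof (rule ideal'I)
    have "sng [] c * (var x * g x) = var x * (sng [] c * g x)" for x
      by (simp add: scalar_commute flip: mult.assoc)
    then show "sng [] c * p = (\<Sum>x\<in>X. (sng [] c * f x) * var x) + (\<Sum>x\<in>X. var x * (sng [] c * g x))"
      by (simp add: * distrib_left sum_distrib_left mult.assoc)
  qed (use * in \<open>auto intro!: mult_left\<close>)
qed

text \<open>
  This is where the rows of \<open>[L\<^sub>n : E\<^sub>n]\<close> enter. Their independence allows one to write a cochain
  of degree \<open>m\<close> as a linear functional \<open>\<phi>\<close> of the rows. The coordinates of \<open>\<phi>\<close> are functionals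
  \<open>\<nu>\<close> on \<open>V\<close>, one for each basis element of \<open>Q\<^sup>n\<^sup>-\<^sup>1\<close>, and \<open>\<mu>\<close> on \<open>I/I'\<close>, one for each basis
  element of \<open>Q\<^sup>n\<^sup>-\<^sup>2\<close>. By the formulas for the classes of degree one and two, the cochain is the
  sum of the products of these classes with the dual basis elements of \<open>Q\<^sup>n\<^sup>-\<^sup>1\<close> and \<open>Q\<^sup>n\<^sup>-\<^sup>2\<close>, which
  by induction come from generated classes of \<open>P\<close>. The chain map \<open>G\<close> may be any one for which
  the claim holds in degree \<open>0\<close>.
\<close>

lemma K2_module_generated:
  assumes Q: "minimal_resolution X I W Q" and LE: "\<And>n. 1 \<le> n \<Longrightarrow> LE_rows_independent X I Q n"
    and I2: "I \<subseteq> tensor_ge2 X"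
    and G: "chain_map X I (complex_of Q) CP 0 G"
    and base: "\<And>m g. g \<in> cochains Q 0 m \<Longrightarrow>
      \<exists>d. yoneda_generated X I P 0 m d \<and> (\<forall>i\<in>bas Q 0. entry g i = apply_cochain d (G 0 i))"
  shows "g \<in> cochains Q n m \<Longrightarrow>
      \<exists>d. yoneda_generated X I P n m d \<and> (\<forall>i\<in>bas Q n. entry g i = apply_cochain d (G n i))"
proof (induction n arbitrary: g m rule: less_induct)
  case (less n)
  show ?case
  proof (cases "n = 0")
    case True
    with base less.prems show ?thesis by simp
  next
    case False
    note Qc = resolution_free_complex[OF Q] and Qm = resolution_minimal[OF Q]
    define S where "S = {i \<in> bas Q n. bdeg Q n i = m}"
    have "finite {i \<in> bas Q n. bdeg Q n i \<le> m}"
      using Q by (auto simp: minimal_resolution_def graded_free_resolution_def)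
    then have S: "finite S" unfolding S_def by (rule rev_finite_subset) auto
    have n: "n = Suc (n - 1)" using False by simp
    define E where "E i = (if 2 \<le> n then mat Q n i \<odot> mat Q (n - 1) else 0)" for i
    \<comment> \<open>The concatenated rows, with the index \<open>Inl\<close> for the block \<open>L\<^sub>n\<close> and \<open>Inr\<close> for \<open>E\<^sub>n\<close>; they
      are lifted to \<open>T(V)\<close>, and \<open>Y\<close> is the space modulo which they are taken.\<close>
    define y :: "nat \<Rightarrow> nat + nat \<Rightarrow>\<^sub>0 ('x, 'k) tensor" where
      "y i = mat Q n i \<odot> (\<lambda>j. unit_row (Inl j)) + E i \<odot> (\<lambda>k. unit_row (Inr k))" for i
    have y: "entry (y i) (Inl j) = entry (mat Q n i) j" "entry (y i) (Inr k) = entry (E i) k" for i j k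
      by (simp_all add: y_def lookup_add entry_Inl_Inr)
    define Y where "Y = {u :: nat + nat \<Rightarrow>\<^sub>0 ('x, 'k) tensor.
        (\<forall>j. entry u (Inl j) \<in> tensor_ge2 X) \<and> (\<forall>k. entry u (Inr k) \<in> ideal' X I)}"
    note ge2 = two_sided_ideal_closed[OF two_sided_ideal_tensor_ge2[of X, where ?'k = 'k]]
      and id' = add_subgroup_ideal'[OF add_subgroup_I, of X]
    have Y: "row_space.subspace Y"
      unfolding row_space.subspace_def
      by (auto simp: Y_def lookup_add ideal'_scalar
          intro: add_subgroupD(1,4)[OF ge2(3)] add_subgroupD(1,4)[OF id'] ge2(1))
    have Mh: "mat Q n i \<in> hrow X (bas Q (n - 1)) (bdeg Q (n - 1)) (bdeg Q n i)" if "i \<in> bas Q n" for i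
      using free_complexD(1)[OF Qc, of i "n - 1"] that n by simp
    have Esupp: "supp (E i) \<subseteq> bas Q (n - 2)" "entries_in I (E i)" if "2 \<le> n" "i \<in> bas Q n" for i
    proof -
      obtain k where k: "n = Suc (Suc k)" using \<open>2 \<le> n\<close> by (metis Suc_le_D numeral_2_eq_2 Suc_le_mono)
      have i: "i \<in> cbas (complex_of Q) (Suc (Suc k))" using \<open>i \<in> bas Q n\<close> k by simp
      show "entries_in I (E i)" using free_complexD(2)[OF Qc i] by (simp add: E_def k)
      show "supp (E i) \<subseteq> bas Q (n - 2)"
        using hrowD(1)[OF chains_diff[OF Qc free_complexD(1)[OF Qc i]]] by (simp add: E_def k)
    qed
    have ind: "\<forall>i\<in>S. c i = 0" if c: "(\<Sum>i\<in>S. scalar_mult (c i) (y i)) \<in> Y" for c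
    proof -
      define cc where "cc = cochain_on S c"
      have cc: "entry cc i = (if i \<in> S then c i else 0)" for i
        unfolding cc_def by (rule entry_cochain_on[OF S])
      have cc_supp: "supp cc \<subseteq> S" by (auto simp: supp_iff cc split: if_splits)
      have sc: "entry (scalar_row cc) i = sng [] (entry cc i)" for i
        by (simp add: scalar_row_def map.rep_eq when_def)
      have sc_supp: "supp (scalar_row cc) \<subseteq> S" by (auto simp: supp_iff sc cc split: if_splits)
      have comb: "scalar_row cc \<star> M = (\<Sum>i\<in>S. scalar_mult (c i) (M i))" for M
        unfolding row_mult_eq by (subst comb_superset[OF S sc_supp]) (simp add: sc cc)
      have SQ: "S \<subseteq> bas Q n" by (auto simp: S_def)
      have "(\<Sum>i\<in>S. scalar_mult (c i) (mat Q n i)) \<in> rows (tensor_ge2 X) (bas Q (n - 1))"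
      proof -
        have "supp (\<Sum>i\<in>S. scalar_mult (c i) (mat Q n i)) \<subseteq> bas Q (n - 1)"
          unfolding comb[symmetric] row_mult_eq
          using sc_supp SQ hrowD(1)[OF Mh] by (intro supp_comb) blast
        moreover have "entry (\<Sum>i\<in>S. scalar_mult (c i) (mat Q n i)) j \<in> tensor_ge2 X" for j
        proof -
          have "entry (\<Sum>i\<in>S. scalar_mult (c i) (mat Q n i)) j = entry (\<Sum>i\<in>S. scalar_mult (c i) (y i)) (Inl j)"
            by (simp add: lookup_sum y)
          with c show ?thesis by (simp add: Y_def)
        qed
        ultimately show ?thesis by (simp add: rows_iff add_subgroupD(1)[OF ge2(3)] entries_in_def)
      qed
      moreover have "(\<Sum>i\<in>S. scalar_mult (c i) (E i)) \<in> rows (ideal' X I) (bas Q (n - 2))" if "2 \<le> n"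
      proof -
        have "supp (\<Sum>i\<in>S. scalar_mult (c i) (E i)) \<subseteq> bas Q (n - 2)"
          unfolding comb[symmetric] row_mult_eq
          using sc_supp SQ Esupp(1)[OF that] by (intro supp_comb) blast
        moreover have "entry (\<Sum>i\<in>S. scalar_mult (c i) (E i)) j \<in> ideal' X I" for j
        proof -
          have "entry (\<Sum>i\<in>S. scalar_mult (c i) (E i)) j = entry (\<Sum>i\<in>S. scalar_mult (c i) (y i)) (Inr j)"
            by (simp add: lookup_sum y)
          with c show ?thesis by (simp add: Y_def)
        qed
        ultimately show ?thesis by (simp add: rows_iff add_subgroupD(1)[OF id'] entries_in_def)
      qed
      moreover have "mat_mult (mat Q n) (mat Q (n - 1)) = E" if "2 \<le> n"
        using that by (simp add: mat_mult_def E_def[abs_def] row_mult_eq)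
      ultimately have "supp cc \<subseteq> bas Q n \<and> scalar_row cc \<star> mat Q n \<in> rows (tensor_ge2 X) (bas Q (n - 1)) \<and>
          (n \<ge> 2 \<longrightarrow> scalar_row cc \<star> mat_mult (mat Q n) (mat Q (n - 1)) \<in> rows (ideal' X I) (bas Q (n - 2)))"
        using cc_supp SQ by (simp add: comb)
      moreover have "LE_rows_independent X I Q n" using LE[of n] False by simp
      ultimately have "cc = 0" unfolding LE_rows_independent_def by blast
      then show ?thesis using cc by (metis lookup_zero)
    qed
    obtain \<phi> where \<phi>: "\<And>u v. \<phi> (u + v) = \<phi> u + \<phi> v" "\<And>c u. \<phi> (scalar_mult c u) = c * \<phi> u"
      "\<And>u. u \<in> Y \<Longrightarrow> \<phi> u = 0" "\<And>i. i \<in> S \<Longrightarrow> \<phi> (y i) = entry g i"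
    proof (rule row_space.functional_extension[OF S Y ind, where g = "entry g"])
      fix \<phi> :: "(nat + nat \<Rightarrow>\<^sub>0 ('x, 'k) tensor) \<Rightarrow> 'k"
      assume \<phi>: "\<And>u v. \<phi> (u + v) = \<phi> u + \<phi> v" "\<And>c u. \<phi> (scalar_mult c u) = c * \<phi> u"
        "\<And>u. u \<in> Y \<Longrightarrow> \<phi> u = 0" "\<And>i. i \<in> S \<Longrightarrow> \<phi> (y i) = entry g i"
      show thesis by (rule that[of \<phi>]) (fact \<phi>)+
    qed
    define \<nu> where "\<nu> j p = \<phi> (sng (Inl j) p)" for j p
    define \<mu> where "\<mu> k p = \<phi> (sng (Inr k) p)" for k p
    have lin: "linear_functional (\<nu> j)" "linear_functional (\<mu> j)" for j
      unfolding \<nu>_def[abs_def] \<mu>_def[abs_def]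
      by (unfold_locales, simp_all add: single_add \<phi>(1) flip: \<phi>(2))
    have \<nu>0: "\<nu> j p = 0" if "p \<in> tensor_ge2 X" for j p
      unfolding \<nu>_def using that add_subgroupD(1)[OF ge2(3)] add_subgroupD(1)[OF id']
      by (intro \<phi>(3)) (auto simp: Y_def lookup_single when_def)
    have \<mu>0: "\<mu> j p = 0" if "p \<in> ideal' X I" for j p
      unfolding \<mu>_def using that add_subgroupD(1)[OF ge2(3)] add_subgroupD(1)[OF id']
      by (intro \<phi>(3)) (auto simp: Y_def lookup_single when_def)
    have \<phi>_sum: "\<phi> (sum f A) = (\<Sum>x\<in>A. \<phi> (f x))" for f :: "nat \<Rightarrow> _" and A
      using \<phi>(2)[of 0 0] by (induction A rule: infinite_finite_induct) (simp_all add: \<phi>(1))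
    \<comment> \<open>Only finitely many coordinates are involved, since only finitely many basis elements
      have degree \<open>m\<close>.\<close>
    define A where "A = (\<Union>i\<in>S. supp (mat Q n i))"
    define B where "B = (if 2 \<le> n then (\<Union>i\<in>S. supp (E i)) else {})"
    have fin: "finite A" "finite B" using S by (auto simp: A_def B_def)
    have AQ: "A \<subseteq> bas Q (n - 1)" using hrowD(1)[OF Mh] by (fastforce simp: A_def S_def)
    have BQ: "B \<subseteq> bas Q (n - 2)" unfolding B_def S_def using Esupp(1) by (cases "2 \<le> n") (simp_all add: UN_subset_iff)
    have g_eq: "entry g i = (\<Sum>j\<in>A. \<nu> j (entry (mat Q n i) j)) + (\<Sum>k\<in>B. \<mu> k (entry (E i) k))" if i: "i \<in> S" for i
    proof -
      have "mat Q n i \<odot> (\<lambda>j. unit_row (Inl j)) = (\<Sum>j\<in>A. sng (Inl j) (entry (mat Q n i) j) :: nat + nat \<Rightarrow>\<^sub>0 ('x, 'k) tensor)"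
        using i by (subst comb_superset[OF fin(1)]) (auto simp: A_def)
      moreover have "E i \<odot> (\<lambda>j. unit_row (Inr j)) = (\<Sum>j\<in>B. sng (Inr j) (entry (E i) j) :: nat + nat \<Rightarrow>\<^sub>0 ('x, 'k) tensor)"
        using i by (subst comb_superset[OF fin(2)]) (auto simp: B_def E_def)
      ultimately show ?thesis
        using \<phi>(4)[OF i] by (simp add: y_def \<phi>(1) \<phi>_sum \<nu>_def \<mu>_def)
    qed
    have unit: "\<exists>d. yoneda_generated X I P k (bdeg Q k j) d \<and>
        (\<forall>i\<in>bas Q k. apply_cochain d (G k i) = (if i = j then 1 else 0))"
      if "k < n" "j \<in> bas Q k" for k j
    proof -
      have "sng j 1 \<in> cochains Q k (bdeg Q k j)" using that(2) by (simp add: cochains_def)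
      from less.IH[OF that(1) this] obtain d where d: "yoneda_generated X I P k (bdeg Q k j) d"
        "\<And>i. i \<in> bas Q k \<Longrightarrow> (if j = i then 1 else 0) = apply_cochain d (G k i)"
        by (auto simp: lookup_single when_def)
      have "apply_cochain d (G k i) = (if i = j then 1 else 0)" if "i \<in> bas Q k" for i
        using d(2)[OF that] by (auto split: if_splits)
      with d(1) show ?thesis by blast
    qed
    have first: "\<exists>h. yoneda_generated X I P n m h \<and>
        (\<forall>i\<in>S. apply_cochain h (G n i) = inverse \<kappa> * \<nu> j (entry (mat Q n i) j))" if j: "j \<in> A" for j
    proof -
      obtain d where d: "yoneda_generated X I P (n - 1) (bdeg Q (n - 1) j) d"
          "\<And>i. i \<in> bas Q (n - 1) \<Longrightarrow> apply_cochain d (G (n - 1) i) = (if i = j then 1 else 0)"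
        using unit[of "n - 1" j] j AQ n by auto
      obtain h F where "yoneda_generated X I P (n - 1 + 1) (bdeg Q (n - 1) j + (m - bdeg Q (n - 1) j)) h \<and>
          chain_map X I (shift (n - 1) (complex_of Q)) CP (bdeg Q (n - 1) j) F \<and>
          (\<forall>j\<in>cbas (complex_of Q) (n - 1).
            const_coeff (entry (F 0 j) b) = inverse \<kappa> * apply_cochain d (G (n - 1) j)) \<and>
          (\<forall>i\<in>cbas (complex_of Q) (n - 1 + 1). apply_cochain h (G (n - 1 + 1) i) =
            apply_cochain (class1 (\<nu> j) (m - bdeg Q (n - 1) j)) (F 1 i))"
        using product_along[OF Qc G d(1) class_generated(1)[of "m - bdeg Q (n - 1) j" "\<nu> j"]]
        by (elim exE)
      then have h: "yoneda_generated X I P (n - 1 + 1) (bdeg Q (n - 1) j + (m - bdeg Q (n - 1) j)) h"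
        "chain_map X I (shift (n - 1) (complex_of Q)) CP (bdeg Q (n - 1) j) F"
        "\<And>j. j \<in> cbas (complex_of Q) (n - 1) \<Longrightarrow>
          const_coeff (entry (F 0 j) b) = inverse \<kappa> * apply_cochain d (G (n - 1) j)"
        "\<And>i. i \<in> cbas (complex_of Q) (n - 1 + 1) \<Longrightarrow> apply_cochain h (G (n - 1 + 1) i) =
          apply_cochain (class1 (\<nu> j) (m - bdeg Q (n - 1) j)) (F 1 i)"
        by simp_all
      have n1: "n - 1 + 1 = n" using n by simp
      have "apply_cochain h (G n i) = inverse \<kappa> * \<nu> j (entry (mat Q n i) j)" if i: "i \<in> S" for i
      proof -
        have i': "i \<in> cbas (shift (n - 1) (complex_of Q)) 1"
          "cdeg (shift (n - 1) (complex_of Q)) 1 i = bdeg Q (n - 1) j + (m - bdeg Q (n - 1) j)"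
          using i n by (auto simp: S_def)
        have "apply_cochain h (G n i) = apply_cochain (class1 (\<nu> j) (m - bdeg Q (n - 1) j)) (F 1 i)"
          using h(4)[of i] i n1 by (simp add: S_def)
        also have "\<dots> = (\<Sum>j'\<in>supp (mat Q n i). \<nu> j (entry (mat Q n i) j') * const_coeff (entry (F 0 j') b))"
          using class1_eval[OF lin(1) \<nu>0 I2 shift_complex(1)[OF Qc] shift_complex(2)[OF Qm] h(2) i'] n by simp
        also have "\<dots> = (\<Sum>j'\<in>supp (mat Q n i). if j' = j then inverse \<kappa> * \<nu> j (entry (mat Q n i) j) else 0)"
        proof (rule sum.cong[OF refl])
          fix j' assume "j' \<in> supp (mat Q n i)"
          then have "j' \<in> bas Q (n - 1)" using hrowD(1)[OF Mh] i by (auto simp: S_def)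
          then show "\<nu> j (entry (mat Q n i) j') * const_coeff (entry (F 0 j') b) =
              (if j' = j then inverse \<kappa> * \<nu> j (entry (mat Q n i) j) else 0)"
            using h(3)[of j'] d(2)[of j'] by simp
        qed
        also have "\<dots> = inverse \<kappa> * \<nu> j (entry (mat Q n i) j)"
          using linear_functional.zero[OF lin(1)] by (simp add: supp_iff)
        finally show ?thesis .
      qed
      then show ?thesis using h(1) n1 by auto
    qed
    have second: "\<exists>h. yoneda_generated X I P n m h \<and>
        (\<forall>i\<in>S. apply_cochain h (G n i) = inverse \<kappa> * \<mu> j (entry (E i) j))" if j: "j \<in> B" for j
    proof -
      have n2: "2 \<le> n" using j by (auto simp: B_def split: if_splits)
      then have n2': "n - 2 + 2 = n" "n - Suc 0 = Suc (n - 2)" "n = Suc (Suc (n - 2))" by simp_all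
      obtain d where d: "yoneda_generated X I P (n - 2) (bdeg Q (n - 2) j) d"
          "\<And>i. i \<in> bas Q (n - 2) \<Longrightarrow> apply_cochain d (G (n - 2) i) = (if i = j then 1 else 0)"
        using unit[of "n - 2" j] j BQ n2 by auto
      obtain h F where "yoneda_generated X I P (n - 2 + 2) (bdeg Q (n - 2) j + (m - bdeg Q (n - 2) j)) h \<and>
          chain_map X I (shift (n - 2) (complex_of Q)) CP (bdeg Q (n - 2) j) F \<and>
          (\<forall>j\<in>cbas (complex_of Q) (n - 2).
            const_coeff (entry (F 0 j) b) = inverse \<kappa> * apply_cochain d (G (n - 2) j)) \<and>
          (\<forall>i\<in>cbas (complex_of Q) (n - 2 + 2). apply_cochain h (G (n - 2 + 2) i) =
            apply_cochain (class2 (\<mu> j) (m - bdeg Q (n - 2) j)) (F 2 i))"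
        using product_along[OF Qc G d(1) class_generated(2)[of "m - bdeg Q (n - 2) j" "\<mu> j"]]
        by (elim exE)
      then have h: "yoneda_generated X I P (n - 2 + 2) (bdeg Q (n - 2) j + (m - bdeg Q (n - 2) j)) h"
        "chain_map X I (shift (n - 2) (complex_of Q)) CP (bdeg Q (n - 2) j) F"
        "\<And>j. j \<in> cbas (complex_of Q) (n - 2) \<Longrightarrow>
          const_coeff (entry (F 0 j) b) = inverse \<kappa> * apply_cochain d (G (n - 2) j)"
        "\<And>i. i \<in> cbas (complex_of Q) (n - 2 + 2) \<Longrightarrow> apply_cochain h (G (n - 2 + 2) i) =
          apply_cochain (class2 (\<mu> j) (m - bdeg Q (n - 2) j)) (F 2 i)"
        by simp_all
      have "apply_cochain h (G n i) = inverse \<kappa> * \<mu> j (entry (E i) j)" if i: "i \<in> S" for i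
      proof -
        have i': "i \<in> cbas (shift (n - 2) (complex_of Q)) 2"
          "cdeg (shift (n - 2) (complex_of Q)) 2 i = bdeg Q (n - 2) j + (m - bdeg Q (n - 2) j)"
          using i n2'(1) by (auto simp: S_def)
        have Ei: "cdiff (shift (n - 2) (complex_of Q)) 1 i \<odot> cdiff (shift (n - 2) (complex_of Q)) 0 = E i"
          using n2 n2'(2) n2'(3)[symmetric] by (simp add: E_def)
        have "apply_cochain h (G n i) = apply_cochain (class2 (\<mu> j) (m - bdeg Q (n - 2) j)) (F 2 i)"
          using h(4)[of i] i n2'(1) by (simp add: S_def)
        also have "\<dots> = (\<Sum>j'\<in>supp (E i). \<mu> j (entry (E i) j') * const_coeff (entry (F 0 j') b))"
          using class2_eval[OF lin(2) \<mu>0 shift_complex(1)[OF Qc] shift_complex(2)[OF Qm] h(2) i'] unfolding Ei .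
        also have "\<dots> = (\<Sum>j'\<in>supp (E i). if j' = j then inverse \<kappa> * \<mu> j (entry (E i) j) else 0)"
        proof (rule sum.cong[OF refl])
          fix j' assume "j' \<in> supp (E i)"
          then have "j' \<in> bas Q (n - 2)" using Esupp(1)[OF n2] i by (auto simp: S_def)
          then show "\<mu> j (entry (E i) j') * const_coeff (entry (F 0 j') b) =
              (if j' = j then inverse \<kappa> * \<mu> j (entry (E i) j) else 0)"
            using h(3)[of j'] d(2)[of j'] by simp
        qed
        also have "\<dots> = inverse \<kappa> * \<mu> j (entry (E i) j)"
          using linear_functional.zero[OF lin(2)] by (simp add: supp_iff)
        finally show ?thesis .
      qed
      then show ?thesis using h(1) n2'(1) by auto
    qed
    obtain h where h: "\<And>j. j \<in> A \<Longrightarrow> yoneda_generated X I P n m (h j)"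
        "\<And>j i. j \<in> A \<Longrightarrow> i \<in> S \<Longrightarrow> apply_cochain (h j) (G n i) = inverse \<kappa> * \<nu> j (entry (mat Q n i) j)"
      using first by metis
    obtain h' where h': "\<And>j. j \<in> B \<Longrightarrow> yoneda_generated X I P n m (h' j)"
        "\<And>j i. j \<in> B \<Longrightarrow> i \<in> S \<Longrightarrow> apply_cochain (h' j) (G n i) = inverse \<kappa> * \<mu> j (entry (E i) j)"
      using second by metis
    \<comment> \<open>The factor undoes the normalization by \<open>inverse \<kappa>\<close> in the products.\<close>
    define d where "d = Poly_Mapping.map ((*) \<kappa>) (sum h A + sum h' B)"
    have d: "yoneda_generated X I P n m d"
      unfolding d_def by (intro yoneda_generated.scale yoneda_generated.add generated_sum h(1) h'(1))
    moreover have "entry g i = apply_cochain d (G n i)" if i: "i \<in> bas Q n" for i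
    proof (cases "i \<in> S")
      case True
      then show ?thesis
        using aug(1) by (simp add: d_def apply_cochain_scale_left apply_cochain_add_left
            apply_cochain_sum_left h(2) h'(2) g_eq distrib_left flip: sum_distrib_left mult.assoc)
    next
      case False
      then have "bdeg Q n i \<noteq> m" using i by (simp add: S_def)
      moreover have "G n i \<in> hrow X (bas P n) (bdeg P n) (bdeg Q n i)"
        using chain_mapD(1)[OF G, of i n] i by simp
      ultimately have "apply_cochain d (G n i) = 0"
        using apply_cochain_degree[OF generated_cochain[OF d]] by blast
      moreover have "entry g i = 0" using less.prems \<open>bdeg Q n i \<noteq> m\<close> by (auto simp: cochains_iff)
      ultimately show ?thesis by simp
    qed
    ultimately show ?thesis by blast
  qed
qed

end

section \<open>Dimension shifting along a syzygy\<close>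

context graded_ideal
begin

lemma chain_map_diff:
  assumes "chain_map X I C D m F" "chain_map X I C D m G"
  shows "chain_map X I C D m (\<lambda>n i. F n i - G n i)"
  unfolding chain_map_def
proof (intro conjI allI ballI)
  show "F n i - G n i \<in> chains X D n (cdeg C n i - m)" if "i \<in> cbas C n" for n i
    using chain_mapD(1)[OF assms(1) that] chain_mapD(1)[OF assms(2) that] by (rule hrow_simps(2))
  show "entries_in I ((F (Suc n) i - G (Suc n) i) \<odot> cdiff D n - cdiff C n i \<odot> (\<lambda>i. F n i - G n i))"
    if "i \<in> cbas C (Suc n)" for n i
    using entries_I(2)[OF chain_mapD(2)[OF assms(1) that] chain_mapD(2)[OF assms(2) that]]
    by (simp add: comb_diff comb_diff_right algebra_simps)
qed

lemma chain_map_id: "chain_map X I C C 0 (\<lambda>n. unit_row)"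
  by (auto simp: chain_map_def entries_I)

lemma neg_free_complex: "free_complex X I R \<Longrightarrow> free_complex X I (neg_complex R)"
  by (auto simp: free_complex_def comb_uminus comb_uminus_right intro: hrow_simps)

end

text \<open>
  In degree \<open>0\<close> of a cone, where the index \<open>j\<close> can only be the generator of \<open>Q\<^sup>0\<close>, this is the
  augmentation to the free module on \<open>U\<close>.
\<close>

definition augment :: "('j \<times> 'u) + 'r \<Rightarrow> ('u \<Rightarrow>\<^sub>0 'a::ring_1)" where
  "augment x = (case x of Inl (j, u) \<Rightarrow> unit_row u | Inr k \<Rightarrow> 0)"

lemma augment_simps [simp]: "augment (Inl (j, u)) = unit_row u" "augment (Inr k) = 0"
  by (simp_all add: augment_def)

lemma augment_entries: "add_subgroup C \<Longrightarrow> entries_in C w \<Longrightarrow> entries_in C (w \<odot> augment)"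
  by (rule entries_in_comb_01)
    (auto simp: entries_in_def augment_def lookup_single when_def split: sum.split)

lemma inl_entries': "add_subgroup C \<Longrightarrow> entries_in C w \<Longrightarrow> entries_in C (w \<odot> (\<lambda>u. inl u j))"
  by (rule entries_in_comb_01) (auto simp: entries_in_def inl_def lookup_single when_def)

text \<open>
  Let \<open>A = T(V)/I\<close> and \<open>B = T(V)/J\<close>. A short exact sequence \<open>0 \<rightarrow> N' \<rightarrow> F \<rightarrow> F/Z \<rightarrow> 0\<close> of
  \<open>B\<close>-modules is given, in which \<open>F\<close> is free on \<open>U\<close> and \<open>N'\<close> is generated by the rows of the
  matrix \<open>N\<close>, indexed by \<open>V\<close>. The complexes \<open>Q\<close>, \<open>RU\<close> and \<open>RV\<close> are \<open>A\<close>-resolutions of \<open>B\<close>, of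
  \<open>F/Z\<close> and of \<open>N'\<close>.
\<close>

locale syzygy_step = graded_ideal X I for X :: "'x set" and I :: "('x, 'k::field) tensor set" +
  fixes J :: "('x, 'k) tensor set" and Q RU RV :: "(nat, 'x, 'k) gcomplex" and b :: nat
    and U V :: "nat set" and dg dgV :: "nat \<Rightarrow> int" and N :: "nat \<Rightarrow> nat \<Rightarrow>\<^sub>0 ('x, 'k) tensor"
    and Z :: "(nat \<Rightarrow>\<^sub>0 ('x, 'k) tensor) set"
  assumes J: "two_sided_ideal X J" "I \<subseteq> J"
    and Q: "free_complex X I Q" "minimal_complex X Q" "acyclic_over X I Q (entries_in J)"
      "cbas Q 0 = {b}" "cdeg Q 0 b = 0" "\<And>i. i \<in> cbas Q 1 \<Longrightarrow> entries_in J (cdiff Q 0 i)"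
    and RU: "free_complex X I RU" "minimal_complex X RU" "acyclic_over X I RU (\<lambda>u. u \<in> Z)"
      "cbas RU 0 = U" "cdeg RU 0 = dg" "\<And>i. i \<in> cbas RU 1 \<Longrightarrow> cdiff RU 0 i \<in> Z"
    and RV: "free_complex X I RV" "acyclic_over X I RV (\<lambda>v. entries_in J (v \<odot> N))"
      "cbas RV 0 = V" "cdeg RV 0 = dgV" "\<And>i. i \<in> cbas RV 1 \<Longrightarrow> entries_in J (cdiff RV 0 i \<odot> N)"
      "\<And>n. locally_finite (cbas RV n) (cdeg RV n)"
    and N: "\<And>v. v \<in> V \<Longrightarrow> N v \<in> hrow X U dg (dgV v)" "\<And>v. v \<in> V \<Longrightarrow> N v \<in> Z"
    and Z: "\<And>u. supp u \<subseteq> U \<Longrightarrow> entries_in J u \<Longrightarrow> u \<in> Z"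
      "\<And>u e. u \<in> hrow X U dg e \<Longrightarrow> u \<in> Z \<Longrightarrow> \<exists>v\<in>hrow X V dgV e. entries_in J (u - v \<odot> N)"
begin

lemma J_subgroup: "add_subgroup J" by (rule two_sided_ideal_closed(3)[OF J(1)])

abbreviation sec :: "nat \<Rightarrow> (nat \<times> nat) + nat \<Rightarrow>\<^sub>0 ('x, 'k) tensor" where "sec u \<equiv> inl u b"

lemma sec_augment: "u \<odot> sec \<odot> augment = u"
  by (simp add: comb_assoc inl_def)

lemma augment_sec:
  assumes "w \<in> chains X (copies Q U dg) 0 e"
  shows "w \<odot> augment \<odot> sec = w"
proof -
  have "w \<odot> augment \<odot> sec = w \<odot> (\<lambda>x. augment x \<odot> sec)" by (rule comb_assoc)
  also have "\<dots> = w \<odot> unit_row"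
  proof (rule comb_cong)
    fix x assume "x \<in> supp w"
    then obtain u where "x = Inl (b, u)" using hrowD(1)[OF assms] Q(4) by fastforce
    then show "augment x \<odot> sec = unit_row x" by (simp add: inl_def)
  qed
  finally show ?thesis by simp
qed

text \<open>
  The long exact sequence of \<open>Ext\<^sub>A(-, K)\<close> for that short exact sequence, in terms of cochains.
  Copies of \<open>Q\<close> resolve \<open>F\<close>; the cone of a lift \<open>\<sigma>\<close> of the inclusion of \<open>N'\<close> resolves \<open>F/Z\<close>, as
  does \<open>RU\<close>. Hence there are chain maps \<open>\<alpha>\<close> to the cone and \<open>\<beta>\<close> back, and \<open>\<alpha> \<beta>\<close> is the identity
  for cochains. The component of \<open>\<alpha>\<close> in \<open>RV\<close> is the connecting map \<open>\<delta>\<close>, and the restriction of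
  \<open>\<beta>\<close> to the copy of \<open>Q\<close> at \<open>u\<close> is the map \<open>\<pi> u\<close>. The last two conclusions are exactness: a
  class on \<open>F/Z\<close> that vanishes on \<open>F\<close> comes from \<open>N'\<close> along \<open>\<delta>\<close>.
\<close>

lemma dimension_shift:
  obtains \<delta> \<pi> where
    "chain_map X I (shift 1 RU) RV 0 \<delta>"
    "\<And>i. i \<in> cbas RU 1 \<Longrightarrow> entries_in J (\<delta> 0 i \<odot> N - cdiff RU 0 i)"
    "\<And>u. u \<in> U \<Longrightarrow> chain_map X I Q RU (- dg u) (\<pi> u)"
    "\<And>u. \<pi> u 0 b = unit_row u"
    "\<And>f i. (\<And>u j. u \<in> U \<Longrightarrow> j \<in> cbas Q 0 \<Longrightarrow> apply_cochain f (\<pi> u 0 j) = 0) \<Longrightarrow>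
      i \<in> cbas RU 0 \<Longrightarrow> entry f i = 0"
    "\<And>f n m. (\<And>u j. u \<in> U \<Longrightarrow> j \<in> cbas Q (Suc n) \<Longrightarrow> apply_cochain f (\<pi> u (Suc n) j) = 0) \<Longrightarrow>
      (\<And>i. entry f i \<noteq> 0 \<Longrightarrow> cdeg RU (Suc n) i = m) \<Longrightarrow>
      \<exists>h. (\<forall>i. entry h i \<noteq> 0 \<longrightarrow> i \<in> cbas RV n \<and> cdeg RV n i = m) \<and>
        (\<forall>i\<in>cbas RU (Suc n). entry f i = apply_cochain h (\<delta> n i))"
proof -
  let ?QU = "copies Q U dg :: ((nat \<times> nat) + nat, 'x, 'k) gcomplex"
  note QU = copies_free_complex[OF Q(1), of U dg] copies_acyclic[OF Q(3) J_subgroup, of U dg]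
  have sec: "sec u \<in> chains X ?QU 0 (dg u)" if "u \<in> U" for u
    using inl_hrow[of b Q 0 u U X dg] that Q(4,5) by simp
  \<comment> \<open>Lift the inclusion of the syzygy, with a sign that makes the cone a complex.\<close>
  define \<sigma>0 where "\<sigma>0 v = N v \<odot> sec" for v
  obtain \<sigma> where \<sigma>0: "\<sigma> 0 = \<sigma>0" and \<sigma>: "chain_map X I (neg_complex RV) ?QU 0 \<sigma>"
  proof (rule lift_chain_map[OF neg_free_complex[OF RV(1)] QU, of \<sigma>0 0])
    show "\<sigma>0 v \<in> chains X ?QU 0 (cdeg (neg_complex RV) 0 v - 0)" if "v \<in> cbas (neg_complex RV) 0" for v
      unfolding \<sigma>0_def using that RV(3,4) hrow_comb0[OF N(1) sec] by simp
    show "entries_in J (cdiff (neg_complex RV) 0 i \<odot> \<sigma>0)" if "i \<in> cbas (neg_complex RV) 1" for i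
    proof -
      have "entries_in J (- (cdiff RV 0 i \<odot> N \<odot> sec))"
        using RV(5) that by (intro entries_in_simps(3)[OF J_subgroup] inl_entries' J_subgroup) simp
      then show ?thesis by (simp add: \<sigma>0_def[abs_def] comb_assoc comb_uminus)
    qed
  qed blast
  let ?C = "cone Q U dg RV \<sigma>"
  have C: "free_complex X I ?C" by (rule cone_free_complex[OF Q(1) RV(1) \<sigma>])
  have C_acyclic: "acyclic_over X I ?C (\<lambda>w. w \<odot> augment \<in> Z)"
  proof (rule cone_acyclic[OF Q(1,3,6) RV(1,2) \<sigma> J])
    fix w e assume w: "w \<in> chains X ?QU 0 e" "w \<odot> augment \<in> Z"
    have "w \<odot> augment \<in> hrow X U dg e"
      using Q(4,5) by (intro hrow_comb0[OF w(1)]) auto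
    then obtain v where v: "v \<in> hrow X V dgV e" "entries_in J (w \<odot> augment - v \<odot> N)" using Z(2) w(2) by blast
    have eq: "(w \<odot> augment - v \<odot> N) \<odot> sec = w - v \<odot> \<sigma> 0"
      unfolding comb_diff augment_sec[OF w(1)] by (simp add: \<sigma>0 \<sigma>0_def[abs_def] comb_assoc)
    show "\<exists>v\<in>chains X RV 0 e. entries_in J (w - v \<odot> \<sigma> 0)"
    proof (intro bexI)
      have "entries_in J ((w \<odot> augment - v \<odot> N) \<odot> sec)" by (rule inl_entries'[OF J_subgroup v(2)])
      then show "entries_in J (w - v \<odot> \<sigma> 0)" by (simp only: eq)
      show "v \<in> chains X RV 0 e" using v(1) RV(3,4) by simp
    qed
  next
    fix v e assume "v \<in> chains X RV 0 e" "entries_in J (v \<odot> \<sigma> 0)"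
    then have "entries_in J (v \<odot> N \<odot> sec \<odot> augment)"
      by (intro augment_entries J_subgroup) (simp add: \<sigma>0 \<sigma>0_def[abs_def] comb_assoc)
    then show "entries_in J (v \<odot> N)" by (simp only: sec_augment)
  qed
  have C1: "cdiff ?C 0 (Inr k) \<odot> augment = N k" for k
    by (simp add: \<sigma>0 \<sigma>0_def sec_augment)
  have C1': "entries_in J (cdiff ?C 0 (Inl (j, u)) \<odot> augment)" if "j \<in> cbas Q 1" for j u
    using Q(6)[OF that] by (auto intro!: augment_entries inl_entries J_subgroup)
  have C1_supp: "supp (cdiff ?C 0 x \<odot> augment) \<subseteq> U" if "x \<in> cbas ?C 1" for x
  proof (rule supp_comb)
    fix y assume "y \<in> supp (cdiff ?C 0 x)"
    then have "y \<in> cbas ?C 0" using free_complexD(3)[OF C, of x 0] that by auto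
    then show "supp (augment y :: nat \<Rightarrow>\<^sub>0 ('x, 'k) tensor) \<subseteq> U" by auto
  qed
  obtain \<beta> where \<beta>0: "\<beta> 0 = augment" and \<beta>: "chain_map X I ?C RU 0 \<beta>"
  proof (rule lift_chain_map[OF C RU(1,3), of augment 0])
    show "augment x \<in> chains X RU 0 (cdeg ?C 0 x - 0)" if "x \<in> cbas ?C 0" for x
      using that RU(4,5) Q(4,5) by auto
    show "cdiff ?C 0 x \<odot> augment \<in> Z" if "x \<in> cbas ?C 1" for x
    proof (cases x)
      case (Inl y)
      then obtain j u where "x = Inl (j, u)" "j \<in> cbas Q 1" using \<open>x \<in> cbas ?C 1\<close> by auto
      then show ?thesis using Z(1)[OF C1_supp[OF that]] C1' by blast
    next
      case (Inr k)
      then show ?thesis using N(2) RV(3) that C1[of k] by auto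
    qed
  qed blast
  obtain \<alpha> where \<alpha>0: "\<alpha> 0 = sec" and \<alpha>: "chain_map X I RU ?C 0 \<alpha>"
  proof (rule lift_chain_map[OF RU(1) C C_acyclic, of sec 0])
    show "sec u \<in> chains X ?C 0 (cdeg RU 0 u - 0)" if "u \<in> cbas RU 0" for u
    proof -
      have "sec u \<in> chains X ?C 0 (dg u)" using sec that RU(4) by (intro subsetD[OF copies_subset_cone]) blast
      then show ?thesis using RU(5) by (simp only: diff_zero)
    qed
    show "cdiff RU 0 i \<odot> sec \<odot> augment \<in> Z" if "i \<in> cbas RU 1" for i
      using RU(6)[OF that] by (simp only: sec_augment)
  qed blast
  have "chain_map X I RU RU 0 (\<lambda>n i. \<alpha> n i \<odot> \<beta> n - unit_row i)"
    using chain_map_diff[OF chain_map_comp[OF RU(1) C \<alpha> \<beta>, simplified] chain_map_id] .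
  then have \<alpha>\<beta>: "entries_in Tp (\<alpha> n i \<odot> \<beta> n - unit_row i)" if "i \<in> cbas RU n" for n i
    using chain_map_vanishes[OF RU(1,2) RU(1,2,3), where F = "\<lambda>n i. \<alpha> n i \<odot> \<beta> n - unit_row i"]
      that Z(1)[of 0] sec_augment[of "unit_row _"]
    by (auto simp: \<alpha>0 \<beta>0 entries_in_simps(1)[OF J_subgroup])
  have f_eq: "entry f i = (\<Sum>x\<in>supp (\<alpha> n i). const_coeff (entry (\<alpha> n i) x) * apply_cochain f (\<beta> n x))"
    if "i \<in> cbas RU n" for f n i
  proof -
    have "apply_cochain f (\<alpha> n i \<odot> \<beta> n - unit_row i) = 0" using apply_cochain_plus[OF \<alpha>\<beta>[OF that]] .
    then show ?thesis by (simp add: apply_cochain_diff apply_cochain_comb)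
  qed
  define \<delta> where "\<delta> n i = \<alpha> (Suc n) i \<odot> prr" for n i
  define \<pi> where "\<pi> u n j = \<beta> n (Inl (j, u))" for u n j
  note c\<alpha> = chain_mapD[OF \<alpha>] and c\<beta> = chain_mapD[OF \<beta>]
  show thesis
  proof (rule that[of \<delta> \<pi>])
    show "chain_map X I (shift 1 RU) RV 0 \<delta>"
      unfolding chain_map_def
    proof (intro conjI allI ballI)
      show "\<delta> n i \<in> chains X RV n (cdeg (shift 1 RU) n i - 0)" if "i \<in> cbas (shift 1 RU) n" for n i
        unfolding \<delta>_def using c\<alpha>(1)[of i "Suc n"] that by (intro cone_chains(2)) simp
      show "entries_in I (\<delta> (Suc n) i \<odot> cdiff RV n - cdiff (shift 1 RU) n i \<odot> \<delta> n)"
        if i: "i \<in> cbas (shift 1 RU) (Suc n)" for n i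
      proof -
        have i': "i \<in> cbas RU (Suc (Suc n))" using i by simp
        have "\<alpha> (Suc (Suc n)) i \<odot> (\<lambda>x. cdiff ?C (Suc n) x \<odot> prr) = \<alpha> (Suc (Suc n)) i \<odot> (\<lambda>x. prr x \<odot> cdiff RV n)"
        proof (rule comb_cong)
          fix x assume "x \<in> supp (\<alpha> (Suc (Suc n)) i)"
          then have x: "x \<in> cbas ?C (Suc (Suc n))" using c\<alpha>(3)[OF i'] by blast
          have prr0: "w \<odot> prr = 0" if "supp w \<subseteq> Inl ` A" for w :: "(nat \<times> nat) + nat \<Rightarrow>\<^sub>0 ('x, 'k) tensor" and A
          proof -
            have "w \<odot> prr = w \<odot> (\<lambda>_. 0)" using that by (intro comb_cong) force
            then show ?thesis by simp
          qed
          show "cdiff ?C (Suc n) x \<odot> prr = prr x \<odot> cdiff RV n"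
          proof (cases x)
            case (Inl y)
            then show ?thesis by (cases y) (simp add: comb_assoc inl_def)
          next
            case (Inr k)
            then have "k \<in> cbas RV (Suc n)" using x by auto
            then have "supp (\<sigma> (Suc n) k) \<subseteq> Inl ` (cbas Q (Suc n) \<times> U)"
              using chain_mapD(3)[OF \<sigma>, of k "Suc n"] by simp
            from prr0[OF this] show ?thesis by (simp add: Inr comb_add comb_assoc inr_def)
          qed
        qed
        then have "(\<alpha> (Suc (Suc n)) i \<odot> cdiff ?C (Suc n) - cdiff RU (Suc n) i \<odot> \<alpha> (Suc n)) \<odot> prr =
            \<delta> (Suc n) i \<odot> cdiff RV n - cdiff (shift 1 RU) n i \<odot> \<delta> n"
          by (simp add: \<delta>_def[abs_def] comb_diff comb_assoc)
        then show ?thesis using pr_entries(2)[OF add_subgroup_I c\<alpha>(2)[OF i']] by simp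
      qed
    qed
    show "entries_in J (\<delta> 0 i \<odot> N - cdiff RU 0 i)" if i: "i \<in> cbas RU 1" for i
    proof -
      have i': "i \<in> cbas RU (Suc 0)" using i by simp
      have "entries_in I ((\<alpha> 1 i \<odot> cdiff ?C 0 - cdiff RU 0 i \<odot> sec) \<odot> augment)"
        using c\<alpha>(2)[OF i'] by (intro augment_entries add_subgroup_I) (simp add: \<alpha>0)
      then have a: "entries_in J (\<alpha> 1 i \<odot> (\<lambda>x. cdiff ?C 0 x \<odot> augment) - cdiff RU 0 i)"
        using entries_in_mono[OF _ J(2)] by (simp add: comb_diff sec_augment comb_assoc[of "\<alpha> _ _"])
      have "entries_in J (\<alpha> 1 i \<odot> (\<lambda>x. cdiff ?C 0 x \<odot> augment - prr x \<odot> N))"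
      proof (rule entries_in_comb[OF J_subgroup, where C = T and D = J])
        show "entries_in T (\<alpha> 1 i)" using c\<alpha>(4)[OF i'] by simp
        show "entries_in J (cdiff ?C 0 x \<odot> augment - prr x \<odot> N)" if "x \<in> supp (\<alpha> 1 i)" for x
        proof (cases x)
          case (Inl y)
          then obtain j u where "x = Inl (j, u)" "j \<in> cbas Q 1" using \<open>x \<in> supp (\<alpha> 1 i)\<close> c\<alpha>(3)[OF i'] by fastforce
          then show ?thesis using C1'[of j u] by simp
        next
          case (Inr k)
          then show ?thesis using C1[of k] entries_in_simps(1)[OF J_subgroup] by simp
        qed
      qed (rule two_sided_ideal_closed(1)[OF J(1)])
      from entries_in_simps(2)[OF J_subgroup a this]
      show ?thesis by (simp add: \<delta>_def comb_diff_right comb_assoc)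
    qed
    show "chain_map X I Q RU (- dg u) (\<pi> u)" if u: "u \<in> U" for u
      unfolding chain_map_def
    proof (intro conjI allI ballI)
      have x: "Inl (j, u) \<in> cbas ?C n" if "j \<in> cbas Q n" for j n using that u by (cases n) auto
      show "\<pi> u n j \<in> chains X RU n (cdeg Q n j - - dg u)" if "j \<in> cbas Q n" for n j
        using c\<beta>(1)[OF x[OF that]] by (simp add: \<pi>_def)
      show "entries_in I (\<pi> u (Suc n) j \<odot> cdiff RU n - cdiff Q n j \<odot> \<pi> u n)" if "j \<in> cbas Q (Suc n)" for n j
        using c\<beta>(2)[OF x[OF that]] by (simp add: \<pi>_def[abs_def] comb_assoc inl_def)
    qed
    show "\<pi> u 0 b = unit_row u" for u by (simp add: \<pi>_def \<beta>0)
    show "entry f i = 0"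
      if f: "\<And>u j. u \<in> U \<Longrightarrow> j \<in> cbas Q 0 \<Longrightarrow> apply_cochain f (\<pi> u 0 j) = 0" and i: "i \<in> cbas RU 0" for f i
    proof -
      have "apply_cochain f (\<beta> 0 x) = 0" if "x \<in> supp (\<alpha> 0 i)" for x
        using that c\<alpha>(3)[OF i] f by (fastforce simp: \<pi>_def)
      then show ?thesis using f_eq[OF i, of f] by simp
    qed
    show "\<exists>h. (\<forall>i. entry h i \<noteq> 0 \<longrightarrow> i \<in> cbas RV n \<and> cdeg RV n i = m) \<and>
        (\<forall>i\<in>cbas RU (Suc n). entry f i = apply_cochain h (\<delta> n i))"
      if f: "\<And>u j. u \<in> U \<Longrightarrow> j \<in> cbas Q (Suc n) \<Longrightarrow> apply_cochain f (\<pi> u (Suc n) j) = 0"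
        and deg: "\<And>i. entry f i \<noteq> 0 \<Longrightarrow> cdeg RU (Suc n) i = m" for f n m
    proof -
      define A where "A = {k \<in> cbas RV n. cdeg RV n k = m}"
      have "finite {k \<in> cbas RV n. cdeg RV n k \<le> m}" using RV(6) by (simp add: locally_finite_def)
      then have A: "finite A" unfolding A_def by (rule rev_finite_subset) auto
      define h where "h = cochain_on A (\<lambda>k. apply_cochain f (\<beta> (Suc n) (Inr k)))"
      have h: "entry h k = apply_cochain f (\<beta> (Suc n) (Inr k))" if "k \<in> cbas RV n" for k
      proof (cases "k \<in> A")
        case False
        have "\<beta> (Suc n) (Inr k) \<in> chains X RU (Suc n) (cdeg RV n k)"
          using c\<beta>(1)[of "Inr k" "Suc n"] that by simp
        moreover have "cdeg RV n k \<noteq> m" using False that by (simp add: A_def)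
        ultimately have "apply_cochain f (\<beta> (Suc n) (Inr k)) = 0"
          using apply_cochain_degree'[of f "cdeg RU (Suc n)" m] deg by blast
        then show ?thesis using False by (simp add: h_def entry_cochain_on[OF A])
      qed (simp add: h_def entry_cochain_on[OF A])
      have "entry f i = apply_cochain h (\<delta> n i)" if i: "i \<in> cbas RU (Suc n)" for i
        unfolding f_eq[OF i] \<delta>_def apply_cochain_comb
      proof (rule sum.cong[OF refl])
        fix x assume "x \<in> supp (\<alpha> (Suc n) i)"
        then have x: "x \<in> cbas ?C (Suc n)" using c\<alpha>(3)[OF i] by blast
        show "const_coeff (entry (\<alpha> (Suc n) i) x) * apply_cochain f (\<beta> (Suc n) x) =
            const_coeff (entry (\<alpha> (Suc n) i) x) * apply_cochain h (prr x)"
          using x f h by (cases x) (auto simp: \<pi>_def)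
      qed
      moreover have "\<forall>i. entry h i \<noteq> 0 \<longrightarrow> i \<in> cbas RV n \<and> cdeg RV n i = m"
        unfolding h_def entry_cochain_on[OF A] by (auto simp: A_def)
      ultimately show ?thesis by blast
    qed
  qed
qed

end

section \<open>From complexes to resolutions\<close>

context graded_ideal
begin

lemma row_comp_entries_P: "entries_in Tp u \<Longrightarrow> entries_in Tp (row_comp dg d u)"
  using hcomp_homs[of _ X] homs_subset
  by (fastforce simp: entries_in_def tensor_plus_def const_coeff_def entry_hcomp)

text \<open>
  Sum up preimages of the finitely many homogeneous components.
\<close>

lemma acyclic_inhomogeneous:
  fixes C :: "('i, 'x, 'k) gcomplex"
  assumes u: "supp u \<subseteq> cbas C n" "entries_in T u"
    and ex: "\<And>e. \<exists>v\<in>chains X C (Suc n) e. entries_in I (row_comp (cdeg C n) e u - v \<odot> cdiff C n)"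
  shows "\<exists>v. supp v \<subseteq> cbas C (Suc n) \<and> entries_in T v \<and> entries_in I (u - v \<odot> cdiff C n)"
proof -
  obtain D where D: "finite D" "(\<Sum>e\<in>D. row_comp (cdeg C n) e u) = u" by (rule row_comp_decompose)
  obtain v where v: "\<And>e. v e \<in> chains X C (Suc n) e"
      "\<And>e. entries_in I (row_comp (cdeg C n) e u - v e \<odot> cdiff C n)"
    using ex by metis
  have "u - sum v D \<odot> cdiff C n = (\<Sum>e\<in>D. row_comp (cdeg C n) e u - v e \<odot> cdiff C n)"
    by (simp add: comb_sum sum_subtractf D(2))
  then have "entries_in I (u - sum v D \<odot> cdiff C n)"
    using v(2) by (simp add: entries_in_sum add_subgroup_I)
  moreover have "entries_in T (sum v D)"
    using hrowD(3)[OF v(1)] by (intro entries_in_sum add_subgroup_tensor_algebra)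
  moreover have "supp (sum v D) \<subseteq> cbas C (Suc n)"
    using order.trans[OF keys_sum[of v D]] hrowD(1)[OF v(1)] by blast
  ultimately show ?thesis by blast
qed

lemma acyclic_kernel:
  fixes C :: "('i, 'x, 'k) gcomplex"
  assumes C: "free_complex X I C" "acyclic_over X I C Z"
    and u: "supp u \<subseteq> cbas C (Suc n)" "entries_in T u" "entries_in I (u \<odot> cdiff C n)"
  shows "\<exists>v. supp v \<subseteq> cbas C (Suc (Suc n)) \<and> entries_in T v \<and> entries_in I (u - v \<odot> cdiff C (Suc n))"
proof (rule acyclic_inhomogeneous[OF u(1,2)])
  fix e
  have "row_comp (cdeg C (Suc n)) e u \<odot> cdiff C n = row_comp (cdeg C n) e (u \<odot> cdiff C n)"
    by (rule row_comp_comb[OF u(1,2), symmetric]) (use free_complexD(1)[OF C(1)] in blast)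
  then have "entries_in I (row_comp (cdeg C (Suc n)) e u \<odot> cdiff C n)"
    using row_comp_entries_I[OF u(3)] by simp
  then show "\<exists>v\<in>chains X C (Suc (Suc n)) e.
      entries_in I (row_comp (cdeg C (Suc n)) e u - v \<odot> cdiff C (Suc n))"
    by (rule acyclic_overD(2)[OF C(2) row_comp_hrow[OF u(1,2)]])
qed

lemma minimal_image:
  assumes "minimal_complex X C" "supp v \<subseteq> cbas C (Suc n)" "entries_in T v" "entries_in I (u - v \<odot> cdiff C n)"
  shows "entries_in Tp u"
proof -
  have "entries_in Tp (v \<odot> cdiff C n)"
    using assms(1-3) by (intro comb_P_right) (auto simp: minimal_complex_def)
  from entries_P(4)[OF entries_I_P[OF assms(4)] this] show ?thesis by simp
qed

text \<open>
  Acyclicity for homogeneous rows extends to all rows by taking components. The constant \<open>\<kappa>\<close> is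
  free so that the augmentation can be made to agree with that of a given resolution over a
  factor algebra.
\<close>

lemma resolution_of_complex:
  fixes C :: "(nat, 'x, 'k) gcomplex"
  assumes C: "free_complex X I C" "minimal_complex X C" "acyclic_over X I C (entries_in Tp)"
    "\<And>n. locally_finite (cbas C n) (cdeg C n)"
    and b: "cbas C 0 = {b}" "cdeg C 0 b = 0" and \<kappa>: "\<kappa> \<noteq> 0"
  shows "minimal_resolution X I (trivial_module X)
    \<lparr>bas = cbas C, bdeg = cdeg C, mat = (\<lambda>n. case n of 0 \<Rightarrow> (\<lambda>_. sng 0 (sng [] \<kappa>)) | Suc k \<Rightarrow> cdiff C k)\<rparr>"
    (is "minimal_resolution X I _ ?P")
proof -
  have inv: "sng [] (inverse \<kappa>) * sng [] \<kappa> = (1 :: ('x, 'k) tensor)" "sng [] \<kappa> * sng [] (inverse \<kappa>) = (1 :: ('x, 'k) tensor)"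
    using \<kappa> by (simp_all add: mult_single plus_list_def one_tensor)
  have P0: "u \<odot> mat ?P 0 = sng 0 (entry u b * sng [] \<kappa>)" if "supp u \<subseteq> {b}" for u
    by (subst comb_superset[OF _ that]) simp_all
  have rels: "sng 0 a \<in> rels (trivial_module X) \<longleftrightarrow> a \<in> Tp" for a
    by (auto simp: trivial_module_def cyclic_module_def rows_iff entries_in_def lookup_single when_def)
  have Z0: "u \<odot> mat ?P 0 \<in> rels (trivial_module X) \<longleftrightarrow> entries_in Tp u"
    if "supp u \<subseteq> {b}" "entries_in T u" for u
  proof
    assume "u \<odot> mat ?P 0 \<in> rels (trivial_module X)"
    then have "entry u b * sng [] \<kappa> \<in> Tp" by (simp only: P0[OF that(1)] rels)
    then have "entry u b * sng [] \<kappa> * sng [] (inverse \<kappa>) \<in> Tp" by (rule mult_tensor_plus) simp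
    then have "entry u b \<in> Tp" by (simp add: mult.assoc inv)
    moreover have "entry u i = 0" if "i \<noteq> b" for i
      using \<open>supp u \<subseteq> {b}\<close> that by (auto simp: supp_iff)
    ultimately show "entries_in Tp u" unfolding entries_in_def by (metis zero_mem_graded(3))
  next
    assume "entries_in Tp u"
    then show "u \<odot> mat ?P 0 \<in> rels (trivial_module X)"
      unfolding P0[OF that(1)] rels by (auto simp: entries_in_def intro: mult_tensor_plus)
  qed
  have rows_T: "u \<in> rows T S \<longleftrightarrow> supp u \<subseteq> S \<and> entries_in T u"
    and rows_I: "u \<in> rows I S \<longleftrightarrow> supp u \<subseteq> S \<and> entries_in I u"
    and rows_P: "u \<in> rows Tp S \<longleftrightarrow> supp u \<subseteq> S \<and> entries_in Tp u" for u S
    by (simp_all add: rows_iff zero_mem_I)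
  have dT: "supp (v \<odot> cdiff C n) \<subseteq> cbas C n \<and> entries_in T (v \<odot> cdiff C n)"
    if "supp v \<subseteq> cbas C (Suc n)" "entries_in T v" for v n
  proof
    show "supp (v \<odot> cdiff C n) \<subseteq> cbas C n"
      using that(1) free_complexD(3)[OF C(1)] by (intro supp_comb) blast
    show "entries_in T (v \<odot> cdiff C n)"
      using that free_complexD(4)[OF C(1)] by (intro comb_T) blast+
  qed
  have eqI: "u \<in> {v \<odot> cdiff C n + w | v w. v \<in> rows T (cbas C (Suc n)) \<and> w \<in> rows I (cbas C n)} \<longleftrightarrow>
      supp u \<subseteq> cbas C n \<and> (\<exists>v. supp v \<subseteq> cbas C (Suc n) \<and> entries_in T v \<and> entries_in I (u - v \<odot> cdiff C n))" for u n
  proof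
    assume "u \<in> {v \<odot> cdiff C n + w | v w. v \<in> rows T (cbas C (Suc n)) \<and> w \<in> rows I (cbas C n)}"
    then obtain v w where vw: "u = v \<odot> cdiff C n + w" "supp v \<subseteq> cbas C (Suc n)" "entries_in T v"
        "supp w \<subseteq> cbas C n" "entries_in I w"
      by (auto simp: rows_T rows_I)
    then show "supp u \<subseteq> cbas C n \<and> (\<exists>v. supp v \<subseteq> cbas C (Suc n) \<and> entries_in T v \<and> entries_in I (u - v \<odot> cdiff C n))"
      using dT[OF vw(2,3)] supp_plus by (metis add_diff_cancel_left')
  next
    assume "supp u \<subseteq> cbas C n \<and> (\<exists>v. supp v \<subseteq> cbas C (Suc n) \<and> entries_in T v \<and> entries_in I (u - v \<odot> cdiff C n))"
    then obtain v where v: "supp u \<subseteq> cbas C n" "supp v \<subseteq> cbas C (Suc n)" "entries_in T v" "entries_in I (u - v \<odot> cdiff C n)"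
      by blast
    then have "u - v \<odot> cdiff C n \<in> rows I (cbas C n)" using dT[OF v(2,3)] supp_diff[OF v(1)] by (simp add: rows_I)
    moreover have "u = v \<odot> cdiff C n + (u - v \<odot> cdiff C n)" by simp
    ultimately show "u \<in> {v \<odot> cdiff C n + w | v w. v \<in> rows T (cbas C (Suc n)) \<and> w \<in> rows I (cbas C n)}"
      using v(2,3) unfolding mem_Collect_eq rows_T by (intro exI conjI)
  qed
  have entT: "entries_in T u" if "supp v \<subseteq> cbas C (Suc n)" "entries_in T v" "entries_in I (u - v \<odot> cdiff C n)" for u v n
    using entries_T(4)[OF entries_I_T[OF that(3)]] dT[OF that(1,2)] by fastforce
  have ex0: "{u \<in> rows T (cbas C 0). u \<odot> mat ?P 0 \<in> rels (trivial_module X)} =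
      {v \<odot> cdiff C 0 + w | v w. v \<in> rows T (cbas C 1) \<and> w \<in> rows I (cbas C 0)}"
  proof (rule set_eqI)
    fix u
    define L where "L \<longleftrightarrow> u \<odot> mat ?P 0 \<in> rels (trivial_module X)"
    have L: "L \<longleftrightarrow> entries_in Tp u" if "supp u \<subseteq> cbas C 0" "entries_in T u"
      unfolding L_def using that b(1) by (intro Z0) simp_all
    have "(supp u \<subseteq> cbas C 0 \<and> entries_in T u) \<and> L \<longleftrightarrow>
        supp u \<subseteq> cbas C 0 \<and> (\<exists>v. supp v \<subseteq> cbas C (Suc 0) \<and> entries_in T v \<and> entries_in I (u - v \<odot> cdiff C 0))"
    proof (intro iffI conjI; elim conjE exE)
      assume u: "supp u \<subseteq> cbas C 0" "entries_in T u" "L"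
      then have "entries_in Tp u" using L by simp
      then show "\<exists>v. supp v \<subseteq> cbas C (Suc 0) \<and> entries_in T v \<and> entries_in I (u - v \<odot> cdiff C 0)"
        by (intro acyclic_inhomogeneous[OF u(1,2)]
            acyclic_overD(1)[OF C(3) row_comp_hrow[OF u(1,2)] row_comp_entries_P])
    next
      fix v assume v: "supp u \<subseteq> cbas C 0" "supp v \<subseteq> cbas C (Suc 0)" "entries_in T v" "entries_in I (u - v \<odot> cdiff C 0)"
      show "entries_in T u" by (rule entT[OF v(2-4)])
      then show L using L[OF v(1)] minimal_image[OF C(2) v(2-4)] by simp
    qed
    then show "u \<in> {u \<in> rows T (cbas C 0). u \<odot> mat ?P 0 \<in> rels (trivial_module X)} \<longleftrightarrow>
        u \<in> {v \<odot> cdiff C 0 + w | v w. v \<in> rows T (cbas C 1) \<and> w \<in> rows I (cbas C 0)}"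
      unfolding One_nat_def eqI unfolding mem_Collect_eq rows_T L_def .
  qed
  have exS: "{u \<in> rows T (cbas C (Suc n)). u \<odot> cdiff C n \<in> rows I (cbas C n)} =
      {v \<odot> cdiff C (Suc n) + w | v w. v \<in> rows T (cbas C (Suc (Suc n))) \<and> w \<in> rows I (cbas C (Suc n))}" for n
  proof (rule set_eqI)
    fix u
    have "entries_in I (u \<odot> cdiff C n)"
      if "supp u \<subseteq> cbas C (Suc n)" "supp v \<subseteq> cbas C (Suc (Suc n))" "entries_in T v" "entries_in I (u - v \<odot> cdiff C (Suc n))" for v
    proof -
      have "entries_in I ((u - v \<odot> cdiff C (Suc n)) \<odot> cdiff C n)"
        using free_complexD(4)[OF C(1)] supp_diff[OF that(1)] dT[OF that(2,3)]
        by (intro comb_I_left[OF that(4)]) blast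
      moreover have "entries_in I (v \<odot> cdiff C (Suc n) \<odot> cdiff C n)"
        unfolding comb_assoc[of v] using that(2) free_complexD(2)[OF C(1)]
        by (intro comb_I_right[OF that(3)]) blast
      ultimately show ?thesis using entries_I(4) by (fastforce simp: comb_diff)
    qed
    note image_ker = this
    have "(supp u \<subseteq> cbas C (Suc n) \<and> entries_in T u) \<and> supp (u \<odot> cdiff C n) \<subseteq> cbas C n \<and> entries_in I (u \<odot> cdiff C n) \<longleftrightarrow>
        supp u \<subseteq> cbas C (Suc n) \<and>
        (\<exists>v. supp v \<subseteq> cbas C (Suc (Suc n)) \<and> entries_in T v \<and> entries_in I (u - v \<odot> cdiff C (Suc n)))"
    proof (intro iffI conjI; elim conjE exE)
      assume "supp u \<subseteq> cbas C (Suc n)" "entries_in T u" "entries_in I (u \<odot> cdiff C n)"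
      then show "\<exists>v. supp v \<subseteq> cbas C (Suc (Suc n)) \<and> entries_in T v \<and> entries_in I (u - v \<odot> cdiff C (Suc n))"
        by (rule acyclic_kernel[OF C(1,3)])
    next
      fix v assume v: "supp u \<subseteq> cbas C (Suc n)" "supp v \<subseteq> cbas C (Suc (Suc n))" "entries_in T v"
        "entries_in I (u - v \<odot> cdiff C (Suc n))"
      show uT: "entries_in T u" by (rule entT[OF v(2-4)])
      show "entries_in I (u \<odot> cdiff C n)" by (rule image_ker[OF v])
      show "supp (u \<odot> cdiff C n) \<subseteq> cbas C n" using dT[OF v(1) uT] by blast
    qed
    then show "u \<in> {u \<in> rows T (cbas C (Suc n)). u \<odot> cdiff C n \<in> rows I (cbas C n)} \<longleftrightarrow>
        u \<in> {v \<odot> cdiff C (Suc n) + w | v w. v \<in> rows T (cbas C (Suc (Suc n))) \<and> w \<in> rows I (cbas C (Suc n))}"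
      unfolding eqI unfolding mem_Collect_eq rows_T rows_I .
  qed
  have surj: "\<exists>u\<in>rows T (cbas C 0). w - u \<odot> mat ?P 0 \<in> rels (trivial_module X)"
    if w: "w \<in> rows T {0}" for w
  proof -
    have w0: "w = sng 0 (entry w 0)"
    proof (rule poly_mapping_eqI)
      fix k show "entry w k = entry (sng 0 (entry w 0)) k"
        using w by (cases "k = 0") (auto simp: rows_T lookup_single supp_iff)
    qed
    define u where "u = sng b (entry w 0 * sng [] (inverse \<kappa>))"
    have "u \<in> rows T (cbas C 0)"
      using w b(1) by (auto simp: u_def rows_T entries_in_def lookup_single when_def intro!: mult_tensor_algebra)
    moreover have "w - u \<odot> mat ?P 0 = sng 0 0"
      using w0 by (simp add: u_def mult.assoc inv)
    then have "w - u \<odot> mat ?P 0 \<in> rels (trivial_module X)" by (simp only: rels zero_mem_graded)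
    ultimately show ?thesis by blast
  qed
  have g: "gens (trivial_module X) = {0}" "gdeg (trivial_module X) = (\<lambda>_. 0)"
    by (simp_all add: trivial_module_def cyclic_module_def)
  have aug: "sng 0 (sng [] \<kappa>) \<in> hrow X {0::nat} (\<lambda>_. 0) 0" by (rule hrow_single) simp_all
  show ?thesis
    unfolding minimal_resolution_def graded_free_resolution_def
  proof (intro conjI allI ballI)
    show "finite {i \<in> bas ?P n. bdeg ?P n i \<le> m}" for n m using C(4)[of n] by (simp add: locally_finite_def)
    show "mat ?P 0 i \<in> rows T (gens (trivial_module X))"
      "homogeneous_row (gdeg (trivial_module X)) (bdeg ?P 0 i) (mat ?P 0 i)" if "i \<in> bas ?P 0" for i
      using aug[unfolded hrow_iff] that b by (simp_all add: g)
    show "mat ?P (Suc n) i \<in> rows T (bas ?P n)"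
      "homogeneous_row (bdeg ?P n) (bdeg ?P (Suc n) i) (mat ?P (Suc n) i)"
      "mat ?P (Suc n) i \<in> rows Tp (bas ?P n)" if "i \<in> bas ?P (Suc n)" for n i
      using free_complexD(1,3)[OF C(1), of i n] C(2) that by (auto simp: hrow_iff minimal_complex_def rows_P)
    show "\<exists>u\<in>rows T (bas ?P 0). w - u \<star> mat ?P 0 \<in> rels (trivial_module X)"
      if "w \<in> rows T (gens (trivial_module X))" for w
      using surj that by (simp add: g row_mult_eq)
    show "{u \<in> rows T (bas ?P n). u \<star> mat ?P n \<in> zero_rows I (trivial_module X) ?P n} =
        {v \<star> mat ?P (Suc n) + w | v w. v \<in> rows T (bas ?P (Suc n)) \<and> w \<in> rows I (bas ?P n)}" for n
      using ex0 exS by (cases n) (simp_all add: zero_rows_def row_mult_eq)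
  qed
qed

end

section \<open>Inflation\<close>

lemma chain_map_mono: "I \<subseteq> J \<Longrightarrow> chain_map X I C D m F \<Longrightarrow> chain_map X J C D m F"
  unfolding chain_map_def by (blast intro: entries_in_mono)

lemma free_complex_mono: "I \<subseteq> J \<Longrightarrow> free_complex X I C \<Longrightarrow> free_complex X J C"
  unfolding free_complex_def by (blast intro: entries_in_mono)

lemma chain_map_shift: "chain_map X I C D m F \<Longrightarrow> chain_map X I (shift p C) (shift p D) m (\<lambda>n. F (p + n))"
  by (auto simp: chain_map_def)

text \<open>
  The chain map \<open>\<theta>\<close> from the resolution \<open>P\<close> of \<open>K\<close> over \<open>A = T(V)/I\<close> to the resolution \<open>PB\<close> over
  \<open>B = T(V)/J\<close> lifts the identity of \<open>K\<close>. Composition with \<open>\<theta>\<close> is the inflation map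
  \<open>E(B) \<rightarrow> E(A)\<close>.
\<close>

locale inflation = A: trivial_resolution X I P b \<kappa> + B: trivial_resolution X J PB b \<kappa>
  for X :: "'x set" and I J :: "('x, 'k::field) tensor set" and P PB :: "('x, 'k) resolution"
    and b :: nat and \<kappa> :: 'k +
  fixes \<theta> :: "nat \<Rightarrow> nat \<Rightarrow> nat \<Rightarrow>\<^sub>0 ('x, 'k) tensor"
  assumes IJ: "I \<subseteq> J"
    and \<theta>: "chain_map X J (complex_of P) (complex_of PB) 0 \<theta>" "\<theta> 0 b = unit_row b"
begin

lemma inflate_cochain:
  assumes f: "f \<in> cochains PB n m"
  obtains f' where "f' \<in> cochains P n m" "\<And>i. i \<in> bas P n \<Longrightarrow> entry f' i = apply_cochain f (\<theta> n i)"
proof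
  let ?A = "{i \<in> bas P n. bdeg P n i = m}"
  show "cochain_on ?A (\<lambda>i. apply_cochain f (\<theta> n i)) \<in> cochains P n m"
    by (rule cochain_on_cochains[OF A.P_finite])
  show "entry (cochain_on ?A (\<lambda>i. apply_cochain f (\<theta> n i))) i = apply_cochain f (\<theta> n i)" if "i \<in> bas P n" for i
  proof (cases "bdeg P n i = m")
    case False
    have "\<theta> n i \<in> hrow X (bas PB n) (bdeg PB n) (bdeg P n i)"
      using chain_mapD(1)[OF \<theta>(1), of i n] that by simp
    from apply_cochain_degree[OF f this False] False show ?thesis
      by (simp add: entry_cochain_on[OF A.P_finite])
  qed (simp add: entry_cochain_on[OF A.P_finite] that)
qed

text \<open>
  Lifting a class over \<open>A\<close> and then applying \<open>\<theta>\<close>, or applying \<open>\<theta>\<close> and then lifting over \<open>B\<close>,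
  gives two chain maps modulo \<open>J\<close> over the same homomorphism to \<open>K\<close>.
\<close>

lemma lifts_agree:
  assumes F': "chain_lift X I P p m f' F'" and F: "chain_lift X J PB p m f F"
    and f': "\<And>i. i \<in> bas P p \<Longrightarrow> entry f' i = apply_cochain f (\<theta> p i)"
    and i: "i \<in> bas P (p + q)"
  shows "apply_cochain g (F' q i \<odot> \<theta> q) = apply_cochain g (\<theta> (p + q) i \<odot> F q)"
proof -
  define \<Phi> where "\<Phi> k i = F' k i \<odot> \<theta> k - \<theta> (p + k) i \<odot> F k" for k i
  note P_J = free_complex_mono[OF IJ A.P_complex]
  have F'c: "chain_map X J (shift p A.CP) A.CP m F'"
    and F'0: "\<And>i. i \<in> bas P p \<Longrightarrow> const_coeff (entry (F' 0 i) b) * \<kappa> = entry f' i"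
    using F' by (auto simp: A.chain_lift_iff intro: chain_map_mono[OF IJ])
  have Fc: "chain_map X J (shift p B.CP) B.CP m F"
    and F0: "\<And>i. i \<in> bas PB p \<Longrightarrow> const_coeff (entry (F 0 i) b) * \<kappa> = entry f i"
    using F by (auto simp: B.chain_lift_iff)
  have left: "chain_map X J (shift p A.CP) B.CP m (\<lambda>k i. F' k i \<odot> \<theta> k)"
    using B.chain_map_comp[OF shift_complex(1)[OF P_J] P_J F'c \<theta>(1)] by simp
  have right: "chain_map X J (shift p A.CP) B.CP m (\<lambda>k i. \<theta> (p + k) i \<odot> F k)"
    using B.chain_map_comp[OF shift_complex(1)[OF P_J] shift_complex(1)[OF B.P_complex]
        chain_map_shift[OF \<theta>(1)] Fc] by simp
  have \<Phi>: "chain_map X J (shift p A.CP) B.CP m \<Phi>"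
    unfolding \<Phi>_def[abs_def] by (rule B.chain_map_diff[OF left right])
  have zero: "entries_in B.Tp (\<Phi> 0 i)" if i: "i \<in> cbas (shift p A.CP) 0" for i
  proof -
    have ip: "i \<in> bas P p" using i by simp
    have supp: "supp (\<Phi> 0 i) \<subseteq> {b}" "entries_in B.T (\<Phi> 0 i)"
      using chain_mapD(3,4)[OF \<Phi> i] B.aug(2) by auto
    have "F' 0 i \<odot> \<theta> 0 = F' 0 i \<odot> unit_row"
      using chain_mapD(3)[OF F'c i] A.aug(2) \<theta>(2) by (intro comb_cong) auto
    then have "const_coeff (entry (F' 0 i \<odot> \<theta> 0) b) * \<kappa> = apply_cochain f (\<theta> p i)"
      using F'0[OF ip] f'[OF ip] by simp
    moreover have "const_coeff (entry (\<theta> p i \<odot> F 0) b) * \<kappa> = apply_cochain f (\<theta> p i)"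
    proof -
      have "const_coeff (entry (\<theta> p i \<odot> F 0) b) * \<kappa> =
          (\<Sum>k\<in>supp (\<theta> p i). const_coeff (entry (\<theta> p i) k) * (const_coeff (entry (F 0 k) b) * \<kappa>))"
        by (simp add: entry_comb const_coeff_sum sum_distrib_right mult.assoc)
      also have "\<dots> = apply_cochain f (\<theta> p i)"
        unfolding apply_cochain_def using chain_mapD(3)[OF \<theta>(1), of i p] ip F0
        by (intro sum.cong) auto
      finally show ?thesis .
    qed
    ultimately have "const_coeff (entry (\<Phi> 0 i) b) * \<kappa> = 0"
      by (simp add: \<Phi>_def lookup_minus left_diff_distrib)
    then have b: "const_coeff (entry (\<Phi> 0 i) b) = 0" using A.aug(1) by simp
    have "entry (\<Phi> 0 i) k \<in> B.Tp" for k
    proof (cases "k = b")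
      case True
      then show ?thesis using b supp(2) by (simp add: tensor_plus_def entries_in_def)
    next
      case False
      then have "k \<notin> supp (\<Phi> 0 i)" using supp(1) by blast
      then show ?thesis by (simp add: supp_iff)
    qed
    then show ?thesis by (simp add: entries_in_def)
  qed
  have "entries_in B.Tp (\<Phi> q i)"
  proof (rule B.chain_map_vanishes[OF shift_complex(1)[OF P_J] shift_complex(2)[OF A.P_minimal]
        B.P_complex B.P_minimal B.P_acyclic \<Phi>])
    show "entries_in B.Tp (\<Phi> 0 i)" if "i \<in> cbas (shift p A.CP) 0" for i using that by (rule zero)
    show "i \<in> cbas (shift p A.CP) q" using i by simp
  qed
  then have "apply_cochain g (\<Phi> q i) = 0" by (rule apply_cochain_plus)
  then show ?thesis by (simp add: \<Phi>_def apply_cochain_diff)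
qed

text \<open>
  Inflation is a homomorphism of algebras, so that it maps the subalgebra generated in degrees
  one and two to the corresponding subalgebra.
\<close>

lemma inflate_generated:
  "yoneda_generated X J PB n m f \<Longrightarrow>
    \<exists>f'. yoneda_generated X I P n m f' \<and> (\<forall>i\<in>bas P n. entry f' i = apply_cochain f (\<theta> n i))"
proof (induction rule: yoneda_generated.induct)
  case (unit f m)
  then obtain f' where "f' \<in> cochains P 0 m" "\<And>i. i \<in> bas P 0 \<Longrightarrow> entry f' i = apply_cochain f (\<theta> 0 i)"
    using inflate_cochain B.cocycles_eq by blast
  then show ?case using yoneda_generated.unit A.cocycles_eq by blast
next
  case (deg1 f m)
  then obtain f' where "f' \<in> cochains P 1 m" "\<And>i. i \<in> bas P 1 \<Longrightarrow> entry f' i = apply_cochain f (\<theta> 1 i)"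
    using inflate_cochain B.cocycles_eq by blast
  then show ?case using yoneda_generated.deg1 A.cocycles_eq by blast
next
  case (deg2 f m)
  then obtain f' where "f' \<in> cochains P 2 m" "\<And>i. i \<in> bas P 2 \<Longrightarrow> entry f' i = apply_cochain f (\<theta> 2 i)"
    using inflate_cochain B.cocycles_eq by blast
  then show ?case using yoneda_generated.deg2 A.cocycles_eq by blast
next
  case (coboundary f n m)
  then have "f = 0" by (rule B.coboundary_zero)
  then show ?case using A.generated_zero by (intro exI[of _ 0]) simp
next
  case (add n m f g)
  then obtain f' g' where "yoneda_generated X I P n m f'" "\<forall>i\<in>bas P n. entry f' i = apply_cochain f (\<theta> n i)"
      "yoneda_generated X I P n m g'" "\<forall>i\<in>bas P n. entry g' i = apply_cochain g (\<theta> n i)"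
    by blast
  then show ?case
    by (intro exI[of _ "f' + g'"]) (simp add: yoneda_generated.add lookup_add apply_cochain_add_left)
next
  case (scale n m f c)
  then obtain f' where "yoneda_generated X I P n m f'" "\<forall>i\<in>bas P n. entry f' i = apply_cochain f (\<theta> n i)"
    by blast
  then show ?case
    by (intro exI[of _ "Poly_Mapping.map ((*) c) f'"])
      (simp add: yoneda_generated.scale apply_cochain_scale_left)
next
  case (product q l g p m f h)
  then obtain f' g' where f': "yoneda_generated X I P p m f'" "\<forall>i\<in>bas P p. entry f' i = apply_cochain f (\<theta> p i)"
      and g': "yoneda_generated X I P q l g'" "\<forall>i\<in>bas P q. entry g' i = apply_cochain g (\<theta> q i)"
    by blast
  obtain F where F: "chain_lift X J PB p m f F" "\<forall>i\<in>bas PB (p + q). entry h i = apply_cochain g (F q i)"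
    using product.hyps(3) by (auto simp: yoneda_product_def)
  obtain F' where F': "chain_lift X I P p m f' F'"
    using A.chain_lift_exists[OF A.generated_cochain[OF f'(1)]] by blast
  obtain h' where h': "yoneda_generated X I P (p + q) (m + l) h'"
      "\<And>i. i \<in> bas P (p + q) \<Longrightarrow> entry h' i = apply_cochain g' (F' q i)"
    using A.generated_product[OF g'(1) f'(1) F'] by blast
  have "entry h' i = apply_cochain h (\<theta> (p + q) i)" if i: "i \<in> bas P (p + q)" for i
  proof -
    have "supp (F' q i) \<subseteq> bas P q"
      using F' chain_mapD(3)[of X I "shift p A.CP" A.CP m F' i q] i by (simp add: A.chain_lift_iff)
    then have "entry h' i = apply_cochain g (F' q i \<odot> \<theta> q)"
      unfolding h'(2)[OF i] using g'(2) by (intro apply_cochain_comb_cochain) auto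
    also have "\<dots> = apply_cochain g (\<theta> (p + q) i \<odot> F q)"
      using f'(2) by (intro lifts_agree[OF F' F(1) _ i]) simp
    also have "\<dots> = apply_cochain h (\<theta> (p + q) i)"
      using F(2) chain_mapD(3)[OF \<theta>(1), of i "p + q"] i
      by (intro apply_cochain_comb_cochain[symmetric]) auto
    finally show ?thesis .
  qed
  with h'(1) show ?case by blast
qed

end

section \<open>The tower of syzygies\<close>

text \<open>
  Let \<open>N\<^sub>0 = K\<close>, and let \<open>N\<^sub>p\<^sub>+\<^sub>1\<close> be the kernel of \<open>PB\<^sup>p \<rightarrow> N\<^sub>p\<close>, where \<open>PB\<close> is the resolution of \<open>K\<close>
  over \<open>B = T(V)/J\<close>. The complex \<open>R p\<close> is a resolution of \<open>N\<^sub>p\<close> over \<open>A = T(V)/I\<close> that has the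
  basis of \<open>PB\<^sup>p\<close> in degree \<open>0\<close>, and \<open>Q\<close> is a resolution of \<open>B\<close> over \<open>A\<close>. The maps \<open>\<delta> p\<close> and
  \<open>\<pi> p\<close> come from the long exact sequence for \<open>0 \<rightarrow> N\<^sub>p\<^sub>+\<^sub>1 \<rightarrow> PB\<^sup>p \<rightarrow> N\<^sub>p \<rightarrow> 0\<close>, and \<open>G\<close> lifts the map
  from \<open>B\<close> to \<open>K\<close>. The last two assumptions are the two K2 properties of \<open>B\<close>.
\<close>

locale syzygy_tower = A: trivial_resolution X I P b \<kappa> + B: trivial_resolution X J PB b \<kappa>
  for X :: "'x set" and I J :: "('x, 'k::field) tensor set" and P PB :: "('x, 'k) resolution"
    and b :: nat and \<kappa> :: 'k +
  fixes Q :: "('x, 'k) resolution" and c :: nat and R :: "nat \<Rightarrow> (nat, 'x, 'k) gcomplex"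
    and \<delta> :: "nat \<Rightarrow> nat \<Rightarrow> nat \<Rightarrow> nat \<Rightarrow>\<^sub>0 ('x, 'k) tensor"
    and \<pi> :: "nat \<Rightarrow> nat \<Rightarrow> nat \<Rightarrow> nat \<Rightarrow> nat \<Rightarrow>\<^sub>0 ('x, 'k) tensor"
    and G :: "nat \<Rightarrow> nat \<Rightarrow> nat \<Rightarrow>\<^sub>0 ('x, 'k) tensor"
  assumes IJ: "I \<subseteq> J"
    and P_R: "complex_of P = R 0"
    and Q: "free_complex X I (complex_of Q)" "minimal_complex X (complex_of Q)"
      "\<And>n. locally_finite (bas Q n) (bdeg Q n)" "bas Q 0 = {c}" "bdeg Q 0 c = 0"
    and R: "\<And>p. free_complex X I (R p)" "\<And>p. minimal_complex X (R p)"
      "\<And>p. cbas (R p) 0 = bas PB p" "\<And>p. cdeg (R p) 0 = bdeg PB p"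
      "\<And>p n. locally_finite (cbas (R p) n) (cdeg (R p) n)"
    and \<delta>: "\<And>p. chain_map X I (shift 1 (R p)) (R (Suc p)) 0 (\<delta> p)"
      "\<And>p i. i \<in> cbas (R p) 1 \<Longrightarrow> entries_in J (\<delta> p 0 i \<odot> mat PB (Suc p) - cdiff (R p) 0 i)"
    and \<pi>: "\<And>p u. u \<in> bas PB p \<Longrightarrow> chain_map X I (complex_of Q) (R p) (- bdeg PB p u) (\<pi> p u)"
      "\<And>p u. \<pi> p u 0 c = unit_row u"
    and exact_0: "\<And>p f i. (\<And>u j. u \<in> bas PB p \<Longrightarrow> j \<in> bas Q 0 \<Longrightarrow> apply_cochain f (\<pi> p u 0 j) = 0) \<Longrightarrow>
        i \<in> cbas (R p) 0 \<Longrightarrow> entry f i = 0"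
    and exact_Suc: "\<And>p f n m. (\<And>u j. u \<in> bas PB p \<Longrightarrow> j \<in> bas Q (Suc n) \<Longrightarrow> apply_cochain f (\<pi> p u (Suc n) j) = 0) \<Longrightarrow>
        (\<And>i. entry f i \<noteq> 0 \<Longrightarrow> cdeg (R p) (Suc n) i = m) \<Longrightarrow>
        \<exists>h. (\<forall>i. entry h i \<noteq> 0 \<longrightarrow> i \<in> cbas (R (Suc p)) n \<and> cdeg (R (Suc p)) n i = m) \<and>
          (\<forall>i\<in>cbas (R p) (Suc n). entry f i = apply_cochain h (\<delta> p n i))"
    and G: "chain_map X I (complex_of Q) (complex_of P) 0 G" "G 0 c = sng b (sng [] (inverse \<kappa>))"
    and K2_B: "\<And>n m f. f \<in> cocycles PB n m \<Longrightarrow> yoneda_generated X J PB n m f"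
    and K2_Q: "\<And>n m g. g \<in> cochains Q n m \<Longrightarrow>
      \<exists>d. yoneda_generated X I P n m d \<and> (\<forall>i\<in>bas Q n. entry g i = apply_cochain d (G n i))"
begin

text \<open>
  The iterated connecting map, from \<open>P\<^sup>p\<^sup>+\<^sup>n\<close> to the resolution of \<open>N\<^sub>p\<close> in degree \<open>n\<close>. It induces
  \<open>Ext\<^sub>A\<^sup>n(N\<^sub>p, K) \<rightarrow> E\<^sup>p\<^sup>+\<^sup>n(A)\<close>.
\<close>

primrec \<Delta> :: "nat \<Rightarrow> nat \<Rightarrow> nat \<Rightarrow> nat \<Rightarrow>\<^sub>0 ('x, 'k) tensor" where
  "\<Delta> 0 = (\<lambda>n i. unit_row i)"
| "\<Delta> (Suc p) = (\<lambda>n i. \<Delta> p (Suc n) i \<odot> \<delta> p n)"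

lemma \<Delta>_chain_map: "chain_map X I (shift p A.CP) (R p) 0 (\<Delta> p)"
proof (induction p)
  case 0
  have "shift 0 A.CP = A.CP" by (simp add: shift_def complex_of_def)
  then show ?case using A.chain_map_id[of A.CP] by (simp add: P_R)
next
  case (Suc p)
  have "shift 1 (shift p A.CP) = shift (Suc p) A.CP" by (simp add: shift_def)
  with chain_map_shift[OF Suc, of 1]
  have "chain_map X I (shift (Suc p) A.CP) (shift 1 (R p)) 0 (\<lambda>n. \<Delta> p (Suc n))" by simp
  from A.chain_map_comp[OF shift_complex(1)[OF A.P_complex] shift_complex(1)[OF R(1)] this \<delta>(1)]
  show ?case by simp
qed

text \<open>
  As \<open>R p\<close> and \<open>PB\<^sup>p\<close> have the same basis in degree \<open>0\<close>, the iterated connecting maps take values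
  in the modules of \<open>PB\<close> there. They form a chain map that lifts the identity of \<open>K\<close>.
\<close>

definition \<theta> :: "nat \<Rightarrow> nat \<Rightarrow> nat \<Rightarrow>\<^sub>0 ('x, 'k) tensor" where
  "\<theta> p i = \<Delta> p 0 i"

lemma \<theta>_chain_map: "chain_map X J A.CP B.CP 0 \<theta>"
  unfolding chain_map_def
proof (intro conjI allI ballI)
  show "\<theta> p i \<in> chains X B.CP p (cdeg A.CP p i - 0)" if "i \<in> cbas A.CP p" for p i
    using chain_mapD(1)[OF \<Delta>_chain_map[of p], of i 0] that R(3,4) by (simp add: \<theta>_def)
  show "entries_in J (\<theta> (Suc p) i \<odot> cdiff B.CP p - cdiff A.CP p i \<odot> \<theta> p)" if i: "i \<in> cbas A.CP (Suc p)" for p i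
  proof -
    have i': "i \<in> cbas (shift p A.CP) (Suc 0)" using i by simp
    note c = chain_mapD[OF \<Delta>_chain_map[of p]]
    have "entries_in J (\<Delta> p 1 i \<odot> (\<lambda>k. \<delta> p 0 k \<odot> mat PB (Suc p) - cdiff (R p) 0 k))"
      using c(3,4)[OF i'] \<delta>(2) by (intro B.comb_I_right) auto
    moreover have "entries_in J (\<Delta> p 1 i \<odot> cdiff (R p) 0 - mat P (Suc p) i \<odot> \<Delta> p 0)"
      using entries_in_mono[OF c(2)[OF i'] IJ] by simp
    ultimately show ?thesis
      using B.entries_I(4) by (fastforce simp: \<theta>_def[abs_def] comb_diff_right comb_assoc)
  qed
qed

sublocale inflation X I J P PB b \<kappa> \<theta>
  by unfold_locales (use IJ \<theta>_chain_map in \<open>simp_all add: \<theta>_def\<close>)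

text \<open>
  The heart of the argument, by induction on \<open>n\<close> for all syzygies at once. Restricted to the
  copy of \<open>B\<close> in \<open>PB\<^sup>p\<close> at the basis element \<open>u\<close>, the class \<open>f\<close> on \<open>N\<^sub>p\<close> is induced by a generated
  class \<open>d u\<close> of \<open>E\<^sup>n(A)\<close>, because \<open>B\<close> is a K2 module. The dual basis element at \<open>u\<close> is a class
  of degree \<open>0\<close> on \<open>N\<^sub>p\<close>, since \<open>PB\<close> is minimal, and the product of \<open>d u\<close> with it has the same
  restriction. When these products have been subtracted, the rest \<open>f2\<close> comes from \<open>N\<^sub>p\<^sub>+\<^sub>1\<close> in
  degree \<open>n - 1\<close>. Under \<open>\<Delta>\<close>, the products go to products of \<open>d u\<close> with inflated classes of
  \<open>E\<^sup>p(B)\<close>, which are generated because \<open>B\<close> is a K2 algebra.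
\<close>

lemma tower_generated:
  "(\<And>i. entry f i \<noteq> 0 \<Longrightarrow> i \<in> cbas (R p) n \<and> cdeg (R p) n i = m) \<Longrightarrow>
    \<exists>f'. yoneda_generated X I P (p + n) m f' \<and> (\<forall>i\<in>bas P (p + n). entry f' i = apply_cochain f (\<Delta> p n i))"
proof (induction n arbitrary: p f rule: less_induct)
  case (less n)
  note f = less.prems
  define U where "U = bas PB p"
  define dg where "dg = bdeg PB p"
  have fin_Rn: "finite {i \<in> cbas (R p) n. cdeg (R p) n i = m}"
    using R(5)[of p n] unfolding locally_finite_def by (rule allE[of _ m]) (erule rev_finite_subset, auto)
  obtain lb where lb: "\<And>j. j \<in> bas Q n \<Longrightarrow> lb \<le> bdeg Q n j"
    using locally_finite_lower_bound[OF Q(3)] by blast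
  \<comment> \<open>For degree reasons, all other copies of \<open>B\<close> contribute nothing.\<close>
  define W where "W = {u \<in> U. dg u \<le> m - lb}"
  have W: "finite W"
    using R(5)[of p 0] by (simp add: W_def U_def dg_def R(3,4) locally_finite_def)
  have \<pi>h: "\<pi> p u n j \<in> chains X (R p) n (bdeg Q n j + dg u)" if "u \<in> U" "j \<in> bas Q n" for u j
    using chain_mapD(1)[OF \<pi>(1), of u p j n] that by (simp add: U_def dg_def)
  have f\<pi>: "apply_cochain f (\<pi> p u n j) = 0" if "u \<in> U" "j \<in> bas Q n" "bdeg Q n j \<noteq> m - dg u" for u j
    by (rule apply_cochain_degree'[of f "cdeg (R p) n" m, OF _ \<pi>h[OF that(1,2)]]) (use f that(3) in auto)
  \<comment> \<open>Since \<open>B\<close> is a K2 module, the restriction of \<open>f\<close> to each copy of \<open>Q\<close> comes from a generated class.\<close>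
  have "\<exists>d. yoneda_generated X I P n (m - dg u) d \<and>
      (\<forall>j\<in>bas Q n. apply_cochain f (\<pi> p u n j) = apply_cochain d (G n j))" if u: "u \<in> U" for u
  proof -
    let ?A = "{j \<in> bas Q n. bdeg Q n j = m - dg u}"
    have fin: "finite ?A"
      using Q(3)[of n] unfolding locally_finite_def by (rule allE[of _ "m - dg u"]) (erule rev_finite_subset, auto)
    define g where "g = cochain_on ?A (\<lambda>j. apply_cochain f (\<pi> p u n j))"
    have "g \<in> cochains Q n (m - dg u)" unfolding g_def by (rule cochain_on_cochains[OF fin])
    then obtain d where d: "yoneda_generated X I P n (m - dg u) d" "\<forall>j\<in>bas Q n. entry g j = apply_cochain d (G n j)"
      using K2_Q by blast
    have "entry g j = apply_cochain f (\<pi> p u n j)" if "j \<in> bas Q n" for j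
      unfolding g_def entry_cochain_on[OF fin] using f\<pi>[OF u that] that by auto
    with d show ?thesis by auto
  qed
  then obtain d where d: "\<And>u. u \<in> U \<Longrightarrow> yoneda_generated X I P n (m - dg u) (d u)"
      "\<And>u j. u \<in> U \<Longrightarrow> j \<in> bas Q n \<Longrightarrow> apply_cochain f (\<pi> p u n j) = apply_cochain (d u) (G n j)"
    by metis
  \<comment> \<open>\<open>E u\<close> lifts the dual basis element at \<open>u\<close>, as a class of degree \<open>0\<close> on \<open>N\<^sub>p\<close>.\<close>
  define \<phi> where "\<phi> u i = (if i = u then inverse \<kappa> else 0)" for u i :: nat
  have "\<exists>E. chain_map X I (R p) A.CP (dg u) E \<and> (\<forall>i. E 0 i = sng b (sng [] (\<phi> u i)))" for u
  proof -
    have "\<And>i. i \<in> cbas (R p) 0 \<Longrightarrow> \<phi> u i \<noteq> 0 \<Longrightarrow> cdeg (R p) 0 i = dg u"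
      by (auto simp: \<phi>_def dg_def R(4) split: if_splits)
    then show ?thesis using A.lift_functional[OF R(1,2), where \<phi> = "\<phi> u"] by metis
  qed
  then obtain E where E: "\<And>u. chain_map X I (R p) A.CP (dg u) (E u)" "\<And>u i. E u 0 i = sng b (sng [] (\<phi> u i))"
    by metis
  \<comment> \<open>On the copy of \<open>Q\<close> at \<open>v\<close>, homomorphisms to \<open>K\<close> do not tell the lift \<open>E u\<close> from \<open>G\<close> if
    \<open>u = v\<close>, and from zero otherwise.\<close>
  have \<pi>E: "apply_cochain (d u) (\<pi> p v n j \<odot> E u n) = (if u = v then apply_cochain f (\<pi> p u n j) else 0)"
    if uv: "u \<in> U" "v \<in> U" and j: "j \<in> bas Q n" for u v j
  proof -
    have pe: "chain_map X I (complex_of Q) A.CP (- dg v + dg u) (\<lambda>n j. \<pi> p v n j \<odot> E u n)"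
      using A.chain_map_comp[OF Q(1) R(1) \<pi>(1) E(1)] uv by (simp add: U_def dg_def)
    define \<Phi> where "\<Phi> n j = (if u = v then \<pi> p v n j \<odot> E u n - G n j else \<pi> p v n j \<odot> E u n)" for n j
    have \<Phi>: "chain_map X I (complex_of Q) A.CP (- dg v + dg u) \<Phi>"
    proof (cases "u = v")
      case True
      then have "chain_map X I (complex_of Q) A.CP 0 (\<lambda>n j. \<pi> p v n j \<odot> E u n)" using pe by simp
      from A.chain_map_diff[OF this G(1)] show ?thesis by (simp add: \<Phi>_def[abs_def] True)
    qed (use pe in \<open>simp add: \<Phi>_def[abs_def]\<close>)
    have \<Phi>0: "\<Phi> 0 j = 0" if "j \<in> cbas (complex_of Q) 0" for j
      using that Q(4) by (simp add: \<Phi>_def \<pi>(2) E(2) \<phi>_def G(2))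
    have "entries_in A.Tp (\<Phi> n j)"
    proof (rule A.chain_map_vanishes[OF Q(1,2) A.P_complex A.P_minimal A.P_acyclic \<Phi>])
      show "entries_in A.Tp (\<Phi> 0 j)" if "j \<in> cbas (complex_of Q) 0" for j
        using \<Phi>0[OF that] A.entries_P(1) by simp
      show "j \<in> cbas (complex_of Q) n" using j by simp
    qed
    then have "apply_cochain (d u) (\<Phi> n j) = 0" by (rule apply_cochain_plus)
    then show ?thesis using d(2)[OF uv(1) j] by (auto simp: \<Phi>_def apply_cochain_diff split: if_splits)
  qed
  define f2 where "f2 = cochain_on {i \<in> cbas (R p) n. cdeg (R p) n i = m}
      (\<lambda>i. entry f i - (\<Sum>u\<in>W. apply_cochain (d u) (E u n i)))"
  have f2: "entry f2 i = entry f i - (\<Sum>u\<in>W. apply_cochain (d u) (E u n i))" if i: "i \<in> cbas (R p) n" for i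
  proof (cases "cdeg (R p) n i = m")
    case False
    have "apply_cochain (d u) (E u n i) = 0" if "u \<in> W" for u
    proof -
      have Eh: "E u n i \<in> hrow X (bas P n) (bdeg P n) (cdeg (R p) n i - dg u)"
        using chain_mapD(1)[OF E(1) i] by simp
      have "u \<in> U" using that by (simp add: W_def)
      from apply_cochain_degree[OF A.generated_cochain[OF d(1)[OF this]] Eh] False show ?thesis by simp
    qed
    then show ?thesis using False f[of i] by (auto simp: f2_def entry_cochain_on[OF fin_Rn])
  qed (simp add: f2_def entry_cochain_on[OF fin_Rn] i)
  have f2_deg: "cdeg (R p) n i = m" if "entry f2 i \<noteq> 0" for i
    using that by (auto simp: f2_def entry_cochain_on[OF fin_Rn] split: if_splits)
  have f2_apply: "apply_cochain f2 w = apply_cochain f w - (\<Sum>u\<in>W. apply_cochain (d u) (w \<odot> E u n))"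
    if w: "supp w \<subseteq> cbas (R p) n" for w
  proof -
    have "apply_cochain f2 w = (\<Sum>k\<in>supp w. const_coeff (entry w k) * entry f k -
        (\<Sum>u\<in>W. const_coeff (entry w k) * apply_cochain (d u) (E u n k)))"
      unfolding apply_cochain_def[of f2] using w f2
      by (intro sum.cong) (auto simp: right_diff_distrib sum_distrib_left)
    also have "\<dots> = apply_cochain f w - (\<Sum>u\<in>W. \<Sum>k\<in>supp w. const_coeff (entry w k) * apply_cochain (d u) (E u n k))"
      unfolding sum_subtractf apply_cochain_def[of f] by (subst sum.swap) (rule refl)
    finally show ?thesis by (simp add: apply_cochain_comb)
  qed
  have f2_zero: "apply_cochain f2 (\<pi> p v n j) = 0" if v: "v \<in> U" and j: "j \<in> bas Q n" for v j
  proof -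
    have "(\<Sum>u\<in>W. apply_cochain (d u) (\<pi> p v n j \<odot> E u n)) =
        (\<Sum>u\<in>W. if u = v then apply_cochain f (\<pi> p v n j) else 0)"
      using \<pi>E v j by (intro sum.cong) (auto simp: W_def)
    also have "\<dots> = apply_cochain f (\<pi> p v n j)"
    proof (cases "v \<in> W")
      case False
      then have "bdeg Q n j \<noteq> m - dg v" using lb[OF j] v by (auto simp: W_def)
      with False W f\<pi>[OF v j] show ?thesis by simp
    qed (use W in simp)
    finally show ?thesis using f2_apply[OF hrowD(1)[OF \<pi>h[OF v j]]] by simp
  qed
  \<comment> \<open>What remains after subtracting these products comes from the next syzygy.\<close>
  have "\<exists>h. yoneda_generated X I P (p + n) m h \<and> (\<forall>i\<in>bas P (p + n). entry h i = apply_cochain f2 (\<Delta> p n i))"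
  proof (cases n)
    case 0
    have "entry f2 i = 0" if "i \<in> cbas (R p) 0" for i
      using exact_0[of p f2 i] f2_zero that unfolding 0 U_def by blast
    then have "apply_cochain f2 (\<Delta> p 0 i) = 0" if "i \<in> bas P p" for i
      using chain_mapD(3)[OF \<Delta>_chain_map[of p], of i 0] that
      by (auto simp: apply_cochain_def intro!: sum.neutral)
    then show ?thesis using A.generated_zero[of p m] 0 by (intro exI[of _ 0]) simp
  next
    case (Suc n')
    obtain h where h: "\<forall>i. entry h i \<noteq> 0 \<longrightarrow> i \<in> cbas (R (Suc p)) n' \<and> cdeg (R (Suc p)) n' i = m"
        "\<forall>i\<in>cbas (R p) (Suc n'). entry f2 i = apply_cochain h (\<delta> p n' i)"
      using exact_Suc[of p n' f2 m] f2_zero f2_deg unfolding Suc U_def by blast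
    obtain h' where h': "yoneda_generated X I P (Suc p + n') m h'"
        "\<forall>i\<in>bas P (Suc p + n'). entry h' i = apply_cochain h (\<Delta> (Suc p) n' i)"
      using less.IH[of n' h "Suc p"] h(1) Suc by blast
    have "apply_cochain h (\<Delta> (Suc p) n' i) = apply_cochain f2 (\<Delta> p (Suc n') i)" if "i \<in> bas P (p + Suc n')" for i
      using chain_mapD(3)[OF \<Delta>_chain_map[of p], of i "Suc n'"] that h(2)
      by (auto intro!: apply_cochain_comb_cochain[symmetric])
    then show ?thesis using h' Suc by (intro exI[of _ h']) simp
  qed
  then obtain h where h: "yoneda_generated X I P (p + n) m h"
      "\<And>i. i \<in> bas P (p + n) \<Longrightarrow> entry h i = apply_cochain f2 (\<Delta> p n i)" by blast
  \<comment> \<open>The subtracted products, pulled back along \<open>\<Delta>\<close>, are products with inflated classes.\<close>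
  have "\<exists>h. yoneda_generated X I P (p + n) m h \<and>
      (\<forall>i\<in>bas P (p + n). entry h i = apply_cochain (d u) (\<Delta> p n i \<odot> E u n))" if u: "u \<in> U" for u
  proof -
    have "sng u 1 \<in> cochains PB p (dg u)" using u by (simp add: cochains_def U_def dg_def)
    then have "yoneda_generated X J PB p (dg u) (sng u 1)" using K2_B B.cocycles_eq by blast
    then obtain e where e: "yoneda_generated X I P p (dg u) e"
        "\<forall>i\<in>bas P p. entry e i = apply_cochain (sng u 1) (\<theta> p i)"
      using inflate_generated by blast
    define F where "F k i = \<Delta> p k i \<odot> E u k" for k i
    have "chain_map X I (shift p A.CP) A.CP (dg u) F"
      using A.chain_map_comp[OF shift_complex(1)[OF A.P_complex] R(1) \<Delta>_chain_map E(1)]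
      by (simp add: F_def[abs_def])
    moreover have "const_coeff (entry (F 0 i) b) * \<kappa> = entry e i" if "i \<in> bas P p" for i
    proof -
      have "const_coeff (entry (F 0 i) b) * \<kappa> =
          (\<Sum>k\<in>supp (\<Delta> p 0 i). const_coeff (entry (\<Delta> p 0 i) k) * \<phi> u k * \<kappa>)"
        by (simp add: F_def entry_comb E(2) const_coeff_sum sum_distrib_right)
      also have "\<dots> = apply_cochain (sng u 1) (\<Delta> p 0 i)"
        unfolding apply_cochain_def using A.aug(1)
        by (intro sum.cong) (auto simp: \<phi>_def lookup_single when_def)
      finally show ?thesis using e(2) that by (simp add: \<theta>_def)
    qed
    ultimately have "chain_lift X I P p (dg u) e F" by (simp add: A.chain_lift_iff)
    then obtain h where "yoneda_generated X I P (p + n) (dg u + (m - dg u)) h"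
        "\<And>i. i \<in> bas P (p + n) \<Longrightarrow> entry h i = apply_cochain (d u) (F n i)"
      using A.generated_product[OF d(1)[OF u] e(1)] by blast
    then show ?thesis by (auto simp: F_def)
  qed
  then obtain k where k: "\<And>u. u \<in> U \<Longrightarrow> yoneda_generated X I P (p + n) m (k u)"
      "\<And>u i. u \<in> U \<Longrightarrow> i \<in> bas P (p + n) \<Longrightarrow> entry (k u) i = apply_cochain (d u) (\<Delta> p n i \<odot> E u n)"
    by metis
  have "yoneda_generated X I P (p + n) m (h + sum k W)"
    using h(1) k(1) by (intro yoneda_generated.add A.generated_sum) (auto simp: W_def)
  moreover have "entry (h + sum k W) i = apply_cochain f (\<Delta> p n i)" if i: "i \<in> bas P (p + n)" for i
  proof -
    have "supp (\<Delta> p n i) \<subseteq> cbas (R p) n" using chain_mapD(3)[OF \<Delta>_chain_map[of p], of i n] i by simp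
    moreover have "(\<Sum>u\<in>W. entry (k u) i) = (\<Sum>u\<in>W. apply_cochain (d u) (\<Delta> p n i \<odot> E u n))"
      using k(2) i by (intro sum.cong) (auto simp: W_def)
    ultimately show ?thesis by (simp add: lookup_add lookup_sum h(2)[OF i] f2_apply)
  qed
  ultimately show ?case by blast
qed

lemma cocycles_generated:
  assumes "f \<in> cocycles P n m"
  shows "yoneda_generated X I P n m f"
proof -
  have f: "f \<in> cochains P n m" using assms A.cocycles_eq by blast
  have "\<exists>f'. yoneda_generated X I P (0 + n) m f' \<and> (\<forall>i\<in>bas P (0 + n). entry f' i = apply_cochain f (\<Delta> 0 n i))"
    using f P_R[symmetric] by (intro tower_generated) (auto simp: cochains_iff)
  then obtain f' where f': "yoneda_generated X I P n m f'" "\<forall>i\<in>bas P n. entry f' i = entry f i"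
    by auto
  have "f' = f"
    using f A.generated_cochain[OF f'(1)] f'(2) by (intro poly_mapping_eqI) (metis cochains_iff)
  with f'(1) show ?thesis by simp
qed

end

section \<open>Syzygies of the trivial module\<close>

lemma acyclic_over_weaken:
  assumes "acyclic_over X I C Z" "\<And>u e. u \<in> chains X C 0 e \<Longrightarrow> Z' u \<Longrightarrow> Z u"
  shows "acyclic_over X I C Z'"
  using assms unfolding acyclic_over_def by blast

context trivial_resolution
begin

text \<open>
  The \<open>p\<close>-th syzygy of \<open>K\<close> is presented as the quotient of \<open>P\<^sup>p\<close> by these rows. For \<open>p = 0\<close> they are written
  down without the augmentation, which has the same kernel because \<open>P\<^sup>0\<close> has rank one.
\<close>

definition syzygy :: "nat \<Rightarrow> (nat \<Rightarrow>\<^sub>0 ('x, 'k) tensor) set" where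
  "syzygy p = {u. supp u \<subseteq> bas P p \<and> entries_in T u \<and>
     (case p of 0 \<Rightarrow> entries_in Tp u | Suc k \<Rightarrow> entries_in I (u \<odot> mat P (Suc k)))}"

lemma syzygy_plus:
  assumes "u \<in> syzygy p"
  shows "entries_in Tp u"
proof (cases p)
  case (Suc k)
  then have "supp u \<subseteq> cbas CP (Suc k)" "entries_in T u" "entries_in I (u \<odot> cdiff CP k)"
    using assms by (auto simp: syzygy_def)
  then obtain v where "supp v \<subseteq> cbas CP (Suc (Suc k))" "entries_in T v" "entries_in I (u - v \<odot> cdiff CP (Suc k))"
    using acyclic_kernel[OF P_complex P_acyclic] by blast
  then show ?thesis by (rule minimal_image[OF P_minimal])
qed (use assms in \<open>simp add: syzygy_def\<close>)

lemma mat_T: "i \<in> bas P (Suc k) \<Longrightarrow> entries_in T (mat P (Suc k) i)"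
  using free_complexD(4)[OF P_complex, of i k] by simp

lemma syzygy_contains_ideal:
  assumes "supp u \<subseteq> bas P p" "entries_in I u"
  shows "u \<in> syzygy p"
proof (cases p)
  case (Suc k)
  then have "entries_in I (u \<odot> mat P (Suc k))"
    using assms mat_T by (intro comb_I_left) auto
  with assms Suc show ?thesis by (simp add: syzygy_def entries_I_T)
qed (use assms in \<open>simp add: syzygy_def entries_I_T entries_I_P\<close>)

text \<open>
  A module over \<open>T(V)/I\<close> is also one over any algebra \<open>T(V)/I'\<close> that has \<open>T(V)/I\<close> as a factor.
\<close>

lemma submodule_syzygy:
  assumes A: "graded_ideal X I'" "I' \<subseteq> I"
  shows "graded_ideal.submodule X I' (bas P p) (syzygy p)"
  unfolding graded_ideal.submodule_def[OF A(1)]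
proof (intro conjI ballI subsetI)
  show "add_subgroup (syzygy p)"
    unfolding add_subgroup_def
  proof (intro conjI ballI)
    show "0 \<in> syzygy p" by (rule syzygy_contains_ideal) (simp_all add: entries_I)
    show "u - v \<in> syzygy p" if "u \<in> syzygy p" "v \<in> syzygy p" for u v
      using that supp_diff[of u "bas P p" v]
      by (cases p) (simp_all add: syzygy_def entries_T entries_P entries_I comb_diff)
  qed
  show "entries_in T u" if "u \<in> syzygy p" for u using that by (simp add: syzygy_def)
  show "i \<in> bas P p" if "u \<in> syzygy p" "i \<in> supp u" for u i using that by (auto simp: syzygy_def)
  show "scale_by a u \<in> syzygy p" if "a \<in> T" "u \<in> syzygy p" for a u
    using that supp_scale_by[of a u]
    by (cases p) (auto simp: syzygy_def comb_scale_by entries_in_def mult_tensor_algebra mult_tensor_plus mult_left)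
  show "u \<in> syzygy p" if "u \<in> {u. supp u \<subseteq> bas P p \<and> entries_in I' u}" for u
    using that A(2) entries_in_mono by (intro syzygy_contains_ideal) auto
qed

lemma syzygy_image:
  assumes "v \<in> bas P (Suc p)"
  shows "mat P (Suc p) v \<in> hrow X (bas P p) (bdeg P p) (bdeg P (Suc p) v)" "mat P (Suc p) v \<in> syzygy p"
proof -
  show h: "mat P (Suc p) v \<in> hrow X (bas P p) (bdeg P p) (bdeg P (Suc p) v)"
    using free_complexD(1)[OF P_complex, of v p] assms by simp
  have "entries_in Tp (mat P (Suc p) v)" using P_minimal assms by (auto simp: minimal_complex_def)
  moreover have "entries_in I (mat P (Suc p) v \<odot> mat P (Suc k))" if "p = Suc k" for k
    using free_complexD(2)[OF P_complex, of v k] assms that by simp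
  ultimately show "mat P (Suc p) v \<in> syzygy p"
    using hrowD(1,3)[OF h] by (cases p) (simp_all add: syzygy_def)
qed

lemma syzygy_cover:
  assumes "u \<in> hrow X (bas P p) (bdeg P p) e" "u \<in> syzygy p"
  shows "\<exists>v\<in>hrow X (bas P (Suc p)) (bdeg P (Suc p)) e. entries_in I (u - v \<odot> mat P (Suc p))"
  using assms acyclic_overD[OF P_acyclic] by (cases p) (simp_all add: syzygy_def)

end

theorem theorem7p4:
  fixes X :: "'x set" and I J :: "('x, 'k::field) tensor set"
  assumes "graded_algebra X I"
    and "graded_factor_algebra X I J"
    and "K2_module X I (cyclic_module J)"
    and "K2_algebra X J"
  shows "K2_algebra X I"
proof -
  interpret A: graded_ideal X I by (rule graded_algebra_ideal(1)[OF assms(1)])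
  interpret BJ: graded_ideal X J by (rule graded_ideal_factor[OF assms(2)])
  have I2: "I \<subseteq> tensor_ge2 X" by (rule graded_algebra_ideal(2)[OF assms(1)])
  have X: "finite X" using assms(1) by (simp add: graded_algebra_def)
  have IJ: "I \<subseteq> J" using assms(2) by (simp add: graded_factor_algebra_def)
  obtain PB where PB: "minimal_resolution X J (trivial_module X) PB"
      and K2_B: "\<And>n m f. f \<in> cocycles PB n m \<Longrightarrow> yoneda_generated X J PB n m f"
    using assms(4) by (auto simp: K2_algebra_def)
  obtain Q where Q: "minimal_resolution X I (cyclic_module J) Q"
      and LE: "\<And>n. 1 \<le> n \<Longrightarrow> LE_rows_independent X I Q n"
    using assms(3) by (auto simp: K2_module_def)
  obtain b \<kappa> where b: "\<kappa> \<noteq> 0" "bas PB 0 = {b}" "bdeg PB 0 b = 0" "mat PB 0 b = sng 0 (sng [] \<kappa>)"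
    using BJ.cyclic_module_augmentation[OF PB[unfolded trivial_module_def] order_refl zero_mem_graded(3)]
    by blast
  interpret B: trivial_resolution X J PB b \<kappa>
    by unfold_locales (use X PB b in auto)
  obtain c \<kappa>' where c: "\<kappa>' \<noteq> 0" "bas Q 0 = {c}" "bdeg Q 0 c = 0" "mat Q 0 c = sng 0 (sng [] \<kappa>')"
    using A.cyclic_module_augmentation[OF Q BJ.subset_plus BJ.zero_mem_I] by blast
  \<comment> \<open>The augmentation of \<open>Q\<close> is multiplication by a nonzero constant, which can be ignored.\<close>
  define CQ where "CQ = complex_of Q"
  have CQ: "free_complex X I CQ" "minimal_complex X CQ"
    unfolding CQ_def by (rule A.resolution_free_complex[OF Q], rule A.resolution_minimal[OF Q])
  have aug: "u \<odot> mat Q 0 = sng 0 (entry u c * sng [] \<kappa>')" if "supp u \<subseteq> {c}" for u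
    by (subst comb_superset[OF _ that]) (simp_all add: c(4))
  have rels: "sng 0 a \<in> rels (cyclic_module J) \<longleftrightarrow> a \<in> J" for a
    by (auto simp: cyclic_module_def rows_iff BJ.zero_mem_I entries_in_def lookup_single when_def)
  have CQ_acyclic: "acyclic_over X I CQ (entries_in J)"
    unfolding CQ_def
  proof (rule acyclic_over_weaken[OF A.resolution_acyclic[OF Q]])
    fix u e assume u: "u \<in> chains X (complex_of Q) 0 e" "entries_in J u"
    have "supp u \<subseteq> {c}" using hrowD(1)[OF u(1)] c(2) by simp
    then show "u \<odot> mat Q 0 \<in> rels (cyclic_module J)"
      unfolding aug[OF \<open>supp u \<subseteq> {c}\<close>] rels using u(2) by (auto simp: entries_in_def intro: BJ.mult_right)
  qed
  have QJ: "entries_in J (cdiff CQ 0 i)" if "i \<in> cbas CQ 1" for i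
  proof -
    have supp: "supp (mat Q 1 i) \<subseteq> {c}" using free_complexD(3)[OF CQ(1), of i 0] that c(2) by (simp add: CQ_def)
    have "mat Q 1 i \<odot> mat Q 0 \<in> rels (cyclic_module J)"
      using A.resolution_augmentation[OF Q] that by (simp add: CQ_def)
    then have "entry (mat Q 1 i) c * sng [] \<kappa>' \<in> J" unfolding aug[OF supp] rels .
    then have "entry (mat Q 1 i) c * sng [] \<kappa>' * sng [] (inverse \<kappa>') \<in> J" by (rule BJ.mult_right) simp
    then have "entry (mat Q 1 i) c \<in> J"
      using c(1) by (simp add: mult.assoc mult_single plus_list_def flip: one_tensor)
    moreover have "entry (mat Q 1 i) k = 0" if "k \<noteq> c" for k using supp that by (auto simp: supp_iff)
    ultimately have "entry (mat Q 1 i) k \<in> J" for k using BJ.zero_mem_I by (cases "k = c") auto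
    then show ?thesis by (simp add: entries_in_def CQ_def)
  qed
  \<comment> \<open>Minimal resolutions over the larger algebra of all syzygies of the trivial module over the factor.\<close>
  have lfPB: "locally_finite (bas PB p) (bdeg PB p)" for p
    using PB by (auto simp: minimal_resolution_def graded_free_resolution_def locally_finite_def)
  define resolves where "resolves p C \<longleftrightarrow> cbas C 0 = bas PB p \<and> cdeg C 0 = bdeg PB p \<and>
      (\<forall>n. locally_finite (cbas C n) (cdeg C n)) \<and> free_complex X I C \<and> minimal_complex X C \<and>
      acyclic_over X I C (\<lambda>u. u \<in> B.syzygy p) \<and> (\<forall>i\<in>cbas C 1. cdiff C 0 i \<in> B.syzygy p)"
    for p and C :: "(nat, 'x, 'k) gcomplex"
  have "\<exists>C. resolves p C" for p
    unfolding resolves_def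
    by (rule A.minimal_resolution_exists[OF X lfPB B.submodule_syzygy[OF A.graded_ideal_axioms IJ] B.syzygy_plus])
      blast+
  then obtain R where "\<And>p. resolves p (R p)" by metis
  then have R: "\<And>p. cbas (R p) 0 = bas PB p" "\<And>p. cdeg (R p) 0 = bdeg PB p"
      "\<And>p n. locally_finite (cbas (R p) n) (cdeg (R p) n)" "\<And>p. free_complex X I (R p)"
      "\<And>p. minimal_complex X (R p)" "\<And>p. acyclic_over X I (R p) (\<lambda>u. u \<in> B.syzygy p)"
      "\<And>p i. i \<in> cbas (R p) 1 \<Longrightarrow> cdiff (R p) 0 i \<in> B.syzygy p"
    unfolding resolves_def by blast+
  have step: "syzygy_step X I J CQ (R p) (R (Suc p)) c (bas PB p) (bas PB (Suc p)) (bdeg PB p)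
      (bdeg PB (Suc p)) (mat PB (Suc p)) (B.syzygy p)" for p
  proof (intro syzygy_step.intro[OF A.graded_ideal_axioms] syzygy_step_axioms.intro)
    show "acyclic_over X I (R (Suc p)) (\<lambda>v. entries_in J (v \<odot> mat PB (Suc p)))"
    proof (rule acyclic_over_weaken[OF R(6)])
      fix v e assume v: "v \<in> chains X (R (Suc p)) 0 e" "entries_in J (v \<odot> mat PB (Suc p))"
      then show "v \<in> B.syzygy (Suc p)" using hrowD(1,3)[OF v(1)] R(1) by (simp add: B.syzygy_def)
    qed
    show "entries_in J (cdiff (R (Suc p)) 0 i \<odot> mat PB (Suc p))" if "i \<in> cbas (R (Suc p)) 1" for i
      using R(7)[OF that] by (simp add: B.syzygy_def)
    show "\<exists>v\<in>hrow X (bas PB (Suc p)) (bdeg PB (Suc p)) e. entries_in J (u - v \<odot> mat PB (Suc p))"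
      if "u \<in> hrow X (bas PB p) (bdeg PB p) e" "u \<in> B.syzygy p" for u e
      using that by (rule B.syzygy_cover)
    show "two_sided_ideal X J" by (rule BJ.ideal)
    show "cbas CQ 0 = {c}" "cdeg CQ 0 c = 0" using c by (simp_all add: CQ_def)
  qed (fact IJ CQ CQ_acyclic QJ R B.syzygy_image B.syzygy_contains_ideal)+
  define shifts where "shifts p \<delta> \<pi> \<longleftrightarrow>
      chain_map X I (shift 1 (R p)) (R (Suc p)) 0 \<delta> \<and>
      (\<forall>i\<in>cbas (R p) 1. entries_in J (\<delta> 0 i \<odot> mat PB (Suc p) - cdiff (R p) 0 i)) \<and>
      (\<forall>u\<in>bas PB p. chain_map X I CQ (R p) (- bdeg PB p u) (\<pi> u)) \<and>
      (\<forall>u. \<pi> u 0 c = unit_row u) \<and>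
      (\<forall>f. (\<forall>u\<in>bas PB p. \<forall>j\<in>cbas CQ 0. apply_cochain f (\<pi> u 0 j) = 0) \<longrightarrow>
        (\<forall>i\<in>cbas (R p) 0. entry f i = 0)) \<and>
      (\<forall>f n m. (\<forall>u\<in>bas PB p. \<forall>j\<in>cbas CQ (Suc n). apply_cochain f (\<pi> u (Suc n) j) = 0) \<longrightarrow>
        (\<forall>i. entry f i \<noteq> 0 \<longrightarrow> cdeg (R p) (Suc n) i = m) \<longrightarrow>
        (\<exists>h. (\<forall>i. entry h i \<noteq> 0 \<longrightarrow> i \<in> cbas (R (Suc p)) n \<and> cdeg (R (Suc p)) n i = m) \<and>
          (\<forall>i\<in>cbas (R p) (Suc n). entry f i = apply_cochain h (\<delta> n i))))"
    for p \<delta> \<pi>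
  have "\<exists>\<delta> \<pi>. shifts p \<delta> \<pi>" for p
  proof (rule syzygy_step.dimension_shift[OF step[of p]], goal_cases)
    case (1 \<delta> \<pi>)
    have "shifts p \<delta> \<pi>"
      unfolding shifts_def
    proof (intro conjI allI ballI impI)
      show "entry f i = 0"
        if "\<forall>u\<in>bas PB p. \<forall>j\<in>cbas CQ 0. apply_cochain f (\<pi> u 0 j) = 0" "i \<in> cbas (R p) 0" for f i
        using that by (intro 1(5)) auto
      show "\<exists>h. (\<forall>i. entry h i \<noteq> 0 \<longrightarrow> i \<in> cbas (R (Suc p)) n \<and> cdeg (R (Suc p)) n i = m) \<and>
          (\<forall>i\<in>cbas (R p) (Suc n). entry f i = apply_cochain h (\<delta> n i))"
        if "\<forall>u\<in>bas PB p. \<forall>j\<in>cbas CQ (Suc n). apply_cochain f (\<pi> u (Suc n) j) = 0"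
          "\<forall>i. entry f i \<noteq> 0 \<longrightarrow> cdeg (R p) (Suc n) i = m" for f n m
        using that by (intro 1(6)) auto
    qed (fact 1)+
    then show ?case by blast
  qed
  then obtain \<delta> \<pi> where shifts: "\<And>p. shifts p (\<delta> p) (\<pi> p)" by metis
  \<comment> \<open>The resolution of \<open>K\<close> over the larger algebra is that of the syzygy for \<open>p = 0\<close>, with the
    augmentation of \<open>PB\<close>.\<close>
  define P where "P = \<lparr>bas = cbas (R 0), bdeg = cdeg (R 0),
      mat = (\<lambda>n. case n of 0 \<Rightarrow> (\<lambda>_. sng 0 (sng [] \<kappa>)) | Suc k \<Rightarrow> cdiff (R 0) k)\<rparr>"
  have P_R: "complex_of P = R 0" by (cases "R 0") (simp add: complex_of_def P_def)
  have R0: "acyclic_over X I (R 0) (entries_in A.Tp)"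
  proof (rule acyclic_over_weaken[OF R(6)])
    fix u e assume "u \<in> chains X (R 0) 0 e" "entries_in A.Tp u"
    then show "u \<in> B.syzygy 0" using hrowD(1,3)[of u] R(1) by (auto simp: B.syzygy_def)
  qed
  have P: "minimal_resolution X I (trivial_module X) P"
    unfolding P_def using b R(1)[of 0] R(2)[of 0]
    by (intro A.resolution_of_complex[OF R(4,5) R0 R(3)]) simp_all
  interpret P: trivial_resolution X I P b \<kappa>
    by unfold_locales (use X P b R(1)[of 0] R(2)[of 0] in \<open>auto simp: P_def\<close>)
  obtain G where G: "chain_map X I CQ (complex_of P) 0 G" "\<And>i. G 0 i = sng b (sng [] (inverse \<kappa>))"
    using P.lift_functional[OF CQ, of "\<lambda>_. inverse \<kappa>" 0] c by (auto simp: CQ_def)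
  have base: "\<exists>d. yoneda_generated X I P 0 m d \<and> (\<forall>i\<in>bas Q 0. entry g i = apply_cochain d (G 0 i))"
    if g: "g \<in> cochains Q 0 m" for m g
  proof (cases "entry g c = 0")
    case True
    then show ?thesis using P.generated_zero c(2) by (intro exI[of _ 0]) simp
  next
    case False
    then have "m = 0" using g c(3) by (auto simp: cochains_iff)
    have "sng b (\<kappa> * entry g c) \<in> cochains P 0 0"
      using P.aug by (auto simp: cochains_iff lookup_single when_def split: if_splits)
    then have "yoneda_generated X I P 0 0 (sng b (\<kappa> * entry g c))"
      using yoneda_generated.unit P.cocycles_eq by blast
    then show ?thesis using \<open>m = 0\<close> b(1) c(2) G(2) by (intro exI[of _ "sng b (\<kappa> * entry g c)"]) simp
  qed
  have K2_Q: "\<exists>d. yoneda_generated X I P n m d \<and> (\<forall>i\<in>bas Q n. entry g i = apply_cochain d (G n i))"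
    if "g \<in> cochains Q n m" for n m g
    by (rule P.K2_module_generated[OF Q LE I2 G(1)[unfolded CQ_def] base that])
  have lfQ: "locally_finite (bas Q n) (bdeg Q n)" for n
    using Q by (auto simp: minimal_resolution_def graded_free_resolution_def locally_finite_def)
  interpret syzygy_tower X I J P PB b \<kappa> Q c R \<delta> \<pi> G
  proof (intro syzygy_tower.intro[OF P.trivial_resolution_axioms B.trivial_resolution_axioms] syzygy_tower_axioms.intro)
    show "entry f i = 0"
      if "\<And>u j. u \<in> bas PB p \<Longrightarrow> j \<in> bas Q 0 \<Longrightarrow> apply_cochain f (\<pi> p u 0 j) = 0" "i \<in> cbas (R p) 0" for p f i
      using shifts[of p] that by (simp add: shifts_def CQ_def)
    show "\<exists>h. (\<forall>i. entry h i \<noteq> 0 \<longrightarrow> i \<in> cbas (R (Suc p)) n \<and> cdeg (R (Suc p)) n i = m) \<and>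
        (\<forall>i\<in>cbas (R p) (Suc n). entry f i = apply_cochain h (\<delta> p n i))"
      if "\<And>u j. u \<in> bas PB p \<Longrightarrow> j \<in> bas Q (Suc n) \<Longrightarrow> apply_cochain f (\<pi> p u (Suc n) j) = 0"
        "\<And>i. entry f i \<noteq> 0 \<Longrightarrow> cdeg (R p) (Suc n) i = m" for p f n m
      using shifts[of p] that by (simp add: shifts_def CQ_def)
    show "chain_map X I (shift 1 (R p)) (R (Suc p)) 0 (\<delta> p)" for p
      using shifts[of p] by (simp add: shifts_def)
    show "entries_in J (\<delta> p 0 i \<odot> mat PB (Suc p) - cdiff (R p) 0 i)" if "i \<in> cbas (R p) 1" for p i
      using shifts[of p] that by (simp add: shifts_def)
    show "chain_map X I (complex_of Q) (R p) (- bdeg PB p u) (\<pi> p u)" if "u \<in> bas PB p" for p u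
      using shifts[of p] that by (simp add: shifts_def CQ_def)
    show "\<pi> p u 0 c = unit_row u" for p u using shifts[of p] by (simp add: shifts_def)
  qed (fact IJ P_R CQ[unfolded CQ_def] lfQ c R G[unfolded CQ_def] K2_B K2_Q)+
  show ?thesis
    unfolding K2_algebra_def using P cocycles_generated by blast
qed

end
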